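(* Let $\epsilon>0$, let $f:\mathbb{N}\to\mathbb{N}$ with $f(n)\ge n+1$, and let $g:\mathbb{R}_{+}\rightarrow\mathbb{R}_{+}$ be a strictly increasing, continuous function that vanishes only at $0$ with $\lim_{x\rightarrow\infty}g(x)=\infty$ and such that $\Omega_g\neq\emptyset$ (equivalently $g(x)\le x$ for all $x$). Let $\Xi_2^L(A)=\mathrm{Leb}(\widehat{\mathrm{Sp}}_{\epsilon}(A))$, where $\widehat{\mathrm{Sp}}_{\epsilon}(A)=\{z\in\mathbb{C}:\|R(z,A)\|^{-1}<\epsilon\}$ (for the self-adjoint classes $\Omega_\mathrm{D}$ and $\Omega_\mathrm{SA}$, $\Xi_2^L(A)=\mathrm{Leb}_{\mathbb{R}}(\widehat{\mathrm{Sp}}_{\epsilon}(A)\cap\mathbb{R})$). We have the following classifications: $$\Delta^G_1 \not\ni \{\Xi_2^L,\Omega_f,\Lambda_i\} \in \Sigma^A_1, \quad \Delta^G_1 \not\ni \{\Xi_2^L,\Omega_\mathrm{D},\Lambda_i\} \in \Sigma^A_1, \quad i=1,2,$$ and for $\Omega=\Omega_{\mathrm{B}},\Omega_\mathrm{SA}$, $\Omega_\mathrm{N}$ or $\Omega_g$, $$\Delta^G_2 \not\ni \{\Xi_2^L,\Omega,\Lambda_1 \} \in \Sigma^A_2,\quad \Delta^G_1 \not\ni \{\Xi_2^L,\Omega,\Lambda_2 \} \in \Sigma^A_1.$$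
   Context: **Operators.** $\{e_i\}_{i\in\mathbb{N}}$ is the canonical basis of $\mathcal{H}=l^2(\mathbb{N})$, $P_m$ is the orthogonal projection onto $\mathrm{span}\{e_1,\ldots,e_m\}$, $\mathrm{Sp}(A)$ is the spectrum, $R(z,A)=(A-zI)^{-1}$, and $\|R(z,A)\|^{-1}:=0$ if $z\in\mathrm{Sp}(A)$. $\Omega_{\mathrm{B}}=\mathcal{B}(l^2(\mathbb{N}))$ (bounded operators); $\Omega_\mathrm{N}$, $\Omega_\mathrm{SA}$: normal, respectively self-adjoint, operators in $\Omega_\mathrm{B}$; $\Omega_\mathrm{D}$: operators in $\Omega_{\mathrm{SA}}$ that are diagonal with respect to $\{e_i\}$. $\mathrm{Leb}$ is Lebesgue measure on $\mathbb{C}\cong\mathbb{R}^2$ and $\mathrm{Leb}_\mathbb{R}$ is Lebesgue measure on $\mathbb{R}$. For $f:\mathbb{N}\to\mathbb{N}$ with $f(n)\ge n+1$ let $D_{f,n}(A)=\max\{\|(I-P_{f(n)})AP_n\|,\|P_nA(I-P_{f(n)})\|\}$. $\Omega_f$ is the class of bounded operators $A$ for which one is given (as part of the input) a sequence $\{c_n(A)\}\subset\mathbb{Q}_{\ge0}$ with $D_{f,n}(A)\le c_n(A)$ and $c_n(A)\to0$ as $n\to\infty$. $\Omega_g$ is the class of $A\in\Omega_\mathrm{B}$ with $g(\mathrm{dist}(z,\mathrm{Sp}(A)))\le\|R(z,A)\|^{-1}$ for all $z\in\mathbb{C}$. **Evaluation sets.** $\Lambda_1=\{A\mapsto\langle Ae_j,e_i\rangle: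 i,j\in\mathbb{N}\}$; $\Lambda_2=\Lambda_1\cup\{A\mapsto\langle Ae_j,Ae_i\rangle,\ A\mapsto\langle A^*e_j,A^*e_i\rangle: i,j\in\mathbb{N}\}$. For classes involving $f$, the evaluations $A\mapsto f(n)$ and $A\mapsto c_n(A)$ ($n\in\mathbb{N}$) are added to $\Lambda_i$; for classes involving $g$, the constants $g(q)$, $q\in\mathbb{Q}_{\geq 0}$, are added; the notation $\Lambda_i$ is kept. The parameter $\epsilon$ is known to the algorithms. **Computational problems.** A computational problem $\{\Xi,\Omega,\mathcal{M},\Lambda\}$ (abbreviated $\{\Xi,\Omega,\Lambda\}$) consists of a domain $\Omega$, a set $\Lambda$ of complex-valued functions on $\Omega$ separating points of $\Omega$, a metric space $(\mathcal{M},d)$ and a map $\Xi:\Omega\to\mathcal{M}$. Here $\mathcal{M}=[0,\infty)$ with the Euclidean metric. A *general algorithm* is a map $\Gamma:\Omega\to\mathcal{M}$ such that for each $A\in\Omega$ there is a non-empty finite set $\Lambda_\Gamma(A)\subset\Lambda$ such that (i) $\Gamma(A)$ depends only on $\{h(A)\}_{h\in\Lambda_\Gamma(A)}$, and (ii) if $B\in\Omega$ satisfies $h(B)=h(A)$ for all $h\in\Lambda_\Gamma(A)$, then $\Lambda_\Gamma(B)=\Lambda_\Gamma(A)$ (hence $\Gamma(B)=\Gamma(A)$). A *tower of algorithms of height $k$* is a family of maps $\Gamma_{n_k},\Gamma_{n_k,n_{k-1}},\ldots,\Gamma_{n_k,\ldots,n_1}:\Omega\to\mathcal{M}$, $n_j\in\mathbb{N}$,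 where the $\Gamma_{n_k,\ldots,n_1}$ are general algorithms and for every $A$: $\Xi(A)=\lim_{n_k\to\infty}\Gamma_{n_k}(A)$ and $\Gamma_{n_k,\ldots,n_{j+1}}(A)=\lim_{n_j\to\infty}\Gamma_{n_k,\ldots,n_j}(A)$ for $j=k-1,\ldots,1$. It has type $G$ (general) with no further restriction. It has type $A$ (arithmetic) if moreover $\Lambda$ is countable and for each $A$ the map $(n_k,\ldots,n_1)\mapsto\Gamma_{n_k,\ldots,n_1}(A)$ is recursive, i.e. executable by a Blum–Shub–Smale machine (finitely many arithmetic operations and comparisons) with input $(n_k,\ldots,n_1)$ and an oracle for $\{h(A)\}_{h\in\Lambda}$ (by a Turing machine with such an oracle if all the evaluations are in $\mathbb{Q}+i\mathbb{Q}$), the output being a finite string of complex numbers identified with an element of $\mathcal{M}$. **SCI hierarchy** ($\alpha\in\{G,A\}$, $m\ge1$). $\Delta_1^\alpha$: problems for which there are type $\alpha$ algorithms $\{\Gamma_n\}$ with $d(\Gamma_n(A),\Xi(A))\le2^{-n}$ for all $n$ and $A\in\Omega$. $\Delta_{m+1}^\alpha$: problems with a type $\alpha$ tower of height at most $m$. $\Sigma_m^\alpha$: problems in $\Delta_{m+1}^\alpha$ having a type $\alpha$ tower of height $m$ with $\Gamma_{n_m}(A)\to\Xi(A)$ from below, i.e. $\Gamma_{n_m}(A)\le\Xi(A)$, for all $A\in\Omega$. "$\Delta\not\ni X\in\Sigma$" means $X\notin\Delta$ and $X\in\Sigma$. *)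

theory Defs
  imports "HOL-Analysis.Analysis"
begin

section \<open>The Hilbert space of square summable complex sequences\<close>

text \<open>Indices start at 0: the basis is basis_vec 0, basis_vec 1, ..., and proj m projects onto the span of the
  first m basis vectors.\<close>

typedef ell2 = "{x :: nat \<Rightarrow> complex. summable (\<lambda>n. (cmod (x n))\<^sup>2)}"
  morphisms coord Abs_ell2
  by (rule exI[of _ "\<lambda>_. 0"]) simp

setup_lifting type_definition_ell2

lemma square_summable_add:
  fixes x y :: "nat \<Rightarrow> complex"
  assumes "summable (\<lambda>n. (cmod (x n))\<^sup>2)" "summable (\<lambda>n. (cmod (y n))\<^sup>2)"
  shows "summable (\<lambda>n. (cmod (x n + y n))\<^sup>2)"
proof (rule summable_comparison_test')
  show "summable (\<lambda>n. 2 * ((cmod (x n))\<^sup>2 + (cmod (y n))\<^sup>2))"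
    by (intro summable_mult summable_add assms)
  fix n :: nat assume "0 \<le> n"
  have "(cmod (x n + y n))\<^sup>2 \<le> (cmod (x n) + cmod (y n))\<^sup>2"
    by (intro power_mono norm_triangle_ineq norm_ge_zero)
  also have "\<dots> \<le> 2 * ((cmod (x n))\<^sup>2 + (cmod (y n))\<^sup>2)"
    using sum_squares_bound[of "cmod (x n)" "cmod (y n)"] by (simp add: power2_sum algebra_simps)
  finally show "norm ((cmod (x n + y n))\<^sup>2) \<le> 2 * ((cmod (x n))\<^sup>2 + (cmod (y n))\<^sup>2)"
    by simp
qed

lemma square_summable_cmult:
  fixes x :: "nat \<Rightarrow> complex"
  assumes "summable (\<lambda>n. (cmod (x n))\<^sup>2)"
  shows "summable (\<lambda>n. (cmod (c * x n))\<^sup>2)"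
  using summable_mult[OF assms, of "(cmod c)\<^sup>2"] by (simp add: norm_mult power_mult_distrib)

lemma square_summable_mult:
  fixes x y :: "nat \<Rightarrow> complex"
  assumes "summable (\<lambda>n. (cmod (x n))\<^sup>2)" "summable (\<lambda>n. (cmod (y n))\<^sup>2)"
  shows "summable (\<lambda>n. x n * cnj (y n))"
proof (rule summable_comparison_test')
  show "summable (\<lambda>n. (cmod (x n))\<^sup>2 + (cmod (y n))\<^sup>2)"
    by (intro summable_add assms)
  fix n :: nat assume "0 \<le> n"
  have "2 * (cmod (x n) * cmod (y n)) \<le> (cmod (x n))\<^sup>2 + (cmod (y n))\<^sup>2"
    using sum_squares_bound[of "cmod (x n)" "cmod (y n)"] by simp
  moreover have "0 \<le> cmod (x n) * cmod (y n)" by simp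
  ultimately show "norm (x n * cnj (y n)) \<le> (cmod (x n))\<^sup>2 + (cmod (y n))\<^sup>2"
    unfolding norm_mult complex_mod_cnj by linarith
qed

lift_definition scaleC :: "complex \<Rightarrow> ell2 \<Rightarrow> ell2" (infixr \<open>*\<^sub>C\<close> 75)
  is "\<lambda>c x n. c * x n" by (rule square_summable_cmult)

lift_definition basis_vec :: "nat \<Rightarrow> ell2" is "\<lambda>i n. if n = i then 1 else 0"
proof -
  fix i :: nat
  have "(\<lambda>n. (cmod (if n = i then 1 else 0))\<^sup>2) = (\<lambda>n. if n = i then 1 else 0)" by auto
  then show "summable (\<lambda>n. (cmod (if n = i then 1 else 0))\<^sup>2)" by simp
qed

definition cinner :: "ell2 \<Rightarrow> ell2 \<Rightarrow> complex" (\<open>\<llangle>_, _\<rrangle>\<close>) where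
  "\<llangle>x, y\<rrangle> = (\<Sum>n. coord x n * cnj (coord y n))"

instantiation ell2 :: real_vector
begin
lift_definition zero_ell2 :: ell2 is "\<lambda>_. 0" by simp
lift_definition plus_ell2 :: "ell2 \<Rightarrow> ell2 \<Rightarrow> ell2" is "\<lambda>x y n. x n + y n"
  by (rule square_summable_add)
lift_definition uminus_ell2 :: "ell2 \<Rightarrow> ell2" is "\<lambda>x n. - x n" by simp
lift_definition minus_ell2 :: "ell2 \<Rightarrow> ell2 \<Rightarrow> ell2" is "\<lambda>x y n. x n - y n"
proof -
  fix x y :: "nat \<Rightarrow> complex"
  assume "summable (\<lambda>n. (cmod (x n))\<^sup>2)" "summable (\<lambda>n. (cmod (y n))\<^sup>2)"
  then show "summable (\<lambda>n. (cmod (x n - y n))\<^sup>2)"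
    using square_summable_add[of x "\<lambda>n. - y n"] by simp
qed
lift_definition scaleR_ell2 :: "real \<Rightarrow> ell2 \<Rightarrow> ell2" is "\<lambda>r x n. r *\<^sub>R x n"
  by (simp add: scaleR_conv_of_real square_summable_cmult)
instance by standard (transfer; simp add: fun_eq_iff algebra_simps)+
end

text \<open>The class \<^class>\<open>real_inner\<close> supplies the norm; its inner product is the real part of
  \<^const>\<open>cinner\<close>, so that the norm is the usual one.\<close>

instantiation ell2 :: real_inner
begin
definition inner_ell2 :: "ell2 \<Rightarrow> ell2 \<Rightarrow> real" where "inner_ell2 x y = Re \<llangle>x, y\<rrangle>"
definition norm_ell2 :: "ell2 \<Rightarrow> real" where "norm_ell2 x = sqrt (inner x x)"
definition sgn_ell2 :: "ell2 \<Rightarrow> ell2" where "sgn_ell2 x = x /\<^sub>R norm x"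
definition dist_ell2 :: "ell2 \<Rightarrow> ell2 \<Rightarrow> real" where "dist_ell2 x y = norm (x - y)"
definition uniformity_ell2 :: "(ell2 \<times> ell2) filter" where
  "uniformity_ell2 = (INF e\<in>{0<..}. principal {(x, y). dist x y < e})"
definition open_ell2 :: "ell2 set \<Rightarrow> bool" where
  "open_ell2 U \<longleftrightarrow> (\<forall>x\<in>U. \<forall>\<^sub>F (x', y) in uniformity. x' = x \<longrightarrow> y \<in> U)"
instance
proof
  have summ: "summable (\<lambda>n. coord x n * cnj (coord y n))" for x y
    using coord[of x] coord[of y] by (auto intro: square_summable_mult)
  have summR: "summable (\<lambda>n. Re (coord x n * cnj (coord y n)))" for x y
    using summ[of x y] by (rule summable_Re)
  have inner_eq: "inner x y = (\<Sum>n. Re (coord x n * cnj (coord y n)))" for x y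
    unfolding inner_ell2_def cinner_def using summ[of x y] by (rule Re_suminf)
  have self: "inner x x = (\<Sum>n. (cmod (coord x n))\<^sup>2)" for x
    unfolding inner_eq by (intro suminf_cong) (simp add: complex_norm_square[symmetric] flip: of_real_power)
  fix x y z :: ell2 and r :: real
  show "sgn x = x /\<^sub>R norm x" by (simp add: sgn_ell2_def)
  show "dist x y = norm (x - y)" by (simp add: dist_ell2_def)
  show "(uniformity :: (ell2 \<times> ell2) filter) = (INF e\<in>{0<..}. principal {(x, y). dist x y < e})"
    by (simp add: uniformity_ell2_def)
  show "open U \<longleftrightarrow> (\<forall>x\<in>U. \<forall>\<^sub>F (x', y) in uniformity. x' = x \<longrightarrow> y \<in> U)" for U :: "ell2 set"
    by (simp add: open_ell2_def)
  show "inner x y = inner y x"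
    unfolding inner_eq by (simp add: algebra_simps)
  show "inner (x + y) z = inner x z + inner y z"
    unfolding inner_eq by (subst suminf_add[OF summR summR]) (simp add: plus_ell2.rep_eq algebra_simps)
  show "inner (r *\<^sub>R x) y = r * inner x y"
    unfolding inner_eq by (subst suminf_mult[OF summR, symmetric]) (simp add: scaleR_ell2.rep_eq algebra_simps)
  have sq: "summable (\<lambda>n. (cmod (coord x n))\<^sup>2)" using coord[of x] by simp
  show "0 \<le> inner x x" unfolding self by (rule suminf_nonneg[OF sq]) simp
  show "inner x x = 0 \<longleftrightarrow> x = 0"
    unfolding self by (subst suminf_eq_zero_iff[OF sq]) (auto simp: zero_ell2.rep_eq coord_inject[symmetric])
  show "norm x = sqrt (inner x x)" by (simp add: norm_ell2_def)
qed
end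

lemma norm_ell2_sqrt_suminf: "norm x = sqrt (\<Sum>n. (cmod (coord x n))\<^sup>2)"
proof -
  have "summable (\<lambda>n. coord x n * cnj (coord x n))"
    using coord[of x] by (auto intro: square_summable_mult)
  from Re_suminf[OF this] have "inner x x = (\<Sum>n. (cmod (coord x n))\<^sup>2)"
    unfolding inner_ell2_def cinner_def
    by (simp add: complex_norm_square[symmetric] flip: of_real_power)
  then show ?thesis by (simp add: norm_ell2_def)
qed


section \<open>Bounded operators, spectrum and pseudospectrum\<close>

type_synonym operator = "ell2 \<Rightarrow>\<^sub>L ell2"

text \<open>Elements of \<^typ>\<open>operator\<close> are only real linear; membership in Omega_B adds
  complex linearity.\<close>

definition Omega_B :: "operator set" where
  "Omega_B = {A :: operator. \<forall>c x. blinfun_apply A (c *\<^sub>C x) = c *\<^sub>C blinfun_apply A x}"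

lift_definition truncate :: "nat \<Rightarrow> ell2 \<Rightarrow> ell2" is "\<lambda>m x n. if n < m then x n else 0"
  by (erule summable_comparison_test'[where N = 0]) simp

lift_definition proj :: "nat \<Rightarrow> operator" is truncate
proof -
  fix m
  show "bounded_linear (truncate m)"
  proof (rule bounded_linear_intro[where K = 1])
    fix x y :: ell2 and r :: real
    show "truncate m (x + y) = truncate m x + truncate m y" by transfer auto
    show "truncate m (r *\<^sub>R x) = r *\<^sub>R truncate m x" by transfer auto
    show "norm (truncate m x) \<le> norm x * 1"
      unfolding norm_ell2_sqrt_suminf using coord[of x] coord[of "truncate m x"]
      by (auto intro!: suminf_le simp: truncate.rep_eq)
  qed
qed

lift_definition scalar_op :: "complex \<Rightarrow> operator" is "scaleC"
proof -
  fix c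
  show "bounded_linear (scaleC c)"
  proof (rule bounded_linear_intro[where K = "cmod c"])
    fix x y :: ell2 and r :: real
    show "c *\<^sub>C (x + y) = c *\<^sub>C x + c *\<^sub>C y" by transfer (simp add: algebra_simps)
    show "c *\<^sub>C (r *\<^sub>R x) = r *\<^sub>R (c *\<^sub>C x)" by transfer (simp add: algebra_simps)
    have "summable (\<lambda>n. (cmod (coord x n))\<^sup>2)" using coord[of x] by simp
    then have "(\<Sum>n. (cmod (coord (c *\<^sub>C x) n))\<^sup>2) = (cmod c)\<^sup>2 * (\<Sum>n. (cmod (coord x n))\<^sup>2)"
      by (simp add: scaleC.rep_eq norm_mult power_mult_distrib suminf_mult)
    then show "norm (c *\<^sub>C x) \<le> norm x * cmod c"
      unfolding norm_ell2_sqrt_suminf by (simp add: real_sqrt_mult)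
  qed
qed

definition is_inverse :: "operator \<Rightarrow> operator \<Rightarrow> bool" where
  "is_inverse T B \<longleftrightarrow> B \<in> Omega_B \<and> B o\<^sub>L T = id_blinfun \<and> T o\<^sub>L B = id_blinfun"

definition Sp :: "operator \<Rightarrow> complex set" where
  "Sp A = {z. \<not> (\<exists>B. is_inverse (A - scalar_op z) B)}"

definition resolvent :: "complex \<Rightarrow> operator \<Rightarrow> operator" where
  "resolvent z A = (THE B. is_inverse (A - scalar_op z) B)"

definition inv_resolvent_norm :: "complex \<Rightarrow> operator \<Rightarrow> real" where
  "inv_resolvent_norm z A = (if z \<in> Sp A then 0 else inverse (norm (resolvent z A)))"

definition pseudospectrum :: "real \<Rightarrow> operator \<Rightarrow> complex set" where
  "pseudospectrum \<epsilon> A = {z. inv_resolvent_norm z A < \<epsilon>}"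

definition Leb_pseudospectrum :: "real \<Rightarrow> operator \<Rightarrow> real" where
  "Leb_pseudospectrum \<epsilon> A = measure lebesgue (pseudospectrum \<epsilon> A)"

definition LebR_pseudospectrum :: "real \<Rightarrow> operator \<Rightarrow> real" where
  "LebR_pseudospectrum \<epsilon> A = measure lebesgue {t :: real. complex_of_real t \<in> pseudospectrum \<epsilon> A}"


section \<open>Classes of operators\<close>

definition adj :: "operator \<Rightarrow> operator" where
  "adj A = (THE B. B \<in> Omega_B \<and> (\<forall>x y. \<llangle>A x, y\<rrangle> = \<llangle>x, B y\<rrangle>))"

definition Omega_N :: "operator set" where
  "Omega_N = {A \<in> Omega_B. A o\<^sub>L adj A = adj A o\<^sub>L A}"

definition Omega_SA :: "operator set" where
  "Omega_SA = {A \<in> Omega_B. adj A = A}"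

definition Omega_D :: "operator set" where
  "Omega_D = {A \<in> Omega_SA. \<forall>i j. i \<noteq> j \<longrightarrow> \<llangle>A (basis_vec j), basis_vec i\<rrangle> = 0}"

definition Omega_g :: "(real \<Rightarrow> real) \<Rightarrow> operator set" where
  "Omega_g g = {A \<in> Omega_B. \<forall>z. g (infdist z (Sp A)) \<le> inv_resolvent_norm z A}"

definition dispersion :: "(nat \<Rightarrow> nat) \<Rightarrow> nat \<Rightarrow> operator \<Rightarrow> real" where
  "dispersion f n A = max (norm ((id_blinfun - proj (f n)) o\<^sub>L A o\<^sub>L proj n))
                          (norm (proj n o\<^sub>L A o\<^sub>L (id_blinfun - proj (f n))))"

text \<open>An input from this class is an operator together with its dispersion bounds c.\<close>

definition Omega_f :: "(nat \<Rightarrow> nat) \<Rightarrow> (operator \<times> (nat \<Rightarrow> rat)) set" where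
  "Omega_f f = {(A, c). A \<in> Omega_B \<and> (\<forall>n. 0 \<le> c n \<and> dispersion f n A \<le> of_rat (c n)) \<and>
                        (\<lambda>n. real_of_rat (c n)) \<longlonglongrightarrow> 0}"


section \<open>Computational problems and general algorithms\<close>

text \<open>Each evaluation function carries a name, consisting of a label and a finite list of natural
  numbers, by which a machine can address it. The set Lambda of the problem is \<open>evaluations P\<close>;
  the names play no role for general algorithms. The metric space is the half line with
  the Euclidean metric.\<close>

type_synonym ('a, 'l) evals = "'l \<Rightarrow> nat list \<Rightarrow> ('a \<Rightarrow> complex) option"

record ('a, 'l) problem =
  Xi :: "'a \<Rightarrow> real"
  Dom :: "'a set"
  Lam :: "('a, 'l) evals"

definition evaluations :: "('a, 'l) problem \<Rightarrow> ('a \<Rightarrow> complex) set" where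
  "evaluations P = {h. \<exists>l w. Lam P l w = Some h}"

definition computational_problem :: "('a, 'l) problem \<Rightarrow> bool" where
  "computational_problem P \<longleftrightarrow>
     Xi P \<in> Dom P \<rightarrow> {0..} \<and>
     (\<forall>A\<in>Dom P. \<forall>B\<in>Dom P. (\<forall>h\<in>evaluations P. h A = h B) \<longrightarrow> A = B)"

definition general_algorithm :: "('a, 'l) problem \<Rightarrow> ('a \<Rightarrow> real) \<Rightarrow> bool" where
  "general_algorithm P \<Gamma> \<longleftrightarrow>
     \<Gamma> \<in> Dom P \<rightarrow> {0..} \<and>
     (\<exists>L :: 'a \<Rightarrow> ('a \<Rightarrow> complex) set. \<forall>A\<in>Dom P.
        finite (L A) \<and> L A \<noteq> {} \<and> L A \<subseteq> evaluations P \<and>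
        (\<forall>B\<in>Dom P. (\<forall>h\<in>L A. h B = h A) \<longrightarrow> L B = L A \<and> \<Gamma> B = \<Gamma> A))"


section \<open>Blum-Shub-Smale machines with an oracle\<close>

text \<open>Flowchart machines over the reals with countably many registers, indirect addressing and
  branching on the sign of a register. A complex number is a pair of real registers:
  \<open>Ask d l rs\<close> puts the real and imaginary part of an oracle value in registers d and d + 1, the
  name of the value being the label l with the numbers stored in the registers rs. Register contents used as addresses or in names
  are rounded down to a natural number, and division by 0 gives 0; both conventions can be
  realised by comparisons.

  The constants of a program are restricted (see \<open>consts_of\<close> and its use below) to rationals
  and known parameters. If the parameters and all oracle values are rational, then so is every
  register content at all times, and executability by such a machine is
  executability by a Turing machine with the same oracle.\<close>

datatype 'l instr =
    Const nat real
  | Add nat nat nat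
  | Sub nat nat nat
  | Mul nat nat nat
  | Div nat nat nat
  | Load nat nat
  | Store nat nat
  | Ask nat 'l "nat list"
  | JumpNeg nat nat

type_synonym registers = "nat \<Rightarrow> real"

definition addr :: "real \<Rightarrow> nat" where "addr x = nat \<lfloor>x\<rfloor>"

primrec exec :: "('l \<Rightarrow> nat list \<Rightarrow> complex) \<Rightarrow> 'l instr \<Rightarrow> nat \<times> registers \<Rightarrow> nat \<times> registers" where
  "exec orc (Const d c) st = (case st of (pc, s) \<Rightarrow> (pc + 1, s(d := c)))"
| "exec orc (Add d a b) st = (case st of (pc, s) \<Rightarrow> (pc + 1, s(d := s a + s b)))"
| "exec orc (Sub d a b) st = (case st of (pc, s) \<Rightarrow> (pc + 1, s(d := s a - s b)))"
| "exec orc (Mul d a b) st = (case st of (pc, s) \<Rightarrow> (pc + 1, s(d := s a * s b)))"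
| "exec orc (Div d a b) st = (case st of (pc, s) \<Rightarrow> (pc + 1, s(d := s a / s b)))"
| "exec orc (Load d a) st = (case st of (pc, s) \<Rightarrow> (pc + 1, s(d := s (addr (s a)))))"
| "exec orc (Store d a) st = (case st of (pc, s) \<Rightarrow> (pc + 1, s(addr (s d) := s a)))"
| "exec orc (Ask d l rs) st = (case st of (pc, s) \<Rightarrow>
     (let v = orc l (map (\<lambda>r. addr (s r)) rs) in (pc + 1, s(d := Re v, Suc d := Im v))))"
| "exec orc (JumpNeg a t) st = (case st of (pc, s) \<Rightarrow> (if s a < 0 then t else pc + 1, s))"

definition step :: "('l \<Rightarrow> nat list \<Rightarrow> complex) \<Rightarrow> 'l instr list \<Rightarrow> nat \<times> registers \<Rightarrow> nat \<times> registers" where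
  "step orc p st = (if fst st < length p then exec orc (p ! fst st) st else st)"

definition input :: "nat list \<Rightarrow> registers" where
  "input ns = (\<lambda>i. if i < length ns then real (ns ! i) else 0)"

text \<open>A machine halts when its program counter leaves the program; the output is in register 0.\<close>

definition computes :: "('l \<Rightarrow> nat list \<Rightarrow> complex) \<Rightarrow> 'l instr list \<Rightarrow> nat list \<Rightarrow> real \<Rightarrow> bool" where
  "computes orc p ns y \<longleftrightarrow>
     (\<exists>t pc s. (step orc p ^^ t) (0, input ns) = (pc, s) \<and> length p \<le> pc \<and> s 0 = y)"

definition consts_of :: "'l instr list \<Rightarrow> real set" where
  "consts_of p = {c. \<exists>d. Const d c \<in> set p}"

definition oracle_of :: "('a, 'l) problem \<Rightarrow> 'a \<Rightarrow> 'l \<Rightarrow> nat list \<Rightarrow> complex" where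
  "oracle_of P A l w = (case Lam P l w of Some h \<Rightarrow> h A | None \<Rightarrow> 0)"


section \<open>Towers of algorithms and the SCI hierarchy\<close>

text \<open>\<open>Arithmetic K\<close> is the arithmetic type when the real parameters in K are known
  to the algorithms. \<open>\<Gamma> [n\<^sub>k, \<dots>, n\<^sub>j]\<close> stands for the map with these indices, and the
  algorithms proper are those with k indices. One machine serves all inputs.\<close>

datatype tower_type = General | Arithmetic "real set"

definition algorithms ::
  "tower_type \<Rightarrow> ('a, 'l) problem \<Rightarrow> nat \<Rightarrow> (nat list \<Rightarrow> 'a \<Rightarrow> real) \<Rightarrow> bool" where
  "algorithms \<alpha> P k \<Gamma> \<longleftrightarrow>
     (\<forall>ns. length ns = k \<longrightarrow> general_algorithm P (\<Gamma> ns)) \<and>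
     (case \<alpha> of General \<Rightarrow> True
      | Arithmetic K \<Rightarrow> countable (evaluations P) \<and>
          (\<exists>p. consts_of p \<subseteq> \<rat> \<union> K \<and>
             (\<forall>A\<in>Dom P. \<forall>ns. length ns = k \<longrightarrow> computes (oracle_of P A) p ns (\<Gamma> ns A))))"

definition tower ::
  "tower_type \<Rightarrow> ('a, 'l) problem \<Rightarrow> nat \<Rightarrow> (nat list \<Rightarrow> 'a \<Rightarrow> real) \<Rightarrow> bool" where
  "tower \<alpha> P k \<Gamma> \<longleftrightarrow>
     1 \<le> k \<and> algorithms \<alpha> P k \<Gamma> \<and>
     (\<forall>ns. 1 \<le> length ns \<and> length ns \<le> k \<longrightarrow> \<Gamma> ns \<in> Dom P \<rightarrow> {0..}) \<and>
     (\<forall>A\<in>Dom P.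
        (\<lambda>n. \<Gamma> [n] A) \<longlonglongrightarrow> Xi P A \<and>
        (\<forall>ns. 1 \<le> length ns \<and> length ns < k \<longrightarrow> (\<lambda>n. \<Gamma> (ns @ [n]) A) \<longlonglongrightarrow> \<Gamma> ns A))"

text \<open>The classes are indexed from 1; the value at 0 is irrelevant.\<close>

definition SCI_Delta :: "tower_type \<Rightarrow> nat \<Rightarrow> ('a, 'l) problem set" where
  "SCI_Delta \<alpha> m = {P. computational_problem P \<and>
     (if m = 1
      then \<exists>\<Gamma>. algorithms \<alpha> P 1 \<Gamma> \<and> (\<forall>n. \<forall>A\<in>Dom P. dist (\<Gamma> [n] A) (Xi P A) \<le> 1 / 2 ^ n)
      else \<exists>k \<Gamma>. k < m \<and> tower \<alpha> P k \<Gamma>)}"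

definition SCI_Sigma :: "tower_type \<Rightarrow> nat \<Rightarrow> ('a, 'l) problem set" where
  "SCI_Sigma \<alpha> m = {P \<in> SCI_Delta \<alpha> (Suc m).
     \<exists>\<Gamma>. tower \<alpha> P m \<Gamma> \<and> (\<forall>n. \<forall>A\<in>Dom P. \<Gamma> [n] A \<le> Xi P A)}"


section \<open>Evaluation sets\<close>

datatype label = Entry | Gram | AdjGram | F_val | C_val | G_val

text \<open>The parameter op extracts the operator from an element of the domain.\<close>

fun Lambda1 :: "('a \<Rightarrow> operator) \<Rightarrow> ('a, label) evals" where
  "Lambda1 op Entry [i, j] = Some (\<lambda>X. \<llangle>op X (basis_vec j), basis_vec i\<rrangle>)"
| "Lambda1 op _ _ = None"

fun Lambda2 :: "('a \<Rightarrow> operator) \<Rightarrow> ('a, label) evals" where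
  "Lambda2 op Gram [i, j] = Some (\<lambda>X. \<llangle>op X (basis_vec j), op X (basis_vec i)\<rrangle>)"
| "Lambda2 op AdjGram [i, j] = Some (\<lambda>X. \<llangle>adj (op X) (basis_vec j), adj (op X) (basis_vec i)\<rrangle>)"
| "Lambda2 op l w = Lambda1 op l w"

fun add_f :: "(nat \<Rightarrow> nat) \<Rightarrow> (operator \<times> (nat \<Rightarrow> rat), label) evals
    \<Rightarrow> (operator \<times> (nat \<Rightarrow> rat), label) evals" where
  "add_f f \<Lambda> F_val [n] = Some (\<lambda>_. of_nat (f n))"
| "add_f f \<Lambda> C_val [n] = Some (\<lambda>X. of_rat (snd X n))"
| "add_f f \<Lambda> l w = \<Lambda> l w"

text \<open>A nonnegative rational is named by a numerator and a predecessor of a denominator.\<close>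

fun add_g :: "(real \<Rightarrow> real) \<Rightarrow> (operator, label) evals \<Rightarrow> (operator, label) evals" where
  "add_g g \<Lambda> G_val [a, b] = Some (\<lambda>_. complex_of_real (g (real a / real (Suc b))))"
| "add_g g \<Lambda> l w = \<Lambda> l w"

end

theory Submission
  imports Defs "HOL-Complex_Analysis.Cauchy_Integral_Formula"
begin

text \<open>
  The number \<open>\<parallel>R(z, A)\<parallel>\<^sup>-\<^sup>1\<close> is the largest e such that \<open>\<parallel>(A - z) x\<parallel> \<ge> e \<parallel>x\<parallel>\<close> and \<open>\<parallel>(A\<^sup>* -
  cnj z) x\<parallel> \<ge> e \<parallel>x\<parallel>\<close> for all x (\<open>le_inv_resolvent_norm_iff\<close>). Hence z belongs to the
  pseudospectrum if and only if a single vector x certifies it, and by density x may be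
  taken finitely supported with Gaussian integer coordinates. If the inequality for x holds
  at z with a margin of \<open>\<delta>\<close>, it puts the whole disc of radius \<open>\<delta>\<close> around z into the
  pseudospectrum.

  Upper bounds. At stage n, with N = n + 1, cover a square of side 2 N (in the self-adjoint
  case, an interval) by a grid of mesh 1 / N, accept a cell if one of finitely many Gaussian
  integer vectors certifies its corner with a margin of 2 / N, and return the total area of
  the accepted cells. It is a lower bound for the measure of the pseudospectrum, and it
  converges since every point lies in accepted cells from some stage on
  (\<open>grid_volume_approximation\<close>). What remains is to compare \<open>\<parallel>(A - z) x\<parallel>\<close> with \<open>r \<parallel>x\<parallel>\<close> for a
  test vector x. With Gram matrices this is exact. A known dispersion gives \<open>\<parallel>P\<^sub>M (A - z)
  x\<parallel>\<close> with an error that can be subtracted from the radius. From matrix entries alone one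
  has only \<open>\<parallel>P\<^sub>M (A - z) x\<parallel>\<close>, which increases with M; acceptance then changes at most once
  as M grows, and M becomes the index of an inner limit (\<open>grid_volume_truncated\<close>).

  To obtain machines, the algorithm is written as an expression of a small language with
  finite sums and products, for which a compiler to flowchart programs is verified
  (\<open>compile_correct\<close>). The same syntax shows that a computation depends on finitely many
  evaluations (\<open>eval_queries_cong\<close>).

  Lower bounds. The measure of the pseudospectrum counts the eigenvalues of an operator with
  finitely many well separated real ones that is built from blocks of size one and two. A
  finite set of evaluations of 0 does not exclude one more eigenvalue further down the
  diagonal, so there is no error control (\<open>not_Delta1_if_diagonal\<close>). With matrix entries
  only, an entry s on the diagonal is either an eigenvalue of its own or part of a block
  with all four entries s, whose second index is too large to have been read, and whose
  eigenvalues are 0 and 2 s. Extending an operator step by step by such blocks makes a given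
  sequence of general algorithms report the eigenvalue s infinitely often, although the
  final operator does not have it (\<open>not_Delta2_if_block_operators\<close>). These operators are
  self-adjoint, and they belong to the class given by g because \<open>g(x) \<le> x\<close>, which follows
  from the existence of a member of that class and the non-emptiness of its spectrum.
\<close>

section \<open>Square summable sequences as a Hilbert space\<close>

lemmas coord_simps [simp] =
  plus_ell2.rep_eq minus_ell2.rep_eq uminus_ell2.rep_eq zero_ell2.rep_eq scaleR_ell2.rep_eq
  scaleC.rep_eq basis_vec.rep_eq

lemma coord_proj [simp]: "coord (proj m x) n = (if n < m then coord x n else 0)"
  by (simp add: proj.rep_eq truncate.rep_eq)

lemma ell2_eqI: "(\<And>i. coord x i = coord y i) \<Longrightarrow> x = y"
  by (simp add: coord_inject[symmetric] fun_eq_iff)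

lemma summable_coord [simp]: "summable (\<lambda>n. (cmod (coord x n))\<^sup>2)"
  using coord[of x] by simp

lemma norm_ell2_square: "(norm x)\<^sup>2 = (\<Sum>n. (cmod (coord x n))\<^sup>2)"
  unfolding norm_ell2_sqrt_suminf by (simp add: suminf_nonneg)

lemma summable_cinner [simp]: "summable (\<lambda>n. coord x n * cnj (coord y n))"
  by (simp add: square_summable_mult)

lemma cinner_add_left: "\<llangle>x + y, z\<rrangle> = \<llangle>x, z\<rrangle> + \<llangle>y, z\<rrangle>"
  unfolding cinner_def by (subst suminf_add) (auto simp: algebra_simps)

lemma cinner_scaleC_left: "\<llangle>c *\<^sub>C x, y\<rrangle> = c * \<llangle>x, y\<rrangle>"
  unfolding cinner_def by (subst suminf_mult[symmetric]) (auto simp: algebra_simps)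

lemma cinner_commute: "\<llangle>y, x\<rrangle> = cnj \<llangle>x, y\<rrangle>"
proof -
  have "(\<lambda>n. coord x n * cnj (coord y n)) sums \<llangle>x, y\<rrangle>"
    unfolding cinner_def by (rule summable_sums) simp
  hence "(\<lambda>n. coord y n * cnj (coord x n)) sums cnj \<llangle>x, y\<rrangle>"
    by (subst (asm) sums_cnj[symmetric]) (simp add: mult.commute)
  thus ?thesis unfolding cinner_def by (simp add: sums_iff)
qed

lemma scaleR_scaleC: "r *\<^sub>R x = complex_of_real r *\<^sub>C x"
  by (rule ell2_eqI) (simp add: scaleR_conv_of_real)

lemma cinner_self: "\<llangle>x, x\<rrangle> = complex_of_real ((norm x)\<^sup>2)"
proof -
  have "Im \<llangle>x, x\<rrangle> = 0" using cinner_commute[of x x] by (simp add: complex_eq_iff)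
  moreover have "Re \<llangle>x, x\<rrangle> = (norm x)\<^sup>2" by (simp add: power2_norm_eq_inner inner_ell2_def)
  ultimately show ?thesis by (simp add: complex_eq_iff)
qed

lemma norm_scaleC: "norm (c *\<^sub>C x) = cmod c * norm x"
proof -
  have "\<llangle>c *\<^sub>C x, c *\<^sub>C x\<rrangle> = (c * cnj c) * \<llangle>x, x\<rrangle>"
    by (metis cinner_commute cinner_scaleC_left complex_cnj_mult mult.assoc)
  hence "complex_of_real ((norm (c *\<^sub>C x))\<^sup>2) = complex_of_real ((cmod c * norm x)\<^sup>2)"
    unfolding cinner_self complex_norm_square[symmetric] by (simp add: power_mult_distrib)
  hence "(norm (c *\<^sub>C x))\<^sup>2 = (cmod c * norm x)\<^sup>2" by (simp only: of_real_eq_iff)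
  thus ?thesis by (simp add: power2_eq_iff_nonneg)
qed

lemma cinner_Cauchy_Schwarz: "cmod \<llangle>x, y\<rrangle> \<le> norm x * norm y"
proof (cases "\<llangle>x, y\<rrangle> = 0")
  case False
  define c where "c = cnj \<llangle>x, y\<rrangle> / cmod \<llangle>x, y\<rrangle>"
  have c: "cmod c = 1" using False by (simp add: c_def norm_divide)
  have "cmod \<llangle>x, y\<rrangle> = Re \<llangle>c *\<^sub>C x, y\<rrangle>"
    using False by (simp add: cinner_scaleC_left c_def complex_norm_square[symmetric]
        mult.commute[of "cnj _"] power2_eq_square)
  also have "\<dots> \<le> norm (c *\<^sub>C x) * norm y"
    using norm_cauchy_schwarz[of "c *\<^sub>C x" y] by (simp add: inner_ell2_def)
  finally show ?thesis by (simp add: norm_scaleC c)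
qed simp

interpretation cinner: bounded_bilinear cinner
proof
  fix x y z :: ell2 and r :: real
  show "\<llangle>x + y, z\<rrangle> = \<llangle>x, z\<rrangle> + \<llangle>y, z\<rrangle>" by (rule cinner_add_left)
  show "\<llangle>x, y + z\<rrangle> = \<llangle>x, y\<rrangle> + \<llangle>x, z\<rrangle>"
    by (metis cinner_add_left cinner_commute complex_cnj_add)
  show "\<llangle>r *\<^sub>R x, y\<rrangle> = r *\<^sub>R \<llangle>x, y\<rrangle>"
    by (simp add: scaleR_scaleC cinner_scaleC_left scaleR_conv_of_real)
  thus "\<llangle>x, r *\<^sub>R y\<rrangle> = r *\<^sub>R \<llangle>x, y\<rrangle>"
    by (metis cinner_commute complex_cnj_complex_of_real complex_cnj_mult scaleR_conv_of_real
        cinner_scaleC_left scaleR_scaleC)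
  show "\<exists>K. \<forall>a b. cmod \<llangle>a, b\<rrangle> \<le> norm a * norm b * K"
    by (rule exI[of _ 1]) (simp add: cinner_Cauchy_Schwarz)
qed

lemma cinner_scaleC_right: "\<llangle>x, c *\<^sub>C y\<rrangle> = cnj c * \<llangle>x, y\<rrangle>"
  by (metis cinner_commute cinner_scaleC_left complex_cnj_mult)

interpretation scaleC: bounded_bilinear scaleC
proof
  fix a a' r :: complex and b b' :: ell2 and t :: real
  show "(a + a') *\<^sub>C b = a *\<^sub>C b + a' *\<^sub>C b" by (rule ell2_eqI) (simp add: algebra_simps)
  show "a *\<^sub>C (b + b') = a *\<^sub>C b + a *\<^sub>C b'" by (rule ell2_eqI) (simp add: algebra_simps)
  show "(t *\<^sub>R a) *\<^sub>C b = t *\<^sub>R (a *\<^sub>C b)" by (rule ell2_eqI) simp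
  show "a *\<^sub>C (t *\<^sub>R b) = t *\<^sub>R (a *\<^sub>C b)" by (rule ell2_eqI) simp
  show "\<exists>K. \<forall>a b. norm (a *\<^sub>C b) \<le> cmod a * norm b * K"
    by (rule exI[of _ 1]) (simp add: norm_scaleC)
qed

lemma scaleC_scaleC [simp]: "a *\<^sub>C (b *\<^sub>C x) = (a * b) *\<^sub>C x"
  by (rule ell2_eqI) simp

lemma cinner_basis_vec: "\<llangle>x, basis_vec i\<rrangle> = coord x i"
proof -
  have "(\<lambda>n. coord x n * cnj (coord (basis_vec i) n)) = (\<lambda>n. if n = i then coord x i else 0)"
    by auto
  thus ?thesis unfolding cinner_def by (simp add: sums_iff[THEN iffD1, OF sums_single, THEN conjunct2])
qed

lemma norm_basis_vec [simp]: "norm (basis_vec i) = 1"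
  using cinner_self[of "basis_vec i"] cinner_basis_vec[of "basis_vec i" i]
  by (metis abs_norm_cancel coord_simps(7) of_real_eq_1_iff power2_eq_1_iff abs_minus_cancel abs_1)

lemma coord_sum: "coord (\<Sum>i\<in>I. f i) j = (\<Sum>i\<in>I. coord (f i) j)"
  by (induction I rule: infinite_finite_induct) auto

lemma proj_eq_sum: "proj n x = (\<Sum>j<n. coord x j *\<^sub>C basis_vec j)"
  by (rule ell2_eqI) (simp add: coord_sum if_distrib cong: if_cong)

lemma norm_proj_square: "(norm (proj n x))\<^sup>2 = (\<Sum>i<n. (cmod (coord x i))\<^sup>2)"
  unfolding norm_ell2_square by (subst suminf_finite[of "{..<n}"]) auto

lemma norm_proj_le: "norm (proj n x) \<le> norm x"
  by (rule power2_le_imp_le, unfold norm_proj_square, unfold norm_ell2_square) (auto intro!: sum_le_suminf)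

lemma norm_proj_mono: "m \<le> n \<Longrightarrow> norm (proj m x) \<le> norm (proj n x)"
  by (rule power2_le_imp_le) (auto simp: norm_proj_square intro!: sum_mono2)

lemma proj_tendsto: "(\<lambda>n. proj n x) \<longlonglongrightarrow> x"
proof -
  have "(norm (proj n x - x))\<^sup>2 = (norm x)\<^sup>2 - (\<Sum>i<n. (cmod (coord x i))\<^sup>2)" for n
  proof -
    have "(norm (proj n x - x))\<^sup>2 = (\<Sum>i. (cmod (coord x i))\<^sup>2 - (cmod (coord (proj n x) i))\<^sup>2)"
      unfolding norm_ell2_square by (intro suminf_cong) auto
    also have "\<dots> = (norm x)\<^sup>2 - (norm (proj n x))\<^sup>2"
      unfolding norm_ell2_square by (intro suminf_diff[symmetric]) (rule summable_coord)+
    finally show ?thesis by (simp add: norm_proj_square)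
  qed
  moreover have "(\<lambda>n. (norm x)\<^sup>2 - (\<Sum>i<n. (cmod (coord x i))\<^sup>2)) \<longlonglongrightarrow> (norm x)\<^sup>2 - (norm x)\<^sup>2"
    unfolding norm_ell2_square by (intro tendsto_intros summable_LIMSEQ) simp
  ultimately have "(\<lambda>n. (norm (proj n x - x))\<^sup>2) \<longlonglongrightarrow> 0" by simp
  hence "(\<lambda>n. norm (proj n x - x)) \<longlonglongrightarrow> 0"
    using tendsto_real_sqrt by fastforce
  thus ?thesis by (simp add: LIM_zero_iff tendsto_norm_zero_iff)
qed

text \<open>Both the adjoint and limits of Cauchy sequences are found as sequences of
  coordinates whose partial square sums are bounded.\<close>

lemma ell2_eq_if_coord_summable:
  fixes a :: "nat \<Rightarrow> complex"
  assumes "\<And>n. (\<Sum>i<n. (cmod (a i))\<^sup>2) \<le> B\<^sup>2" "0 \<le> B"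
  shows "\<exists>y. coord y = a \<and> norm y \<le> B"
proof -
  have s: "summable (\<lambda>n. (cmod (a n))\<^sup>2)"
    by (rule bounded_imp_summable[of _ "B\<^sup>2"]) (use assms(1)[of "Suc _"] in \<open>auto simp: lessThan_Suc_atMost\<close>)
  have c: "coord (Abs_ell2 a) = a" by (rule Abs_ell2_inverse) (simp add: s)
  have "(norm (Abs_ell2 a))\<^sup>2 \<le> B\<^sup>2"
    unfolding norm_ell2_square c by (rule suminf_le_const[OF s assms(1)])
  thus ?thesis using c power2_le_imp_le[OF _ assms(2)] by blast
qed

text \<open>The coordinates of a Cauchy sequence converge, and a bound \<open>e\<close> on the square sums of
  \<open>X m - X n\<close> over finitely many coordinates survives the limit in n.\<close>

instance ell2 :: banach
proof
  fix X :: "nat \<Rightarrow> ell2" assume X: "Cauchy X"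
  have "Cauchy (\<lambda>n. coord (X n) i)" for i
    using cinner.bounded_linear_left[THEN bounded_linear.Cauchy, OF X, of "basis_vec i"]
    by (simp add: cinner_basis_vec)
  hence "\<exists>l. (\<lambda>n. coord (X n) i) \<longlonglongrightarrow> l" for i
    by (simp add: Cauchy_convergent_iff convergent_def)
  then obtain a where a: "\<And>i. (\<lambda>n. coord (X n) i) \<longlonglongrightarrow> a i" by metis
  have near: "\<exists>y. coord y = (\<lambda>i. coord (X m) i - a i) \<and> norm y \<le> e"
    if e: "e > 0" and M: "\<And>n. n \<ge> M \<Longrightarrow> norm (X m - X n) \<le> e" for e m M
  proof (rule ell2_eq_if_coord_summable)
    fix k
    show "(\<Sum>i<k. (cmod (coord (X m) i - a i))\<^sup>2) \<le> e\<^sup>2"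
    proof (rule tendsto_upperbound)
      show "(\<lambda>n. (\<Sum>i<k. (cmod (coord (X m) i - coord (X n) i))\<^sup>2))
             \<longlonglongrightarrow> (\<Sum>i<k. (cmod (coord (X m) i - a i))\<^sup>2)"
        by (intro tendsto_intros a)
      have "(\<Sum>i<k. (cmod (coord (X m) i - coord (X n) i))\<^sup>2) \<le> e\<^sup>2" if "n \<ge> M" for n
      proof -
        have "(\<Sum>i<k. (cmod (coord (X m) i - coord (X n) i))\<^sup>2) = (norm (proj k (X m - X n)))\<^sup>2"
          by (simp add: norm_proj_square)
        also have "\<dots> \<le> e\<^sup>2"
          using norm_proj_le[of k "X m - X n"] M[OF that] by (intro power_mono) auto
        finally show ?thesis .
      qed
      thus "\<forall>\<^sub>F n in sequentially. (\<Sum>i<k. (cmod (coord (X m) i - coord (X n) i))\<^sup>2) \<le> e\<^sup>2"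
        by (auto simp: eventually_sequentially)
    qed simp
  qed (use e in auto)
  have cau: "\<exists>M. \<forall>m\<ge>M. \<forall>n\<ge>M. norm (X m - X n) \<le> e" if "e > 0" for e
    using X that unfolding Cauchy_iff by (meson less_imp_le)
  obtain M1 where "\<forall>m\<ge>M1. \<forall>n\<ge>M1. norm (X m - X n) \<le> 1" using cau[of 1] by auto
  then obtain y where y: "coord y = (\<lambda>i. coord (X M1) i - a i)" using near[of 1 M1 M1] by auto
  define L where "L = X M1 - y"
  have L: "coord L = a" by (auto simp: L_def y)
  have "X \<longlonglongrightarrow> L"
  proof (rule LIMSEQ_I)
    fix r :: real assume r: "0 < r"
    obtain M where M: "\<forall>m\<ge>M. \<forall>n\<ge>M. norm (X m - X n) \<le> r / 2" using cau[of "r / 2"] r by auto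
    have "norm (X m - L) < r" if "m \<ge> M" for m
    proof -
      have "\<exists>y. coord y = (\<lambda>i. coord (X m) i - a i) \<and> norm y \<le> r / 2"
        by (rule near[of "r / 2" M m]) (use M r that in auto)
      then obtain y where y: "coord y = (\<lambda>i. coord (X m) i - a i)" "norm y \<le> r / 2" by blast
      have "y = X m - L" by (rule ell2_eqI) (simp add: y L)
      thus ?thesis using y r by simp
    qed
    thus "\<exists>M. \<forall>m\<ge>M. norm (X m - L) < r" by blast
  qed
  thus "convergent X" by (auto simp: convergent_def)
qed

section \<open>Complex linear operators and their adjoints\<close>

lemma Omega_B_scaleC: "A \<in> Omega_B \<Longrightarrow> A (c *\<^sub>C x) = c *\<^sub>C A x" for A :: operator
  by (simp add: Omega_B_def)

lemma scalar_op_apply [simp]: "blinfun_apply (scalar_op z) x = z *\<^sub>C x"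
  by (simp add: scalar_op.rep_eq)

lemma Omega_B_intros [simp, intro]:
  "A \<in> Omega_B \<Longrightarrow> B \<in> Omega_B \<Longrightarrow> A - B \<in> Omega_B"
  "A \<in> Omega_B \<Longrightarrow> B \<in> Omega_B \<Longrightarrow> A + B \<in> Omega_B"
  "A \<in> Omega_B \<Longrightarrow> B \<in> Omega_B \<Longrightarrow> A o\<^sub>L B \<in> Omega_B"
  "scalar_op z \<in> Omega_B" "id_blinfun \<in> Omega_B" "proj n \<in> Omega_B"
  by (auto simp: Omega_B_def blinfun.diff_left blinfun.add_left scaleC.diff_right scaleC.add_right
      mult.commute intro: ell2_eqI)

lemma Omega_B_apply_proj:
  assumes "A \<in> Omega_B"
  shows "A (proj n x) = (\<Sum>j<n. coord x j *\<^sub>C A (basis_vec j))"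
  unfolding proj_eq_sum by (simp add: blinfun.sum_right Omega_B_scaleC[OF assms])

text \<open>The span of the basis is dense, so the columns of its matrix determine an operator.\<close>

lemma Omega_B_eqI:
  fixes A B :: operator
  assumes "A \<in> Omega_B" "B \<in> Omega_B" "\<And>j. A (basis_vec j) = B (basis_vec j)"
  shows "A = B"
proof (rule blinfun_eqI)
  fix x
  have "(\<lambda>n. A (proj n x)) \<longlonglongrightarrow> A x" "(\<lambda>n. B (proj n x)) \<longlonglongrightarrow> B x"
    by (intro tendsto_intros proj_tendsto)+
  thus "A x = B x" using LIMSEQ_unique by (simp add: Omega_B_apply_proj assms)
qed

lemma operator_from_coords:
  fixes F :: "ell2 \<Rightarrow> nat \<Rightarrow> complex"
  assumes bound: "\<And>x n. (\<Sum>i<n. (cmod (F x i))\<^sup>2) \<le> (K * norm x)\<^sup>2" "0 \<le> K"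
    and add: "\<And>x y i. F (x + y) i = F x i + F y i"
    and scale: "\<And>c x i. F (c *\<^sub>C x) i = c * F x i"
  obtains A :: operator where "A \<in> Omega_B" "\<And>x. coord (A x) = F x"
proof -
  have "\<exists>v. coord v = F x \<and> norm v \<le> K * norm x" for x
    by (rule ell2_eq_if_coord_summable[OF bound(1)]) (use bound(2) in simp)
  then obtain b where b: "\<And>x. coord (b x) = F x" "\<And>x. norm (b x) \<le> K * norm x" by metis
  have lin: "bounded_linear b"
  proof (rule bounded_linear_intro)
    fix x y :: ell2 and r :: real
    show "b (x + y) = b x + b y" by (rule ell2_eqI) (simp add: b add)
    show "b (r *\<^sub>R x) = r *\<^sub>R b x"
      by (rule ell2_eqI) (simp add: b scale scaleR_scaleC)
    show "norm (b x) \<le> norm x * K" using b(2)[of x] by (simp add: mult.commute)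
  qed
  have "Blinfun b \<in> Omega_B"
    unfolding Omega_B_def by (auto simp: bounded_linear_Blinfun_apply[OF lin] b scale intro: ell2_eqI)
  thus ?thesis by (rule that) (simp add: bounded_linear_Blinfun_apply[OF lin] b)
qed

text \<open>For \<open>u = \<Sum>\<^sub>i\<^sub><\<^sub>n \<llangle>y, A e\<^sub>i\<rrangle> e\<^sub>i\<close> the sum in question equals both \<open>\<parallel>u\<parallel>\<^sup>2\<close> and \<open>\<llangle>y, A
  u\<rrangle>\<close>, so that \<open>\<parallel>u\<parallel>\<^sup>2 \<le> \<parallel>y\<parallel> \<parallel>A\<parallel> \<parallel>u\<parallel>\<close>.\<close>

lemma coord_op_square_sum_le:
  fixes A :: operator
  assumes A: "A \<in> Omega_B"
  shows "(\<Sum>i<n. (cmod \<llangle>y, A (basis_vec i)\<rrangle>)\<^sup>2) \<le> (norm A * norm y)\<^sup>2"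
proof -
  define a where "a i = \<llangle>y, A (basis_vec i)\<rrangle>" for i
  define u where "u = (\<Sum>i<n. a i *\<^sub>C basis_vec i)"
  have "coord u i = (if i < n then a i else 0)" for i
    unfolding u_def by (simp add: coord_sum if_distrib cong: if_cong)
  hence nu: "(norm u)\<^sup>2 = (\<Sum>i<n. (cmod (a i))\<^sup>2)"
    unfolding norm_ell2_square by (subst suminf_finite[of "{..<n}"]) auto
  have "\<llangle>y, A u\<rrangle> = (\<Sum>i<n. cnj (a i) * a i)"
    unfolding u_def by (simp add: blinfun.sum_right cinner.sum_right Omega_B_scaleC[OF A]
        cinner_scaleC_right a_def)
  also have "\<dots> = complex_of_real ((norm u)\<^sup>2)"
    unfolding nu of_real_sum by (intro sum.cong refl) (simp add: complex_norm_square mult.commute del: of_real_power)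
  finally have "(norm u)\<^sup>2 = cmod \<llangle>y, A u\<rrangle>"
    by (simp only: norm_of_real abs_power2 abs_norm_cancel)
  also have "\<dots> \<le> norm y * (norm A * norm u)"
    by (rule order.trans[OF cinner_Cauchy_Schwarz]) (intro mult_left_mono norm_blinfun norm_ge_zero)
  finally have "norm u * norm u \<le> norm A * norm y * norm u"
    by (simp add: power2_eq_square algebra_simps)
  hence "norm u \<le> norm A * norm y"
    by (cases "norm u = 0") (auto simp: mult_le_cancel_right)
  hence "(norm u)\<^sup>2 \<le> (norm A * norm y)\<^sup>2" by (intro power_mono) auto
  thus ?thesis by (simp add: nu a_def)
qed

text \<open>The i-th coordinate of \<open>A\<^sup>* y\<close> has to be \<open>\<llangle>y, A e\<^sub>i\<rrangle>\<close>; the preceding bound makes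
  this an element of the space.\<close>

lemma adjoint_exists:
  fixes A :: operator
  assumes A: "A \<in> Omega_B"
  shows "\<exists>B. B \<in> Omega_B \<and> (\<forall>x y. \<llangle>A x, y\<rrangle> = \<llangle>x, blinfun_apply B y\<rrangle>)"
proof -
  obtain B :: operator where B: "B \<in> Omega_B" "\<And>y. coord (B y) = (\<lambda>i. \<llangle>y, A (basis_vec i)\<rrangle>)"
    by (rule operator_from_coords[OF coord_op_square_sum_le[OF A] norm_ge_zero])
      (auto simp: cinner.add_left cinner_scaleC_left)
  have "\<llangle>A x, y\<rrangle> = \<llangle>x, B y\<rrangle>" for x y
  proof (rule LIMSEQ_unique)
    show "(\<lambda>n. \<llangle>A (proj n x), y\<rrangle>) \<longlonglongrightarrow> \<llangle>A x, y\<rrangle>"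
      by (intro cinner.tendsto blinfun.tendsto tendsto_const proj_tendsto)
    have "\<llangle>basis_vec j, B y\<rrangle> = \<llangle>A (basis_vec j), y\<rrangle>" for j
      using cinner_commute[of "basis_vec j" "B y"] cinner_commute[of "A (basis_vec j)" y]
      by (simp add: cinner_basis_vec B)
    hence "\<llangle>A (proj n x), y\<rrangle> = \<llangle>proj n x, B y\<rrangle>" for n
      unfolding Omega_B_apply_proj[OF A] unfolding proj_eq_sum
      by (simp add: cinner.sum_left cinner_scaleC_left)
    thus "(\<lambda>n. \<llangle>A (proj n x), y\<rrangle>) \<longlonglongrightarrow> \<llangle>x, B y\<rrangle>"
      using cinner.tendsto[OF proj_tendsto tendsto_const] by simp
  qed
  thus ?thesis using B(1) by blast
qed

lemma cinner_right_eqD: "(\<And>x. \<llangle>x, y\<rrangle> = \<llangle>x, z\<rrangle>) \<Longrightarrow> y = z"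
  by (rule ell2_eqI) (metis cinner_basis_vec cinner_commute)

lemma adj_unique:
  fixes A :: operator
  assumes "A \<in> Omega_B"
  shows "\<exists>!B. B \<in> Omega_B \<and> (\<forall>x y. \<llangle>A x, y\<rrangle> = \<llangle>x, blinfun_apply B y\<rrangle>)"
proof (rule ex_ex1I[OF adjoint_exists[OF assms]])
  fix B B' :: operator
  assume "B \<in> Omega_B \<and> (\<forall>x y. \<llangle>A x, y\<rrangle> = \<llangle>x, B y\<rrangle>)" "B' \<in> Omega_B \<and> (\<forall>x y. \<llangle>A x, y\<rrangle> = \<llangle>x, B' y\<rrangle>)"
  thus "B = B'" by (intro blinfun_eqI cinner_right_eqD) metis
qed

lemma
  assumes "A \<in> Omega_B"
  shows adj_in_Omega_B [simp, intro]: "adj A \<in> Omega_B"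
    and cinner_adj: "\<llangle>A x, y\<rrangle> = \<llangle>x, adj A y\<rrangle>"
  using theI'[OF adj_unique[OF assms]] unfolding adj_def by blast+

lemma adj_eqI_cinner:
  fixes A B :: operator
  assumes "A \<in> Omega_B" "B \<in> Omega_B" "\<And>x y. \<llangle>A x, y\<rrangle> = \<llangle>x, B y\<rrangle>"
  shows "adj A = B"
  unfolding adj_def using adj_unique[OF assms(1)] assms by (intro the1_equality) auto

lemma adj_eqI_entries:
  fixes A B :: operator
  assumes "A \<in> Omega_B" "B \<in> Omega_B"
    and "\<And>i j. coord (A (basis_vec j)) i = cnj (coord (B (basis_vec i)) j)"
  shows "adj A = B"
proof (rule Omega_B_eqI)
  fix i
  show "adj A (basis_vec i) = B (basis_vec i)"
  proof (rule ell2_eqI)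
    fix j
    have "coord (adj A (basis_vec i)) j = \<llangle>adj A (basis_vec i), basis_vec j\<rrangle>"
      by (simp add: cinner_basis_vec)
    also have "\<dots> = cnj (coord (A (basis_vec j)) i)"
      by (metis cinner_adj[OF assms(1)] cinner_basis_vec cinner_commute)
    finally show "coord (adj A (basis_vec i)) j = coord (B (basis_vec i)) j" by (simp add: assms)
  qed
qed (auto simp: assms)

lemma coord_adj_basis_vec:
  assumes "A \<in> Omega_B"
  shows "coord (adj A (basis_vec j)) i = cnj (coord (A (basis_vec i)) j)"
  by (metis cinner_adj[OF assms] cinner_basis_vec cinner_commute)

lemma adj_adj: "A \<in> Omega_B \<Longrightarrow> adj (adj A) = A"
  by (rule adj_eqI_entries) (auto simp: coord_adj_basis_vec)

lemma adj_comp: "A \<in> Omega_B \<Longrightarrow> B \<in> Omega_B \<Longrightarrow> adj (A o\<^sub>L B) = adj B o\<^sub>L adj A"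
  by (rule adj_eqI_cinner) (auto simp: cinner_adj)

lemma adj_id: "adj id_blinfun = id_blinfun"
  by (rule adj_eqI_cinner) auto

lemma adj_proj: "adj (proj n) = proj n"
  by (rule adj_eqI_entries) auto

lemma adj_minus: "A \<in> Omega_B \<Longrightarrow> B \<in> Omega_B \<Longrightarrow> adj (A - B) = adj A - adj B"
  by (rule adj_eqI_cinner) (auto simp: cinner_adj blinfun.diff_left cinner.diff_left cinner.diff_right)

lemma adj_scalar_op: "adj (scalar_op z) = scalar_op (cnj z)"
  by (rule adj_eqI_cinner) (auto simp: cinner_scaleC_left cinner_scaleC_right)

lemma norm_adj_le:
  assumes A: "A \<in> Omega_B"
  shows "norm (adj A) \<le> norm A"
proof (rule norm_blinfun_bound)
  fix x
  have "complex_of_real ((norm (adj A x))\<^sup>2) = \<llangle>A (adj A x), x\<rrangle>"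
    by (simp only: cinner_self[symmetric] cinner_adj[OF A])
  hence "(norm (adj A x))\<^sup>2 = cmod \<llangle>A (adj A x), x\<rrangle>"
    by (metis abs_power2 norm_of_real)
  also have "\<dots> \<le> (norm A * norm (adj A x)) * norm x"
    by (rule order.trans[OF cinner_Cauchy_Schwarz]) (intro mult_right_mono norm_blinfun norm_ge_zero)
  finally have "norm (adj A x) * norm (adj A x) \<le> norm A * norm x * norm (adj A x)"
    by (simp add: power2_eq_square algebra_simps)
  thus "norm (adj A x) \<le> norm A * norm x"
    by (cases "norm (adj A x) = 0") (auto simp: mult_le_cancel_right)
qed simp

lemma norm_adj: "A \<in> Omega_B \<Longrightarrow> norm (adj A) = norm A"
  using norm_adj_le[of A] norm_adj_le[of "adj A"] by (simp add: adj_adj)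


section \<open>The resolvent norm in terms of lower bounds\<close>

text \<open>An approximate eigenvector x for z makes the residual small in comparison with
  \<open>\<parallel>x\<parallel>\<close>.\<close>

abbreviation residual :: "operator \<Rightarrow> complex \<Rightarrow> ell2 \<Rightarrow> real" where
  "residual A z x \<equiv> norm (A x - z *\<^sub>C x)"

text \<open>Surjectivity comes from \<open>T T\<^sup>*\<close> alone: this positive operator is at least \<open>e\<^sup>2\<close>, so
  \<open>I - \<tau> T T\<^sup>*\<close> is a contraction for small \<open>\<tau>\<close> and the Banach fixed point theorem solves \<open>T
  (\<tau> T\<^sup>* x) = y\<close>.\<close>

lemma bounded_below_surj:
  fixes T :: operator
  assumes T: "T \<in> Omega_B" and e: "e > 0" and below: "\<And>x. e * norm x \<le> norm (adj T x)"
  shows "\<exists>x. T x = y"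
proof -
  define S where "S = T o\<^sub>L adj T"
  \<comment> \<open>an upper bound for S that also dominates \<open>e\<^sup>2\<close>; the choice of \<open>\<tau>\<close> minimises \<open>1 - 2 \<tau> e\<^sup>2 + \<tau>\<^sup>2 M\<^sup>2\<close>\<close>
  define M where "M = norm S + e\<^sup>2"
  define q where "q = 1 - (e\<^sup>2 / M)\<^sup>2"
  define \<tau> where "\<tau> = e\<^sup>2 / M\<^sup>2"
  have M: "M > 0" "e\<^sup>2 \<le> M" "norm S \<le> M" using e by (auto simp: M_def add_nonneg_pos)
  have "(e\<^sup>2 / M)\<^sup>2 \<le> 1" using M e by (intro power_le_one) auto
  moreover have "(e\<^sup>2 / M)\<^sup>2 > 0" using M e by simp
  ultimately have q: "0 \<le> q" "q < 1" by (auto simp: q_def)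
  have tau: "\<tau> \<ge> 0" by (simp add: \<tau>_def)
  have contr: "norm (x - \<tau> *\<^sub>R S x) \<le> sqrt q * norm x" for x
  proof -
    have "\<llangle>S x, x\<rrangle> = complex_of_real ((norm (adj T x))\<^sup>2)"
      by (simp add: S_def cinner_adj[OF T] cinner_self)
    hence "inner (S x) x = (norm (adj T x))\<^sup>2" by (simp add: inner_ell2_def)
    moreover have "(e * norm x)\<^sup>2 \<le> (norm (adj T x))\<^sup>2" using below e by (intro power_mono) auto
    ultimately have ge: "e\<^sup>2 * (norm x)\<^sup>2 \<le> inner (S x) x" by (simp add: power_mult_distrib)
    have "norm (S x) \<le> M * norm x"
      using norm_blinfun[of S x] M(3) mult_right_mono[OF M(3) norm_ge_zero[of x]] by linarith
    hence le: "(norm (S x))\<^sup>2 \<le> M\<^sup>2 * (norm x)\<^sup>2"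
      by (metis norm_ge_zero power_mono power_mult_distrib)
    have "(norm (x - \<tau> *\<^sub>R S x))\<^sup>2 = (norm x)\<^sup>2 - 2 * \<tau> * inner (S x) x + \<tau>\<^sup>2 * (norm (S x))\<^sup>2"
      unfolding power2_norm_eq_inner
      by (simp add: inner_diff_left inner_diff_right inner_commute power2_eq_square algebra_simps)
    also have "\<dots> \<le> (norm x)\<^sup>2 - 2 * \<tau> * (e\<^sup>2 * (norm x)\<^sup>2) + \<tau>\<^sup>2 * (M\<^sup>2 * (norm x)\<^sup>2)"
      using ge le tau by (intro add_mono diff_mono mult_left_mono) auto
    also have "\<dots> = q * (norm x)\<^sup>2"
      using M by (simp add: q_def \<tau>_def field_simps power2_eq_square)
    finally have "norm (x - \<tau> *\<^sub>R S x) \<le> sqrt (q * (norm x)\<^sup>2)" by (rule real_le_rsqrt)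
    thus ?thesis by (simp add: real_sqrt_mult)
  qed
  have "dist (y + (x - \<tau> *\<^sub>R S x)) (y + (x' - \<tau> *\<^sub>R S x')) \<le> sqrt q * dist x x'" for x x'
    using contr[of "x - x'"] by (simp add: dist_norm blinfun.diff_right algebra_simps)
  hence "\<exists>!x. y + (x - \<tau> *\<^sub>R S x) = x" using q by (intro banach_fix_type[of "sqrt q"]) auto
  then obtain x where "y + (x - \<tau> *\<^sub>R S x) = x" by blast
  hence "T (\<tau> *\<^sub>R adj T x) = y" by (simp add: S_def blinfun.scaleR_right algebra_simps)
  thus ?thesis by blast
qed

text \<open>Boundedness below of the adjoint gives surjectivity; boundedness below of T gives
  injectivity and the bound \<open>1 / e\<close> for the inverse.\<close>

lemma bounded_below_invertible:
  fixes T :: operator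
  assumes T: "T \<in> Omega_B" and e: "e > 0"
    and below: "\<And>x. e * norm x \<le> norm (T x)" and below_adj: "\<And>x. e * norm x \<le> norm (adj T x)"
  shows "\<exists>B. is_inverse T B"
proof -
  have inj: "x = y" if "T x = T y" for x y
    using below[of "x - y"] that e by (simp add: blinfun.diff_right mult_le_0_iff)
  have "\<exists>g. \<forall>y. T (g y) = y" using bounded_below_surj[OF T e below_adj] by metis
  then obtain g where g: "\<And>y. T (g y) = y" by blast
  have gT: "g (T x) = x" for x by (rule inj) (rule g)
  have "bounded_linear g"
  proof (rule bounded_linear_intro)
    fix x y :: ell2 and r :: real
    show "g (x + y) = g x + g y" by (rule inj) (simp add: g blinfun.add_right)
    show "g (r *\<^sub>R x) = r *\<^sub>R g x" by (rule inj) (simp add: g blinfun.scaleR_right)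
    show "norm (g x) \<le> norm x * (1 / e)" using below[of "g x"] e by (simp add: g field_simps)
  qed
  hence app: "blinfun_apply (Blinfun g) = g" by (rule bounded_linear_Blinfun_apply)
  have "g (c *\<^sub>C x) = c *\<^sub>C g x" for c x by (rule inj) (simp add: g Omega_B_scaleC[OF T])
  hence "is_inverse T (Blinfun g)"
    unfolding is_inverse_def Omega_B_def by (auto intro!: blinfun_eqI simp: app g gT)
  thus ?thesis by blast
qed

lemma is_inverse_apply:
  fixes T :: operator
  assumes "is_inverse T B"
  shows "B (T x) = x" "T (B x) = x"
  using assms unfolding is_inverse_def by (metis blinfun_apply_blinfun_compose id_blinfun.rep_eq)+

lemma is_inverse_unique:
  fixes T :: operator
  assumes "is_inverse T B" "is_inverse T C"
  shows "B = C"
  by (rule blinfun_eqI) (metis is_inverse_apply assms)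

lemma is_inverse_resolvent:
  assumes "z \<notin> Sp A"
  shows "is_inverse (A - scalar_op z) (resolvent z A)"
proof -
  obtain B where "is_inverse (A - scalar_op z) B" using assms by (auto simp: Sp_def)
  hence "\<exists>!B. is_inverse (A - scalar_op z) B" using is_inverse_unique by blast
  thus ?thesis unfolding resolvent_def by (rule theI')
qed

lemma resolvent_apply:
  assumes "z \<notin> Sp A"
  shows "resolvent z A (A x - z *\<^sub>C x) = x"
    and "A (resolvent z A x) - z *\<^sub>C resolvent z A x = x"
  using is_inverse_apply[OF is_inverse_resolvent[OF assms]] by (auto simp: blinfun.diff_left)

lemma norm_resolvent_pos:
  assumes "z \<notin> Sp A"
  shows "norm (resolvent z A) > 0"
proof -
  have "resolvent z A \<noteq> 0"
    using resolvent_apply(1)[OF assms, of "basis_vec 0"] norm_basis_vec[of 0]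
    by (metis blinfun.zero_left norm_zero zero_neq_one)
  thus ?thesis by simp
qed

lemma inv_resolvent_norm_nonneg: "0 \<le> inv_resolvent_norm z A"
  by (simp add: inv_resolvent_norm_def)

lemma inv_resolvent_norm_pos_iff: "0 < inv_resolvent_norm z A \<longleftrightarrow> z \<notin> Sp A"
  using norm_resolvent_pos by (auto simp: inv_resolvent_norm_def)

text \<open>The right-hand side only involves norms of vectors, which algorithms can
  approximate, and every property of the pseudospectrum below is read off from it. The
  adjoint is needed because an operator can be bounded below without being surjective.\<close>

theorem le_inv_resolvent_norm_iff:
  assumes A: "A \<in> Omega_B" and e: "e > 0"
  shows "e \<le> inv_resolvent_norm z A \<longleftrightarrow>
    (\<forall>x. e * norm x \<le> residual A z x) \<and>
    (\<forall>x. e * norm x \<le> residual (adj A) (cnj z) x)"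
proof
  have adjT: "adj (A - scalar_op z) = adj A - scalar_op (cnj z)"
    by (simp add: adj_minus A adj_scalar_op)
  {
    assume le: "e \<le> inv_resolvent_norm z A"
    hence z: "z \<notin> Sp A" using e inv_resolvent_norm_pos_iff[of z A] by linarith
    define R where "R = resolvent z A"
    have R: "R \<in> Omega_B" using is_inverse_resolvent[OF z] by (simp add: is_inverse_def R_def)
    have "e \<le> inverse (norm R)" using le z by (simp add: inv_resolvent_norm_def R_def)
    hence eR: "e * norm R \<le> 1" using norm_resolvent_pos[OF z] by (simp add: R_def field_simps)
    have *: "e * norm x \<le> norm y" if "norm x \<le> norm R * norm y" for x y :: ell2
    proof -
      have "e * norm x \<le> (e * norm R) * norm y" using that e by simp
      also have "\<dots> \<le> 1 * norm y" by (intro mult_right_mono eR) auto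
      finally show ?thesis by simp
    qed
    have "R o\<^sub>L (A - scalar_op z) = id_blinfun" "(A - scalar_op z) o\<^sub>L R = id_blinfun"
      using is_inverse_resolvent[OF z] by (simp_all add: is_inverse_def R_def)
    hence "adj ((A - scalar_op z) o\<^sub>L R) = id_blinfun" by (simp add: adj_id)
    hence "adj R o\<^sub>L (adj A - scalar_op (cnj z)) = id_blinfun"
      by (simp add: adj_comp A R adjT)
    hence adjR: "adj R (adj A x - cnj z *\<^sub>C x) = x" for x
      by (metis blinfun_apply_blinfun_compose id_blinfun.rep_eq blinfun.diff_left scalar_op_apply)
    have "norm x \<le> norm R * residual A z x" for x
      by (metis R_def norm_blinfun resolvent_apply(1)[OF z])
    moreover have "norm x \<le> norm R * residual (adj A) (cnj z) x" for x
      by (metis adjR norm_adj[OF R] norm_blinfun)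
    ultimately show "(\<forall>x. e * norm x \<le> residual A z x) \<and>
      (\<forall>x. e * norm x \<le> residual (adj A) (cnj z) x)" using * by blast
  }
  {
    assume le: "(\<forall>x. e * norm x \<le> residual A z x) \<and>
      (\<forall>x. e * norm x \<le> residual (adj A) (cnj z) x)"
    have "\<exists>B. is_inverse (A - scalar_op z) B"
      by (rule bounded_below_invertible[OF _ e]) (use le A in \<open>auto simp: adjT blinfun.diff_left\<close>)
    hence z: "z \<notin> Sp A" by (simp add: Sp_def)
    have "norm (resolvent z A) \<le> 1 / e"
    proof (rule norm_blinfun_bound)
      fix y
      have "e * norm (resolvent z A y) \<le> norm y"
        using le resolvent_apply(2)[OF z, of y] by metis
      thus "norm (resolvent z A y) \<le> 1 / e * norm y" using e by (simp add: field_simps)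
    qed (use e in simp)
    thus "e \<le> inv_resolvent_norm z A"
      using z e norm_resolvent_pos[OF z] by (simp add: inv_resolvent_norm_def field_simps)
  }
qed

corollary pseudospectrum_iff:
  assumes "A \<in> Omega_B" "\<epsilon> > 0"
  shows "z \<in> pseudospectrum \<epsilon> A \<longleftrightarrow>
    (\<exists>x. residual A z x < \<epsilon> * norm x \<or> residual (adj A) (cnj z) x < \<epsilon> * norm x)"
  using le_inv_resolvent_norm_iff[OF assms, of z]
  unfolding pseudospectrum_def mem_Collect_eq not_le[symmetric] by blast

lemma norm_shift_le:
  fixes A :: operator
  shows "residual A w x \<le> residual A z x + cmod (z - w) * norm x"
proof -
  have "A x - w *\<^sub>C x = (A x - z *\<^sub>C x) + (z - w) *\<^sub>C x" by (simp add: scaleC.diff_left)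
  thus ?thesis by (metis norm_scaleC norm_triangle_ineq)
qed

text \<open>By \<open>le_inv_resolvent_norm_iff\<close>, the function is a minimum of two infima of the
  1-Lipschitz functions \<open>z \<mapsto> \<parallel>(A - z) x\<parallel>\<close> and \<open>z \<mapsto> \<parallel>(A\<^sup>* - cnj z) x\<parallel>\<close> over unit vectors x.\<close>

lemma inv_resolvent_norm_Lipschitz:
  assumes A: "A \<in> Omega_B"
  shows "inv_resolvent_norm z A \<le> inv_resolvent_norm w A + cmod (z - w)"
proof (rule ccontr)
  assume "\<not> ?thesis"
  hence gt: "inv_resolvent_norm w A < inv_resolvent_norm z A - cmod (z - w)" (is "_ < ?e") by simp
  have e: "?e > 0" using gt inv_resolvent_norm_nonneg[of w A] by linarith
  hence "inv_resolvent_norm z A > 0" by (metis gt_ex less_diff_eq norm_ge_zero add_0 order_le_less_trans)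
  from le_inv_resolvent_norm_iff[OF A this, of z]
  have le: "inv_resolvent_norm z A * norm x \<le> residual A z x"
    "inv_resolvent_norm z A * norm x \<le> residual (adj A) (cnj z) x" for x by auto
  have "?e * norm x \<le> residual A w x" for x
    using le(1)[of x] norm_shift_le[of A x z w] by (simp add: algebra_simps norm_minus_commute)
  moreover have "?e * norm x \<le> residual (adj A) (cnj w) x" for x
    using le(2)[of x] norm_shift_le[of "adj A" x "cnj z" "cnj w"]
    by (simp add: algebra_simps norm_minus_commute flip: complex_cnj_diff)
  ultimately have "?e \<le> inv_resolvent_norm w A" using le_inv_resolvent_norm_iff[OF A e] by blast
  thus False using gt by simp
qed

section \<open>Pseudospectra are bounded and open\<close>

lemma pseudospectrum_subset_ball:
  assumes A: "A \<in> Omega_B" and e: "\<epsilon> > 0"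
  shows "pseudospectrum \<epsilon> A \<subseteq> ball 0 (norm A + \<epsilon>)"
proof
  fix z assume "z \<in> pseudospectrum \<epsilon> A"
  then obtain x where x: "residual A z x < \<epsilon> * norm x \<or> residual (adj A) (cnj z) x < \<epsilon> * norm x"
    using pseudospectrum_iff[OF A e] by blast
  have *: "cmod w < norm A + \<epsilon>" if B: "norm B \<le> norm A" "residual B w x < \<epsilon> * norm x" for B :: operator and w
  proof -
    have x0: "norm x > 0" using order.strict_trans1[OF norm_ge_zero that(2)] e by (simp add: zero_less_mult_iff)
    have "cmod w * norm x \<le> norm (B x) + residual B w x"
      using norm_triangle_ineq4[of "B x" "B x - w *\<^sub>C x"] by (simp add: norm_scaleC)
    also have "\<dots> < norm A * norm x + \<epsilon> * norm x"
      using norm_blinfun[of B x] B mult_right_mono[OF B(1) norm_ge_zero[of x]] by linarith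
    finally have "cmod w * norm x < (norm A + \<epsilon>) * norm x" by (simp add: algebra_simps)
    thus ?thesis using x0 by simp
  qed
  show "z \<in> ball 0 (norm A + \<epsilon>)"
    using x *[of A z] *[of "adj A" "cnj z"] norm_adj[OF A] by auto
qed

lemma open_pseudospectrum:
  assumes A: "A \<in> Omega_B"
  shows "open (pseudospectrum \<epsilon> A)"
proof (rule openI)
  fix z assume "z \<in> pseudospectrum \<epsilon> A"
  hence z: "inv_resolvent_norm z A < \<epsilon>" by (simp add: pseudospectrum_def)
  have "w \<in> pseudospectrum \<epsilon> A" if "w \<in> ball z (\<epsilon> - inv_resolvent_norm z A)" for w
    using inv_resolvent_norm_Lipschitz[OF A, of w z] that
    by (simp add: pseudospectrum_def dist_norm norm_minus_commute)
  thus "\<exists>d>0. ball z d \<subseteq> pseudospectrum \<epsilon> A" using z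
    by (intro exI[of _ "\<epsilon> - inv_resolvent_norm z A"]) auto
qed

lemma lmeasurable_pseudospectrum:
  assumes "A \<in> Omega_B" "\<epsilon> > 0"
  shows "pseudospectrum \<epsilon> A \<in> lmeasurable"
  by (rule bounded_set_imp_lmeasurable)
    (use pseudospectrum_subset_ball[OF assms] open_pseudospectrum[OF assms(1)] bounded_subset[OF bounded_ball] in
      \<open>auto simp: borel_open\<close>)

lemma lmeasurable_real_pseudospectrum:
  assumes "A \<in> Omega_B" "\<epsilon> > 0"
  shows "{t :: real. complex_of_real t \<in> pseudospectrum \<epsilon> A} \<in> lmeasurable"
proof (rule bounded_set_imp_lmeasurable)
  have "{t. complex_of_real t \<in> pseudospectrum \<epsilon> A} \<subseteq> ball 0 (norm A + \<epsilon>)"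
    using pseudospectrum_subset_ball[OF assms] by auto
  thus "bounded {t. complex_of_real t \<in> pseudospectrum \<epsilon> A}" using bounded_subset bounded_ball by blast
  have "open (complex_of_real -` pseudospectrum \<epsilon> A)"
    by (intro open_vimage open_pseudospectrum assms continuous_intros)
  thus "{t. complex_of_real t \<in> pseudospectrum \<epsilon> A} \<in> sets lebesgue"
    by (simp add: vimage_def borel_open)
qed


section \<open>The spectrum is not empty\<close>

text \<open>Both the continuity and the complex derivative of the resolvent come from this
  identity.\<close>

lemma resolvent_identity:
  assumes z: "z \<notin> Sp A" and w: "w \<notin> Sp A"
  shows "resolvent z A x - resolvent w A x = (z - w) *\<^sub>C resolvent z A (resolvent w A x)"
proof -
  have lin: "resolvent z A (c *\<^sub>C y) = c *\<^sub>C resolvent z A y" for c y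
    using is_inverse_resolvent[OF z] by (simp add: is_inverse_def Omega_B_def)
  have "resolvent z A x = resolvent z A (A (resolvent w A x) - w *\<^sub>C resolvent w A x)"
    by (simp add: resolvent_apply[OF w])
  also have "\<dots> = resolvent z A ((A (resolvent w A x) - z *\<^sub>C resolvent w A x) + (z - w) *\<^sub>C resolvent w A x)"
    by (simp add: scaleC.diff_left)
  also have "\<dots> = resolvent w A x + (z - w) *\<^sub>C resolvent z A (resolvent w A x)"
    by (simp only: blinfun.add_right resolvent_apply[OF z] lin)
  finally show ?thesis by simp
qed

lemma norm_resolvent: "z \<notin> Sp A \<Longrightarrow> norm (resolvent z A) = inverse (inv_resolvent_norm z A)"
  by (simp add: inv_resolvent_norm_def)

lemma isCont_inv_resolvent_norm:
  assumes A: "A \<in> Omega_B"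
  shows "isCont (\<lambda>z. inv_resolvent_norm z A) w"
proof -
  have "(\<lambda>z. inv_resolvent_norm z A) \<midarrow>w\<rightarrow> inv_resolvent_norm w A"
  proof (rule LIM_I)
    fix r :: real assume "r > 0"
    moreover have "norm (inv_resolvent_norm z A - inv_resolvent_norm w A) \<le> norm (z - w)" for z
      using inv_resolvent_norm_Lipschitz[OF A, of z w] inv_resolvent_norm_Lipschitz[OF A, of w z]
      by (auto simp: norm_minus_commute abs_le_iff)
    ultimately show "\<exists>s>0. \<forall>z. z \<noteq> w \<and> norm (z - w) < s \<longrightarrow>
        norm (inv_resolvent_norm z A - inv_resolvent_norm w A) < r"
      using order.strict_trans1 by blast
  qed
  thus ?thesis by (simp add: isCont_def)
qed

lemma inv_resolvent_norm_ge_at_infinity: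
  assumes A: "A \<in> Omega_B" and z: "cmod z > norm A"
  shows "cmod z - norm A \<le> inv_resolvent_norm z A"
proof -
  have *: "(cmod w - norm A) * norm x \<le> residual B w x" if "norm B \<le> norm A" for B :: operator and w x
  proof -
    have "cmod w * norm x \<le> norm (B x) + residual B w x"
      using norm_triangle_ineq4[of "B x" "B x - w *\<^sub>C x"] by (simp add: norm_scaleC)
    thus ?thesis using norm_blinfun[of B x] mult_right_mono[OF that norm_ge_zero[of x]]
      by (simp add: algebra_simps)
  qed
  show ?thesis
    using *[of A z] *[of "adj A" "cnj z"] norm_adj[OF A] z
    by (subst le_inv_resolvent_norm_iff[OF A]) auto
qed

text \<open>If the spectrum were empty, all matrix entries of the resolvent would be entire
  functions vanishing at infinity, hence 0.\<close>

theorem Sp_nonempty: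
  assumes A: "A \<in> Omega_B"
  shows "Sp A \<noteq> {}"
proof
  assume "Sp A = {}"
  hence Sp: "z \<notin> Sp A" for z by simp
  define R where "R z = resolvent z A" for z
  define h where "h z = inv_resolvent_norm z A" for z
  have h: "h z > 0" "norm (R z) = inverse (h z)" for z
    using Sp inv_resolvent_norm_pos_iff by (auto simp: R_def h_def norm_resolvent)
  have cont_h: "(h \<longlongrightarrow> h w) (at w)" for w
    using isCont_inv_resolvent_norm[OF A] unfolding h_def isCont_def .
  have ident: "R z x - R w x = (z - w) *\<^sub>C R z (R w x)" for z w x
    unfolding R_def by (rule resolvent_identity[OF Sp Sp])
  have cont: "((\<lambda>z. R z x) \<longlongrightarrow> R w x) (at w)" for w x
  proof -
    have "((\<lambda>z. cmod (z - w) * (inverse (h z) * norm (R w x))) \<longlongrightarrow> cmod (w - w) * (inverse (h w) * norm (R w x))) (at w)"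
      using h(1)[of w] by (intro tendsto_intros cont_h) auto
    hence lim: "((\<lambda>z. cmod (z - w) * (inverse (h z) * norm (R w x))) \<longlongrightarrow> 0) (at w)" by simp
    have "((\<lambda>z. R z x - R w x) \<longlongrightarrow> 0) (at w)"
      by (rule Lim_null_comparison[OF _ lim], rule always_eventually)
        (auto intro!: mult_left_mono simp: ident norm_scaleC norm_blinfun h(2)[symmetric])
    thus ?thesis by (simp add: LIM_zero_iff)
  qed
  have "\<llangle>R z x, y\<rrangle> = 0" for z x y
  proof (rule Liouville_weak_0[where f = "\<lambda>z. \<llangle>R z x, y\<rrangle>"])
    show "(\<lambda>z. \<llangle>R z x, y\<rrangle>) holomorphic_on UNIV"
      unfolding holomorphic_on_def field_differentiable_def
    proof
      fix w
      have "((\<lambda>z. \<llangle>R z (R w x), y\<rrangle>) \<longlongrightarrow> \<llangle>R w (R w x), y\<rrangle>) (at w)"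
        by (intro cinner.tendsto cont tendsto_const)
      moreover have "\<forall>\<^sub>F z in at w. \<llangle>R z (R w x), y\<rrangle> = (\<llangle>R z x, y\<rrangle> - \<llangle>R w x, y\<rrangle>) / (z - w)"
        unfolding eventually_at_filter
        by (intro always_eventually)
          (auto simp: cinner.diff_left[symmetric] ident cinner_scaleC_left)
      ultimately have "((\<lambda>z. (\<llangle>R z x, y\<rrangle> - \<llangle>R w x, y\<rrangle>) / (z - w)) \<longlongrightarrow> \<llangle>R w (R w x), y\<rrangle>) (at w)"
        by (rule Lim_transform_eventually)
      thus "\<exists>f'. ((\<lambda>z. \<llangle>R z x, y\<rrangle>) has_field_derivative f') (at w within UNIV)"
        by (auto simp: has_field_derivative_iff)
    qed
    have "LIM z at_infinity. cmod z - norm A :> at_top"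
      using filterlim_tendsto_add_at_top[OF tendsto_const filterlim_norm_at_top, of "- norm A"] by simp
    from tendsto_inverse_0_at_top[OF this]
    have "((\<lambda>z. inverse (cmod z - norm A) * norm x * norm y) \<longlongrightarrow> 0 * norm x * norm y) at_infinity"
      by (intro tendsto_intros)
    moreover have "\<forall>\<^sub>F z in at_infinity. norm \<llangle>R z x, y\<rrangle> \<le> inverse (cmod z - norm A) * norm x * norm y"
      unfolding eventually_at_infinity
    proof (intro exI[of _ "norm A + 1"] allI impI)
      fix z assume "norm A + 1 \<le> cmod z"
      hence z: "cmod z > norm A" by simp
      have "norm (R z) \<le> inverse (cmod z - norm A)"
        unfolding h(2) h_def using z by (intro le_imp_inverse_le inv_resolvent_norm_ge_at_infinity A) auto
      hence "norm (R z) * norm x * norm y \<le> inverse (cmod z - norm A) * norm x * norm y"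
        by (intro mult_right_mono) auto
      moreover have "norm \<llangle>R z x, y\<rrangle> \<le> norm (R z) * norm x * norm y"
        by (rule order.trans[OF cinner_Cauchy_Schwarz]) (intro mult_right_mono norm_blinfun norm_ge_zero)
      ultimately show "norm \<llangle>R z x, y\<rrangle> \<le> inverse (cmod z - norm A) * norm x * norm y" by simp
    qed
    ultimately show "((\<lambda>z. \<llangle>R z x, y\<rrangle>) \<longlongrightarrow> 0) at_infinity"
      using Lim_null_comparison[of "\<lambda>z. \<llangle>R z x, y\<rrangle>"] by simp
  qed
  from this[of 0 x "R 0 x" for x] have "R 0 x = 0" for x by (simp add: cinner_self)
  hence "R 0 = 0" by (intro blinfun_eqI) simp
  thus False using h[of 0] by simp
qed

lemma Sp_bounded_closed:
  assumes A: "A \<in> Omega_B"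
  shows "Sp A \<subseteq> cball 0 (norm A)" and "closed (Sp A)"
proof -
  show "Sp A \<subseteq> cball 0 (norm A)"
  proof
    fix z assume "z \<in> Sp A"
    hence "inv_resolvent_norm z A = 0" by (simp add: inv_resolvent_norm_def)
    thus "z \<in> cball 0 (norm A)" using inv_resolvent_norm_ge_at_infinity[OF A, of z] by force
  qed
  have "Sp A = (\<lambda>z. inv_resolvent_norm z A) -` {0}"
    using inv_resolvent_norm_pos_iff[of _ A] inv_resolvent_norm_nonneg[of _ A]
    by (auto simp: less_le)
  moreover have "closed ((\<lambda>z. inv_resolvent_norm z A) -` {0})"
    by (intro closed_vimage continuous_at_imp_continuous_on ballI isCont_inv_resolvent_norm A) auto
  ultimately show "closed (Sp A)" by simp
qed

text \<open>The function vanishes on the spectrum and is 1-Lipschitz.\<close>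

lemma inv_resolvent_norm_le_infdist:
  assumes A: "A \<in> Omega_B"
  shows "inv_resolvent_norm z A \<le> infdist z (Sp A)"
proof -
  have "inv_resolvent_norm z A \<le> dist z w" if "w \<in> Sp A" for w
    using inv_resolvent_norm_Lipschitz[OF A, of z w] that
    by (simp add: inv_resolvent_norm_def[of w] dist_norm)
  thus ?thesis using Sp_nonempty[OF A] by (simp add: infdist_def cINF_greatest)
qed

text \<open>Every \<open>x \<ge> 0\<close> is the distance of some point from the non-empty bounded spectrum of a
  member of the class, by connectedness of the plane. The conclusion puts all operators with
  \<open>\<parallel>R(z, A)\<parallel>\<^sup>-\<^sup>1 = dist(z, Sp A)\<close> into the class.\<close>

lemma Omega_g_nonempty_imp_le:
  assumes "Omega_g g \<noteq> {}" "0 \<le> x"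
  shows "g x \<le> x"
proof -
  obtain A where A: "A \<in> Omega_B" "\<And>z. g (infdist z (Sp A)) \<le> inv_resolvent_norm z A"
    using assms by (auto simp: Omega_g_def)
  obtain w where w: "w \<in> Sp A" using Sp_nonempty[OF A(1)] by blast
  define y where "y = complex_of_real (norm A + x)"
  have "x \<le> dist y v" if "v \<in> Sp A" for v
  proof -
    have "cmod v \<le> norm A" using Sp_bounded_closed(1)[OF A(1)] that by auto
    moreover have "cmod y = norm A + x" unfolding y_def norm_of_real using assms(2) by simp
    ultimately show ?thesis using norm_triangle_ineq2[of y v] by (simp add: dist_norm)
  qed
  hence "x \<le> infdist y (Sp A)" using w by (auto simp: infdist_def intro!: cINF_greatest)
  moreover have "infdist w (Sp A) = 0" using w by simp
  moreover have "connected (range (\<lambda>z. infdist z (Sp A)))"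
    by (intro connected_continuous_image continuous_intros connected_UNIV)
  ultimately have "x \<in> range (\<lambda>z. infdist z (Sp A))"
    using assms(2) unfolding connected_iff_interval by (metis rangeI)
  then obtain z where "infdist z (Sp A) = x" by auto
  thus ?thesis using A(2)[of z] inv_resolvent_norm_le_infdist[OF A(1), of z] by simp
qed

section \<open>Self-adjoint operators made of blocks of size one and two\<close>

text \<open>For an involution \<open>\<tau>\<close>, a fixed point i of \<open>\<tau>\<close> carries the entry a i, and an orbit
  {i, \<open>\<tau>\<close> i} of size two carries the block with all four entries s. The eigenvalues of such
  a block are 0 and 2 s.\<close>

definition block_coord :: "(nat \<Rightarrow> real) \<Rightarrow> real \<Rightarrow> (nat \<Rightarrow> nat) \<Rightarrow> ell2 \<Rightarrow> nat \<Rightarrow> complex" where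
  "block_coord a s \<tau> x i = (if \<tau> i = i then complex_of_real (a i) * coord x i
     else complex_of_real s * (coord x i + coord x (\<tau> i)))"

definition block_op :: "(nat \<Rightarrow> real) \<Rightarrow> real \<Rightarrow> (nat \<Rightarrow> nat) \<Rightarrow> operator" where
  "block_op a s \<tau> = (SOME A. A \<in> Omega_B \<and> (\<forall>x. coord (blinfun_apply A x) = block_coord a s \<tau> x))"

definition block_eigenvalues :: "(nat \<Rightarrow> real) \<Rightarrow> real \<Rightarrow> (nat \<Rightarrow> nat) \<Rightarrow> real set" where
  "block_eigenvalues a s \<tau> = {a i |i. \<tau> i = i} \<union> (if \<exists>i. \<tau> i \<noteq> i then {0, 2 * s} else {})"

locale block =
  fixes a :: "nat \<Rightarrow> real" and s :: real and \<tau> :: "nat \<Rightarrow> nat" and K :: real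
  assumes a_bound: "\<And>i. \<bar>a i\<bar> \<le> K" and s_bound: "\<bar>s\<bar> \<le> K" and invol: "\<And>i. \<tau> (\<tau> i) = i"
begin

lemma inj_tau: "inj \<tau>"
  by (metis injI invol)

lemma range_tau: "range \<tau> = UNIV"
  by (metis invol surjI)

text \<open>An involution permutes the coordinates and thus preserves norms.\<close>

lemma suminf_permuted: "(\<Sum>n. (cmod (coord x (\<tau> n)))\<^sup>2) = (norm x)\<^sup>2"
  and summable_permuted: "summable (\<lambda>n. (cmod (coord x (\<tau> n)))\<^sup>2)"
  using suminf_reindex[of "\<lambda>n. (cmod (coord x n))\<^sup>2" \<tau>]
    summable_reindex[of "\<lambda>n. (cmod (coord x n))\<^sup>2" \<tau>] inj_tau
  by (auto simp: range_tau o_def norm_ell2_square)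

lemma block_op_exists:
  "\<exists>A. A \<in> Omega_B \<and> (\<forall>x. coord (blinfun_apply A x) = block_coord a s \<tau> x)"
proof -
  have K: "0 \<le> K" using s_bound by linarith
  have "(\<Sum>i<n. (cmod (block_coord a s \<tau> x i))\<^sup>2) \<le> ((2 * K) * norm x)\<^sup>2" for x n
  proof -
    have le: "(cmod (block_coord a s \<tau> x i))\<^sup>2 \<le> 2 * K\<^sup>2 * ((cmod (coord x i))\<^sup>2 + (cmod (coord x (\<tau> i)))\<^sup>2)" for i
    proof (cases "\<tau> i = i")
      case True
      have "(cmod (block_coord a s \<tau> x i))\<^sup>2 = \<bar>a i\<bar>\<^sup>2 * (cmod (coord x i))\<^sup>2"
        using True by (simp add: block_coord_def norm_mult power_mult_distrib)
      also have "\<dots> \<le> K\<^sup>2 * (cmod (coord x i))\<^sup>2" by (intro mult_right_mono power_mono a_bound) auto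
      also have "\<dots> \<le> 4 * (K\<^sup>2 * (cmod (coord x i))\<^sup>2)" by simp
      finally show ?thesis using True by simp
    next
      case False
      have "(cmod (coord x i + coord x (\<tau> i)))\<^sup>2 \<le> (cmod (coord x i) + cmod (coord x (\<tau> i)))\<^sup>2"
        by (intro power_mono norm_triangle_ineq) auto
      also have "\<dots> \<le> 2 * ((cmod (coord x i))\<^sup>2 + (cmod (coord x (\<tau> i)))\<^sup>2)"
        using sum_squares_bound[of "cmod (coord x i)" "cmod (coord x (\<tau> i))"]
        by (simp add: power2_sum)
      finally have "\<bar>s\<bar>\<^sup>2 * (cmod (coord x i + coord x (\<tau> i)))\<^sup>2
          \<le> K\<^sup>2 * (2 * ((cmod (coord x i))\<^sup>2 + (cmod (coord x (\<tau> i)))\<^sup>2))"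
        by (intro mult_mono power_mono s_bound) auto
      moreover have "(cmod (block_coord a s \<tau> x i))\<^sup>2 = \<bar>s\<bar>\<^sup>2 * (cmod (coord x i + coord x (\<tau> i)))\<^sup>2"
        using False by (simp add: block_coord_def norm_mult power_mult_distrib)
      ultimately show ?thesis by (simp only: mult.assoc mult.left_commute[of "K\<^sup>2"])
    qed
    have 1: "(\<Sum>i<n. (cmod (coord x i))\<^sup>2) \<le> (norm x)\<^sup>2"
      unfolding norm_ell2_square by (intro sum_le_suminf) auto
    have 2: "(\<Sum>i<n. (cmod (coord x (\<tau> i)))\<^sup>2) \<le> (norm x)\<^sup>2"
      unfolding suminf_permuted[symmetric] by (intro sum_le_suminf summable_permuted) auto
    have "(\<Sum>i<n. (cmod (block_coord a s \<tau> x i))\<^sup>2)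
        \<le> (\<Sum>i<n. 2 * K\<^sup>2 * ((cmod (coord x i))\<^sup>2 + (cmod (coord x (\<tau> i)))\<^sup>2))"
      by (intro sum_mono le)
    also have "\<dots> = 2 * K\<^sup>2 * ((\<Sum>i<n. (cmod (coord x i))\<^sup>2) + (\<Sum>i<n. (cmod (coord x (\<tau> i)))\<^sup>2))"
      by (simp only: sum_distrib_left[symmetric] sum.distrib)
    also have "\<dots> \<le> 2 * K\<^sup>2 * ((norm x)\<^sup>2 + (norm x)\<^sup>2)"
      by (intro mult_left_mono add_mono 1 2) auto
    finally show ?thesis by (simp add: power_mult_distrib)
  qed
  moreover have "block_coord a s \<tau> (x + y) i = block_coord a s \<tau> x i + block_coord a s \<tau> y i"
    "block_coord a s \<tau> (c *\<^sub>C x) i = c * block_coord a s \<tau> x i" for x y c i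
    by (auto simp: block_coord_def algebra_simps)
  ultimately show ?thesis
    using K operator_from_coords[of "block_coord a s \<tau>" "2 * K"] by (metis mult_nonneg_nonneg zero_le_numeral)
qed

abbreviation A :: operator where "A \<equiv> block_op a s \<tau>"

lemma block_op_in_Omega_B: "A \<in> Omega_B"
  and coord_block_op: "coord (A x) i = block_coord a s \<tau> x i"
  using someI_ex[OF block_op_exists] unfolding block_op_def by auto

lemma adj_block_op: "adj A = A"
proof (rule adj_eqI_entries)
  fix i j
  have "\<tau> i = j \<longleftrightarrow> \<tau> j = i" using invol by auto
  thus "coord (A (basis_vec j)) i = cnj (coord (A (basis_vec i)) j)"
    by (auto simp: coord_block_op block_coord_def)
qed (rule block_op_in_Omega_B)+

text \<open>On an orbit of size two, the sum and the difference of the two coordinates of \<open>A x -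
  z x\<close> are \<open>2 s - z\<close> and \<open>-z\<close> times those of x; the parallelogram law turns this into the
  bound.\<close>

lemma block_op_bounded_below:
  assumes e: "0 \<le> e" and far: "\<And>\<mu>. \<mu> \<in> block_eigenvalues a s \<tau> \<Longrightarrow> e \<le> cmod (z - complex_of_real \<mu>)"
  shows "e * norm x \<le> residual A z x"
proof -
  define y where "y = A x - z *\<^sub>C x"
  have termwise: "e\<^sup>2 * ((cmod (coord x i))\<^sup>2 + (cmod (coord x (\<tau> i)))\<^sup>2)
      \<le> (cmod (coord y i))\<^sup>2 + (cmod (coord y (\<tau> i)))\<^sup>2" for i
  proof (cases "\<tau> i = i")
    case True
    have "e \<le> cmod (complex_of_real (a i) - z)"
      using far[of "a i"] True by (auto simp: block_eigenvalues_def norm_minus_commute)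
    hence "e * cmod (coord x i) \<le> cmod (coord y i)"
      using True by (simp add: y_def coord_block_op block_coord_def norm_mult mult_right_mono
          flip: left_diff_distrib)
    hence "(e * cmod (coord x i))\<^sup>2 \<le> (cmod (coord y i))\<^sup>2" using e by (intro power_mono) auto
    thus ?thesis using True by (simp add: power_mult_distrib)
  next
    case False
    define u v where "u = coord x i" and "v = coord x (\<tau> i)"
    have par: "(cmod (p + q))\<^sup>2 + (cmod (p - q))\<^sup>2 = 2 * ((cmod p)\<^sup>2 + (cmod q)\<^sup>2)" for p q :: complex
      unfolding cmod_power2 by (simp add: power2_eq_square algebra_simps)
    have y: "coord y i = s * (u + v) - z * u" "coord y (\<tau> i) = s * (v + u) - z * v"
      using False invol[of i] by (auto simp: y_def coord_block_op block_coord_def u_def v_def)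
    have "2 * s \<in> block_eigenvalues a s \<tau>" "0 \<in> block_eigenvalues a s \<tau>"
      using False by (auto simp: block_eigenvalues_def)
    hence "e \<le> cmod (2 * s - z)" "e \<le> cmod z"
      using far[of "2 * s"] far[of 0] by (auto simp: norm_minus_commute)
    hence "(e * cmod (u + v))\<^sup>2 \<le> (cmod ((2 * s - z) * (u + v)))\<^sup>2"
      and "(e * cmod (u - v))\<^sup>2 \<le> (cmod (z * (u - v)))\<^sup>2"
      using e by (auto intro!: power_mono mult_right_mono simp: norm_mult)
    moreover have "(2 * s - z) * (u + v) = coord y i + coord y (\<tau> i)"
      and "z * (u - v) = - (coord y i - coord y (\<tau> i))" by (auto simp: y algebra_simps)
    ultimately have "(e * cmod (u + v))\<^sup>2 + (e * cmod (u - v))\<^sup>2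
        \<le> (cmod (coord y i + coord y (\<tau> i)))\<^sup>2 + (cmod (coord y i - coord y (\<tau> i)))\<^sup>2"
      by (simp only: norm_minus_cancel)
    hence "e\<^sup>2 * (2 * ((cmod u)\<^sup>2 + (cmod v)\<^sup>2)) \<le> 2 * ((cmod (coord y i))\<^sup>2 + (cmod (coord y (\<tau> i)))\<^sup>2)"
      unfolding power_mult_distrib distrib_left[symmetric] unfolding par by simp
    thus ?thesis unfolding u_def v_def by (simp add: algebra_simps)
  qed
  have "e\<^sup>2 * (norm x)\<^sup>2 + e\<^sup>2 * (norm x)\<^sup>2
      = (\<Sum>i. e\<^sup>2 * ((cmod (coord x i))\<^sup>2 + (cmod (coord x (\<tau> i)))\<^sup>2))"
    using summable_permuted[of x]
    by (subst suminf_mult) (auto simp: suminf_add[symmetric] suminf_permuted algebra_simps summable_add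
        norm_ell2_square[symmetric])
  also have "\<dots> \<le> (\<Sum>i. (cmod (coord y i))\<^sup>2 + (cmod (coord y (\<tau> i)))\<^sup>2)"
    by (intro suminf_le termwise summable_mult summable_add summable_coord summable_permuted)
  also have "\<dots> = (norm y)\<^sup>2 + (norm y)\<^sup>2"
    by (simp add: suminf_add[symmetric] suminf_permuted summable_permuted norm_ell2_square[symmetric])
  finally have "(e * norm x)\<^sup>2 \<le> (norm y)\<^sup>2" by (simp add: power_mult_distrib)
  thus ?thesis unfolding y_def by (rule power2_le_imp_le) simp
qed

lemma block_op_eigenvector:
  assumes "\<mu> \<in> block_eigenvalues a s \<tau>"
  shows "\<exists>x. x \<noteq> 0 \<and> A x = complex_of_real \<mu> *\<^sub>C x"
proof -
  have ne: "x \<noteq> 0" if "coord x i = 1" for x i using that by auto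
  consider i where "\<tau> i = i" "\<mu> = a i" | i where "\<tau> i \<noteq> i" "\<mu> = 2 * s" | i where "\<tau> i \<noteq> i" "\<mu> = 0"
    using assms by (auto simp: block_eigenvalues_def split: if_splits)
  thus ?thesis
  proof cases
    case 1
    hence "\<tau> j = i \<longleftrightarrow> j = i" for j using invol by metis
    hence "A (basis_vec i) = complex_of_real \<mu> *\<^sub>C basis_vec i"
      using 1 by (intro ell2_eqI) (auto simp: coord_block_op block_coord_def)
    thus ?thesis using ne[of "basis_vec i" i] by auto
  next
    case 2
    have "A (basis_vec i + basis_vec (\<tau> i)) = complex_of_real \<mu> *\<^sub>C (basis_vec i + basis_vec (\<tau> i))"
      using 2 invol by (intro ell2_eqI) (auto simp: coord_block_op block_coord_def inj_eq[OF inj_tau])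
    moreover have "basis_vec i + basis_vec (\<tau> i) \<noteq> 0" using 2 by (intro ne[of _ i]) auto
    ultimately show ?thesis by blast
  next
    case 3
    have "A (basis_vec i - basis_vec (\<tau> i)) = complex_of_real \<mu> *\<^sub>C (basis_vec i - basis_vec (\<tau> i))"
      using 3 invol by (intro ell2_eqI) (auto simp: coord_block_op block_coord_def inj_eq[OF inj_tau])
    moreover have "basis_vec i - basis_vec (\<tau> i) \<noteq> 0" using 3 by (intro ne[of _ i]) auto
    ultimately show ?thesis by blast
  qed
qed

text \<open>Eigenvectors give one direction; the other is the lower bound above, applied to z
  and to \<open>cnj z\<close>, since A is its own adjoint and its eigenvalues are real.\<close>

lemma inv_resolvent_norm_block_op:
  assumes e: "e > 0"
  shows "e \<le> inv_resolvent_norm z A \<longleftrightarrow> (\<forall>\<mu>\<in>block_eigenvalues a s \<tau>. e \<le> cmod (z - complex_of_real \<mu>))"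
proof
  assume le: "e \<le> inv_resolvent_norm z A"
  show "\<forall>\<mu>\<in>block_eigenvalues a s \<tau>. e \<le> cmod (z - complex_of_real \<mu>)"
  proof
    fix \<mu> assume "\<mu> \<in> block_eigenvalues a s \<tau>"
    then obtain x where x: "x \<noteq> 0" "A x = complex_of_real \<mu> *\<^sub>C x" using block_op_eigenvector by blast
    have "e * norm x \<le> residual A z x"
      using le le_inv_resolvent_norm_iff[OF block_op_in_Omega_B e] by blast
    also have "\<dots> = cmod (z - complex_of_real \<mu>) * norm x"
      by (simp add: x(2) norm_scaleC norm_minus_commute flip: scaleC.diff_left)
    finally show "e \<le> cmod (z - complex_of_real \<mu>)" using x(1) by simp
  qed
next
  assume far: "\<forall>\<mu>\<in>block_eigenvalues a s \<tau>. e \<le> cmod (z - complex_of_real \<mu>)"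
  hence "\<forall>\<mu>\<in>block_eigenvalues a s \<tau>. e \<le> cmod (cnj z - complex_of_real \<mu>)"
    by (metis complex_cnj_complex_of_real complex_cnj_diff complex_mod_cnj)
  with far show "e \<le> inv_resolvent_norm z A"
    using e by (subst le_inv_resolvent_norm_iff[OF block_op_in_Omega_B e])
      (auto simp: adj_block_op intro!: block_op_bounded_below)
qed

lemma pseudospectrum_block_op:
  assumes "\<epsilon> > 0"
  shows "pseudospectrum \<epsilon> A = (\<Union>\<mu>\<in>block_eigenvalues a s \<tau>. ball (complex_of_real \<mu>) \<epsilon>)"
  using inv_resolvent_norm_block_op[OF assms]
  by (auto simp: pseudospectrum_def dist_norm norm_minus_commute not_le[symmetric])

lemma block_op_in_classes:
  shows block_op_in_Omega_SA: "A \<in> Omega_SA" and block_op_in_Omega_N: "A \<in> Omega_N"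
  by (auto simp: Omega_SA_def Omega_N_def block_op_in_Omega_B adj_block_op)

text \<open>For these operators the resolvent norm is the reciprocal of the distance to the
  spectrum.\<close>

lemma block_op_in_Omega_g:
  assumes g: "\<And>x. 0 \<le> x \<Longrightarrow> g x \<le> x"
  shows "A \<in> Omega_g g"
proof -
  have "infdist z (Sp A) \<le> inv_resolvent_norm z A" for z
  proof (cases "infdist z (Sp A) = 0")
    case False
    hence pos: "infdist z (Sp A) > 0" using infdist_nonneg[of z "Sp A"] by linarith
    have "infdist z (Sp A) \<le> cmod (z - complex_of_real \<mu>)" if "\<mu> \<in> block_eigenvalues a s \<tau>" for \<mu>
    proof -
      have "complex_of_real \<mu> \<in> Sp A"
        using inv_resolvent_norm_block_op[of "inv_resolvent_norm (complex_of_real \<mu>) A" "complex_of_real \<mu>"] that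
          inv_resolvent_norm_pos_iff[of "complex_of_real \<mu>" A]
        by (metis cancel_comm_monoid_add_class.diff_cancel norm_zero not_le order_refl)
      thus ?thesis by (metis dist_norm infdist_le)
    qed
    thus ?thesis using inv_resolvent_norm_block_op[OF pos] by blast
  qed (use inv_resolvent_norm_nonneg in auto)
  thus ?thesis
    using g[OF infdist_nonneg] block_op_in_Omega_B by (auto simp: Omega_g_def intro: order.trans)
qed

end

lemma block_op_in_Omega_D:
  assumes "\<And>i. \<bar>a i\<bar> \<le> K"
  shows "block_op a 0 id \<in> Omega_D"
proof -
  have "0 \<le> K" using assms[of 0] by linarith
  then interpret block a 0 id K by unfold_locales (auto simp: assms)
  show ?thesis
    using block_op_in_Omega_SA by (auto simp: Omega_D_def cinner_basis_vec coord_block_op block_coord_def)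
qed

lemma zero_in_Omega_B: "0 \<in> Omega_B"
  by (simp add: Omega_B_def scaleC.zero_right)

text \<open>A diagonal operator maps the span of the first n basis vectors to itself, and
  likewise the closed span of the others.\<close>

lemma dispersion_Omega_D:
  assumes A: "A \<in> Omega_D" and f: "n \<le> f n"
  shows "dispersion f n A = 0"
proof -
  have AB: "A \<in> Omega_B" using A by (simp add: Omega_D_def Omega_SA_def)
  have off: "coord (A (basis_vec j)) i = 0" if "i \<noteq> j" for i j
    using A that by (auto simp: Omega_D_def cinner_basis_vec)
  have "(id_blinfun - proj (f n)) o\<^sub>L A o\<^sub>L proj n = 0"
  proof (rule Omega_B_eqI)
    fix j
    show "((id_blinfun - proj (f n)) o\<^sub>L A o\<^sub>L proj n) (basis_vec j) = (0 :: operator) (basis_vec j)"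
      using f off[of _ j] by (intro ell2_eqI) (auto simp: blinfun.diff_left Omega_B_apply_proj[OF AB] coord_sum
          if_distrib[of "\<lambda>c. c * _"] sum.delta cong: if_cong)
  qed (auto simp: AB zero_in_Omega_B)
  moreover have "proj n o\<^sub>L A o\<^sub>L (id_blinfun - proj (f n)) = 0"
  proof (rule Omega_B_eqI)
    fix j
    have "proj n (A (basis_vec j)) = 0" if "n \<le> j"
      using that off[of _ j] by (intro ell2_eqI) auto
    moreover have "basis_vec j - proj m (basis_vec j) = (if m \<le> j then basis_vec j else 0)" for m
      by (intro ell2_eqI) auto
    ultimately show "(proj n o\<^sub>L A o\<^sub>L (id_blinfun - proj (f n))) (basis_vec j) = (0 :: operator) (basis_vec j)"
      using f by (auto simp: blinfun.diff_left)
  qed (auto simp: AB zero_in_Omega_B)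
  ultimately show ?thesis by (simp add: dispersion_def)
qed

section \<open>The volume of the pseudospectrum counts well separated eigenvalues\<close>

text \<open>Open balls of radius r whose centres have distance at least \<open>2 r\<close> are disjoint.\<close>

lemma measure_Union_balls:
  fixes c :: "'b \<Rightarrow> 'a :: euclidean_space"
  assumes "finite V" and sep: "\<And>v w. v \<in> V \<Longrightarrow> w \<in> V \<Longrightarrow> v \<noteq> w \<Longrightarrow> 2 * r \<le> dist (c v) (c w)"
    and r: "r > 0"
  shows "measure lebesgue (\<Union>v\<in>V. ball (c v) r) = card V * measure lebesgue (ball (0 :: 'a) r)"
proof -
  have "measure lebesgue (\<Union>v\<in>V. ball (c v) r) = (\<Sum>v\<in>V. measure lebesgue (ball (c v) r))"
  proof (rule measure_UNION')
    have "ball x r \<inter> ball y r = {}" if "2 * r \<le> dist x y" for x y :: 'a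
    proof -
      have False if "dist x z < r" "dist y z < r" for z
        using \<open>2 * r \<le> dist x y\<close> that dist_triangle2[of x y z] by linarith
      thus ?thesis by auto
    qed
    thus "pairwise (\<lambda>v w. disjnt (ball (c v) r) (ball (c w) r)) V"
      using sep by (auto simp: pairwise_def disjnt_def)
  qed (use assms in auto)
  also have "\<dots> = (\<Sum>v\<in>V. measure lebesgue (ball (0 :: 'a) r))"
    using r by (intro sum.cong refl) (simp add: content_ball_conv_unit_ball[of r])
  finally show ?thesis by simp
qed

definition separated :: "real \<Rightarrow> real set \<Rightarrow> bool" where
  "separated \<epsilon> V \<longleftrightarrow> (\<forall>v\<in>V. \<forall>w\<in>V. v \<noteq> w \<longrightarrow> 2 * \<epsilon> \<le> \<bar>v - w\<bar>)"

text \<open>Planar and linear Lebesgue measure have this property in common: each of finitely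
  many eigenvalues at mutual distance at least \<open>2 \<epsilon>\<close> contributes one disc, or one interval,
  of radius \<open>\<epsilon>\<close>.\<close>

definition counts_eigenvalues :: "real \<Rightarrow> (operator \<Rightarrow> real) \<Rightarrow> bool" where
  "counts_eigenvalues \<epsilon> \<Xi> \<longleftrightarrow> (\<exists>\<mu>>0. \<forall>a s \<tau> K. block a s \<tau> K \<longrightarrow> finite (block_eigenvalues a s \<tau>) \<longrightarrow>
     separated \<epsilon> (block_eigenvalues a s \<tau>) \<longrightarrow>
     \<Xi> (block_op a s \<tau>) = real (card (block_eigenvalues a s \<tau>)) * \<mu>)"

lemma counts_eigenvalues_Leb:
  assumes e: "\<epsilon> > 0"
  shows "counts_eigenvalues \<epsilon> (Leb_pseudospectrum \<epsilon>)"
  unfolding counts_eigenvalues_def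
proof (intro exI[of _ "measure lebesgue (ball (0 :: complex) \<epsilon>)"] conjI allI impI)
  show "measure lebesgue (ball (0 :: complex) \<epsilon>) > 0" using content_ball_pos[OF e, of "0 :: complex"] by simp
  fix a s \<tau> K
  assume b: "block a s \<tau> K" and fin: "finite (block_eigenvalues a s \<tau>)"
    and sep: "separated \<epsilon> (block_eigenvalues a s \<tau>)"
  show "Leb_pseudospectrum \<epsilon> (block_op a s \<tau>)
      = real (card (block_eigenvalues a s \<tau>)) * measure lebesgue (ball (0 :: complex) \<epsilon>)"
    unfolding Leb_pseudospectrum_def block.pseudospectrum_block_op[OF b e]
    by (rule measure_Union_balls[OF fin _ e])
      (use sep in \<open>auto simp: separated_def dist_norm simp flip: of_real_diff\<close>)
qed

lemma counts_eigenvalues_LebR: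
  assumes e: "\<epsilon> > 0"
  shows "counts_eigenvalues \<epsilon> (LebR_pseudospectrum \<epsilon>)"
  unfolding counts_eigenvalues_def
proof (intro exI[of _ "measure lebesgue (ball (0 :: real) \<epsilon>)"] conjI allI impI)
  show "measure lebesgue (ball (0 :: real) \<epsilon>) > 0" using content_ball_pos[OF e, of "0 :: real"] by simp
  fix a s \<tau> K
  assume b: "block a s \<tau> K" and fin: "finite (block_eigenvalues a s \<tau>)"
    and sep: "separated \<epsilon> (block_eigenvalues a s \<tau>)"
  have eq: "{t. complex_of_real t \<in> pseudospectrum \<epsilon> (block_op a s \<tau>)}
      = (\<Union>v\<in>block_eigenvalues a s \<tau>. ball v \<epsilon>)"
    unfolding block.pseudospectrum_block_op[OF b e] by (auto simp: dist_norm simp flip: of_real_diff)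
  show "LebR_pseudospectrum \<epsilon> (block_op a s \<tau>)
      = real (card (block_eigenvalues a s \<tau>)) * measure lebesgue (ball (0 :: real) \<epsilon>)"
    unfolding LebR_pseudospectrum_def eq
    by (rule measure_Union_balls[OF fin _ e]) (use sep in \<open>auto simp: separated_def dist_norm\<close>)
qed


section \<open>Lower bounds\<close>

text \<open>A general algorithm is locally constant for the topology generated by the
  evaluations.\<close>

lemma general_algorithm_eventually_constant:
  assumes alg: "general_algorithm P \<Gamma>" and A: "A \<in> Dom P"
    and dom: "\<forall>\<^sub>F B in F. B \<in> Dom P" and evals: "\<And>h. h \<in> evaluations P \<Longrightarrow> \<forall>\<^sub>F B in F. h B = h A"
  shows "\<forall>\<^sub>F B in F. \<Gamma> B = \<Gamma> A"
proof -
  obtain L where L: "finite (L A)" "L A \<subseteq> evaluations P"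
    "\<And>B. B \<in> Dom P \<Longrightarrow> \<forall>h\<in>L A. h B = h A \<Longrightarrow> \<Gamma> B = \<Gamma> A"
    using alg A unfolding general_algorithm_def by blast
  have "\<forall>\<^sub>F B in F. \<forall>h\<in>L A. h B = h A"
    using L evals by (intro eventually_ball_finite) auto
  with dom show ?thesis by eventually_elim (rule L(3))
qed

subsection \<open>No error control\<close>

text \<open>No finite set of evaluations separates A from all B m, but the values at A and B m
  stay apart.\<close>

lemma not_Delta1_criterion:
  fixes A :: 'a and B :: "nat \<Rightarrow> 'a"
  assumes A: "A \<in> Dom P" and B: "\<And>m. B m \<in> Dom P"
    and evals: "\<And>h. h \<in> evaluations P \<Longrightarrow> \<forall>\<^sub>F m in sequentially. h (B m) = h A"
    and gap: "\<And>m. \<mu> \<le> dist (Xi P (B m)) (Xi P A)" "\<mu> > 0"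
  shows "P \<notin> SCI_Delta General 1"
proof
  assume "P \<in> SCI_Delta General 1"
  then obtain \<Gamma> where \<Gamma>: "algorithms General P 1 \<Gamma>"
    "\<And>n A. A \<in> Dom P \<Longrightarrow> dist (\<Gamma> [n] A) (Xi P A) \<le> 1 / 2 ^ n" by (auto simp: SCI_Delta_def)
  obtain n where n: "(1 / 2 :: real) ^ n < \<mu> / 2" using real_arch_pow_inv[of "\<mu> / 2" "1 / 2"] gap(2) by auto
  have "general_algorithm P (\<Gamma> [n])" using \<Gamma>(1) by (auto simp: algorithms_def)
  from general_algorithm_eventually_constant[OF this A, of "filtermap B sequentially"]
  have "\<forall>\<^sub>F m in sequentially. \<Gamma> [n] (B m) = \<Gamma> [n] A"
    using B evals by (simp add: eventually_filtermap)
  then obtain m where m: "\<Gamma> [n] (B m) = \<Gamma> [n] A" by (auto simp: eventually_sequentially)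
  have "\<mu> \<le> dist (Xi P (B m)) (\<Gamma> [n] A) + dist (\<Gamma> [n] A) (Xi P A)"
    using gap(1)[of m] dist_triangle[of "Xi P (B m)" "Xi P A" "\<Gamma> [n] A"] by linarith
  also have "\<dots> \<le> 1 / 2 ^ n + 1 / 2 ^ n"
    using \<Gamma>(2)[OF B, of n m] \<Gamma>(2)[OF A, of n] by (simp add: m dist_commute)
  also have "\<dots> < \<mu>" using n by (simp add: power_one_over)
  finally show False by simp
qed

text \<open>On the image of the embedding emb of operators into inputs, h is a constant or one
  of the evaluations of \<open>Lambda2\<close>.\<close>

definition operator_evaluation :: "(operator \<Rightarrow> 'a) \<Rightarrow> ('a \<Rightarrow> complex) \<Rightarrow> bool" where
  "operator_evaluation emb h \<longleftrightarrow>
     (\<exists>i j. \<forall>A. h (emb A) = \<llangle>A (basis_vec j), basis_vec i\<rrangle>) \<or>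
     (\<exists>i j. \<forall>A. h (emb A) = \<llangle>A (basis_vec j), A (basis_vec i)\<rrangle>) \<or>
     (\<exists>i j. \<forall>A. h (emb A) = \<llangle>adj A (basis_vec j), adj A (basis_vec i)\<rrangle>) \<or>
     (\<exists>c. \<forall>A. h (emb A) = c)"

text \<open>One additional eigenvalue \<open>3 \<epsilon>\<close>, placed at a position that has not been read, adds a
  whole disc to the pseudospectrum of 0.\<close>

lemma not_Delta1_if_diagonal:
  fixes P :: "('a, 'l) problem" and emb :: "operator \<Rightarrow> 'a"
  assumes e: "\<epsilon> > 0" and count: "counts_eigenvalues \<epsilon> \<Xi>"
    and dom: "\<And>a K. (\<And>i. \<bar>a i\<bar> \<le> K) \<Longrightarrow> emb (block_op a 0 id) \<in> Dom P"
    and Xi: "\<And>A. Xi P (emb A) = \<Xi> A"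
    and evals: "\<And>h. h \<in> evaluations P \<Longrightarrow> operator_evaluation emb h"
  shows "P \<notin> SCI_Delta General 1"
proof -
  define d where "d m i = (if i = m then 3 * \<epsilon> else 0)" for m i :: nat
  define B where "B m = block_op (d m) 0 id" for m
  define Z where "Z = block_op (\<lambda>_. 0) 0 id"
  have bd: "\<bar>d m i\<bar> \<le> 3 * \<epsilon>" for m i using e by (simp add: d_def)
  have blockB: "block (d m) 0 id (3 * \<epsilon>)" for m using bd e by unfold_locales auto
  have blockZ: "block (\<lambda>_. 0) 0 id (3 * \<epsilon>)" using e by unfold_locales auto
  have adjB: "adj (B m) = B m" and adjZ: "adj Z = Z" for m
    unfolding B_def Z_def by (rule block.adj_block_op[OF blockB]) (rule block.adj_block_op[OF blockZ])
  have "{d m i |i. id i = i} = {0, 3 * \<epsilon>}" for m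
    by (auto simp: d_def intro: exI[of _ m] exI[of _ "Suc m"])
  hence evB: "block_eigenvalues (d m) 0 id = {0, 3 * \<epsilon>}" for m by (simp add: block_eigenvalues_def)
  have evZ: "block_eigenvalues (\<lambda>_. 0) 0 id = {0}" by (auto simp: block_eigenvalues_def)
  obtain \<mu> where mu: "\<mu> > 0" "\<And>m. \<Xi> (B m) = 2 * \<mu>" "\<Xi> Z = \<mu>"
  proof -
    obtain \<mu> where *: "\<mu> > 0" "\<And>a s \<tau> K. block a s \<tau> K \<Longrightarrow> finite (block_eigenvalues a s \<tau>) \<Longrightarrow>
     separated \<epsilon> (block_eigenvalues a s \<tau>) \<Longrightarrow>
     \<Xi> (block_op a s \<tau>) = real (card (block_eigenvalues a s \<tau>)) * \<mu>"
      using count unfolding counts_eigenvalues_def by blast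
    have "\<Xi> (B m) = 2 * \<mu>" for m using *(2)[OF blockB, of m] e by (simp add: B_def evB separated_def)
    moreover have "\<Xi> Z = \<mu>" using *(2)[OF blockZ] by (simp add: Z_def evZ separated_def)
    ultimately show ?thesis using that *(1) by blast
  qed
  have apply_eq: "B m (basis_vec j) = Z (basis_vec j)" if "j < m" for m j
    using that by (intro ell2_eqI)
      (simp add: B_def Z_def block.coord_block_op[OF blockB] block.coord_block_op[OF blockZ] block_coord_def d_def)
  show ?thesis
  proof (rule not_Delta1_criterion)
    show "emb Z \<in> Dom P" "\<And>m. emb (B m) \<in> Dom P" unfolding Z_def B_def using bd by (auto intro!: dom)
    show "\<mu> > 0" "\<And>m. \<mu> \<le> dist (Xi P (emb (B m))) (Xi P (emb Z))" using mu by (auto simp: Xi dist_norm)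
    fix h assume "h \<in> evaluations P"
    then consider i j where "\<And>A. h (emb A) = \<llangle>A (basis_vec j), basis_vec i\<rrangle>"
      | i j where "\<And>A. h (emb A) = \<llangle>A (basis_vec j), A (basis_vec i)\<rrangle>"
      | i j where "\<And>A. h (emb A) = \<llangle>adj A (basis_vec j), adj A (basis_vec i)\<rrangle>"
      | c where "\<And>A. h (emb A) = c"
      using evals unfolding operator_evaluation_def by blast
    hence "\<exists>M. \<forall>m\<ge>Suc M. h (emb (B m)) = h (emb Z)"
    proof cases
      case (1 i j)
      thus ?thesis by (intro exI[of _ "max i j"]) (simp add: apply_eq)
    next
      case (2 i j)
      thus ?thesis by (intro exI[of _ "max i j"]) (simp add: apply_eq)
    next
      case (3 i j)
      thus ?thesis by (intro exI[of _ "max i j"]) (simp add: apply_eq adjB adjZ)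
    qed simp
    thus "\<forall>\<^sub>F m in sequentially. h (emb (B m)) = h (emb Z)"
      by (auto simp: eventually_sequentially)
  qed
qed

subsection \<open>No single limit from matrix entries\<close>

text \<open>For s = \<open>2 \<epsilon>\<close>, even positions carry s as long as they are fixed by the involution.
  The involution joins the even position 2 r, for r in R, to the odd position 2 l(r) + 5 in
  a block with eigenvalues 0 and 2 s. Positions 1 and 3, which are never joined, provide the
  eigenvalues 2 s and 0 in all cases, so the eigenvalue s is present if and only if R is not
  everything.\<close>

definition join :: "(nat \<Rightarrow> nat) \<Rightarrow> nat set \<Rightarrow> nat \<Rightarrow> nat" where
  "join l R i = (if even i \<and> i div 2 \<in> R then 2 * l (i div 2) + 5
     else if \<exists>r\<in>R. i = 2 * l r + 5 then 2 * inv_into R l ((i - 5) div 2) else i)"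

definition joined_op :: "real \<Rightarrow> (nat \<Rightarrow> nat) \<Rightarrow> nat set \<Rightarrow> operator" where
  "joined_op s l R = block_op (\<lambda>i. if even i then s else if i = 1 then 2 * s else 0) s (join l R)"

lemma join_even: "r \<in> R \<Longrightarrow> join l R (2 * r) = 2 * l r + 5"
  by (simp add: join_def)

lemma join_odd:
  assumes "inj_on l R" "r \<in> R"
  shows "join l R (2 * l r + 5) = 2 * r"
proof -
  have "inv_into R l ((2 * l r + 5 - 5) div 2) = r" using assms by simp
  thus ?thesis using assms unfolding join_def by auto
qed

text \<open>Case analysis on the role of a position: joined source, joined target, or fixed. The
  parities of \<open>2 r\<close> and \<open>2 l(r) + 5\<close> keep the first two apart.\<close>

lemma join_cases:
  assumes "inj_on l R"
  obtains r where "r \<in> R" "i = 2 * r" "join l R i = 2 * l r + 5"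
  | r where "r \<in> R" "i = 2 * l r + 5" "join l R i = 2 * r"
  | "join l R i = i" "\<And>r. r \<in> R \<Longrightarrow> i \<noteq> 2 * r" "\<And>r. r \<in> R \<Longrightarrow> i \<noteq> 2 * l r + 5"
proof -
  consider "\<exists>r\<in>R. i = 2 * r" | "\<exists>r\<in>R. i = 2 * l r + 5"
    | "\<And>r. r \<in> R \<Longrightarrow> i \<noteq> 2 * r" "\<And>r. r \<in> R \<Longrightarrow> i \<noteq> 2 * l r + 5" by blast
  thus ?thesis
  proof cases
    case 3
    have "\<not> (even i \<and> i div 2 \<in> R)" using 3(1) by (metis dvd_mult_div_cancel)
    hence "join l R i = i" using 3(2) unfolding join_def by auto
    thus ?thesis using that(3) 3 by blast
  qed (use that join_even join_odd[OF assms] in blast)+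
qed

lemma block_joined:
  assumes "inj_on l R" "s > 0"
  shows "block (\<lambda>i. if even i then s else if i = 1 then 2 * s else 0) s (join l R) (2 * s)"
proof
  fix i
  show "join l R (join l R i) = i"
    by (rule join_cases[OF assms(1), of i]) (simp_all add: join_even join_odd[OF assms(1)])
qed (use assms in auto)

lemma joined_eigenvalues:
  assumes inj: "inj_on l R"
  shows "block_eigenvalues (\<lambda>i. if even i then s else if i = 1 then 2 * s else 0) s (join l R)
    = (if R = UNIV then {0, 2 * s} else {0, s, 2 * s})"
proof -
  let ?a = "\<lambda>i :: nat. if even i then s else if i = 1 then 2 * s else 0 :: real"
  have fixed_odd: "join l R 1 = 1" "join l R 3 = 3"
    by (rule join_cases[OF inj, of 1]; simp; presburger) (rule join_cases[OF inj, of 3]; simp; presburger)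
  define E where "E = {?a i |i. join l R i = i}"
  have mem: "?a i \<in> E" if "join l R i = i" for i using that unfolding E_def by blast
  have "2 * s \<in> E" "0 \<in> E" using mem[OF fixed_odd(1)] mem[OF fixed_odd(2)] by simp_all
  moreover have "s \<in> E" if ne: "R \<noteq> UNIV"
  proof -
    obtain r where r: "r \<notin> R" using ne by blast
    have "join l R (2 * r) = 2 * r"
    proof (rule join_cases[OF inj, where i = "2 * r"])
      fix r' assume "2 * r = 2 * l r' + 5"
      thus ?thesis by presburger
    qed (use r in auto)
    thus ?thesis using mem[of "2 * r"] by simp
  qed
  moreover have "E \<subseteq> {0, 2 * s}" if "R = UNIV"
  proof -
    have "odd i" if "join l R i = i" for i
    proof
      assume "even i"
      then obtain r where "i = 2 * r" by blast
      hence "2 * l r + 5 = 2 * r" using join_even[of r R l] \<open>R = UNIV\<close> \<open>join l R i = i\<close> by simp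
      thus False by presburger
    qed
    thus ?thesis unfolding E_def by auto
  qed
  moreover have "E \<subseteq> {0, s, 2 * s}" unfolding E_def by auto
  ultimately show ?thesis unfolding block_eigenvalues_def E_def[symmetric] by auto
qed

text \<open>Joining the sources from k on changes only entries with a row or column index \<open>2
  l(r) + 5\<close> with \<open>r \<ge> k\<close>, because a joined source keeps its diagonal entry s.\<close>

lemma coord_joined_op_eq:
  assumes l: "strict_mono l" and s: "s > 0" and i: "i < l k" and j: "j < l k"
  shows "coord (joined_op s l UNIV (basis_vec j)) i = coord (joined_op s l {..<k} (basis_vec j)) i"
proof -
  have inj: "inj_on l R" for R using l by (simp add: inj_on_subset strict_mono_imp_inj_on)
  have large: "l k \<le> l r" if "k \<le> r" for r using l that by (simp add: strict_mono_less_eq)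
  note coord = joined_op_def block.coord_block_op[OF block_joined[OF inj s]] block_coord_def
  show ?thesis
  proof (rule join_cases[OF inj, where i = i and R = "{..<k}"])
    fix r assume "r \<in> {..<k}" "i = 2 * r" "join l {..<k} i = 2 * l r + 5"
    thus ?thesis by (simp add: coord join_even)
  next
    fix r assume "r \<in> {..<k}" "i = 2 * l r + 5" "join l {..<k} i = 2 * r"
    thus ?thesis by (simp add: coord join_odd[OF inj])
  next
    assume fixed: "join l {..<k} i = i" "\<And>r. r \<in> {..<k} \<Longrightarrow> i \<noteq> 2 * r" "\<And>r. r \<in> {..<k} \<Longrightarrow> i \<noteq> 2 * l r + 5"
    show ?thesis
    proof (rule join_cases[OF inj, where i = i and R = UNIV])
      fix r assume r: "i = 2 * r" "join l UNIV i = 2 * l r + 5"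
      hence "k \<le> r" using fixed(2)[of r] by (intro leI) auto
      hence "j \<noteq> 2 * l r + 5" using large[of r] j by auto
      thus ?thesis using r fixed(1) by (auto simp: coord)
    next
      fix r assume r: "i = 2 * l r + 5" "join l UNIV i = 2 * r"
      hence "k \<le> r" using fixed(3)[of r] by (intro leI) auto
      thus ?thesis using large[of r] i r by auto
    qed (use fixed in \<open>simp add: coord\<close>)
  qed
qed

lemma joined_op_cong:
  assumes "\<And>r. r \<in> R \<Longrightarrow> l r = l' r"
  shows "joined_op s l R = joined_op s l' R"
proof -
  have "inv_into R l = inv_into R l'" unfolding inv_into_def using assms by (auto simp: fun_eq_iff cong: conj_cong)
  hence "join l R = join l' R" unfolding join_def using assms by (auto simp: fun_eq_iff)
  thus ?thesis by (simp add: joined_op_def)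
qed

text \<open>Given a putative algorithm with a single limit, the pairs are chosen one by one.
  With R finite, the algorithm must eventually report three discs, and it does so after
  reading finitely many entries; the next odd partner is taken beyond these. The final
  operator thus makes the algorithm report three discs infinitely often, but has only two.\<close>

lemma not_Delta2_if_block_operators:
  fixes P :: "(operator, 'l) problem"
  assumes e: "\<epsilon> > 0" and count: "counts_eigenvalues \<epsilon> (Xi P)"
    and dom: "\<And>a s \<tau> K. block a s \<tau> K \<Longrightarrow> block_op a s \<tau> \<in> Dom P"
    and evals: "\<And>h. h \<in> evaluations P \<Longrightarrow>
      (\<exists>i j. \<forall>A. h A = \<llangle>A (basis_vec j), basis_vec i\<rrangle>) \<or> (\<exists>c. \<forall>A. h A = c)"
  shows "P \<notin> SCI_Delta General 2"
proof
  assume "P \<in> SCI_Delta General 2"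
  then obtain k \<Gamma> where k: "k < 2" and \<Gamma>: "tower General P k \<Gamma>" by (auto simp: SCI_Delta_def)
  hence "k = 1" by (auto simp: tower_def)
  with \<Gamma> have alg: "\<And>n. general_algorithm P (\<Gamma> [n])"
    and lim: "\<And>A. A \<in> Dom P \<Longrightarrow> (\<lambda>n. \<Gamma> [n] A) \<longlonglongrightarrow> Xi P A"
    by (auto simp: tower_def algorithms_def)
  define s where "s = 2 * \<epsilon>"
  have s: "s > 0" using e by (simp add: s_def)
  obtain \<mu> where mu: "\<mu> > 0" "\<And>a s \<tau> K. block a s \<tau> K \<Longrightarrow> finite (block_eigenvalues a s \<tau>) \<Longrightarrow>
     separated \<epsilon> (block_eigenvalues a s \<tau>) \<Longrightarrow>
     Xi P (block_op a s \<tau>) = real (card (block_eigenvalues a s \<tau>)) * \<mu>"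
    using count unfolding counts_eigenvalues_def by blast
  have Xi: "Xi P (joined_op s l R) = (if R = UNIV then 2 * \<mu> else 3 * \<mu>)" if "inj_on l R" for l R
    unfolding joined_op_def using mu(2)[OF block_joined[OF that s]] s
    by (simp add: joined_eigenvalues[OF that] separated_def s_def[symmetric])
  have domJ: "joined_op s l R \<in> Dom P" if "inj_on l R" for l R
    unfolding joined_op_def by (rule dom[OF block_joined[OF that s]])
  define agree where "agree N A B \<longleftrightarrow> (\<forall>i<N. \<forall>j<N. coord (blinfun_apply B (basis_vec j)) i = coord (blinfun_apply A (basis_vec j)) i)"
    for N and A B :: operator
  have local: "\<exists>N. \<forall>B\<in>Dom P. agree N A B \<longrightarrow> \<Gamma> [n] B = \<Gamma> [n] A" if A: "A \<in> Dom P" for n A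
  proof -
    \<comment> \<open>the neighbourhoods of A are the operators with the same upper left corner of size N\<close>
    define F where "F = (INF N. principal {B \<in> Dom P. agree N A B})"
    have F: "eventually Q F \<longleftrightarrow> (\<exists>N. \<forall>B\<in>Dom P. agree N A B \<longrightarrow> Q B)" for Q
      unfolding F_def
    proof (subst eventually_INF_base)
      fix M N :: nat
      show "\<exists>K\<in>UNIV. principal {B \<in> Dom P. agree K A B}
          \<le> inf (principal {B \<in> Dom P. agree M A B}) (principal {B \<in> Dom P. agree N A B})"
        by (intro bexI[of _ "max M N"]) (auto simp: agree_def)
    qed (auto simp: eventually_principal)
    have "\<forall>\<^sub>F B in F. \<Gamma> [n] B = \<Gamma> [n] A"
    proof (rule general_algorithm_eventually_constant[OF alg A])
      show "\<forall>\<^sub>F B in F. B \<in> Dom P" by (simp add: F)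
      fix h assume "h \<in> evaluations P"
      then consider i j where "\<And>A. h A = \<llangle>A (basis_vec j), basis_vec i\<rrangle>" | c where "\<And>A. h A = c"
        using evals by blast
      thus "\<forall>\<^sub>F B in F. h B = h A"
      proof cases
        case (1 i j)
        thus ?thesis unfolding F by (intro exI[of _ "Suc (max i j)"]) (simp add: agree_def cinner_basis_vec)
      qed (simp add: F)
    qed
    thus ?thesis by (simp add: F)
  qed
  \<comment> \<open>r qualifies as partner of source k: \<open>5 / 2 \<mu>\<close> separates the volumes of two and of three discs, and nothing at positions
    from r on has been read\<close>
  define Q where "Q l k r \<longleftrightarrow> (\<forall>j<k. l j < r) \<and> (\<exists>n\<ge>k. \<Gamma> [n] (joined_op s l {..<k}) > 5 / 2 * \<mu> \<and>
      (\<forall>B\<in>Dom P. agree r (joined_op s l {..<k}) B \<longrightarrow> \<Gamma> [n] B = \<Gamma> [n] (joined_op s l {..<k})))"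
    for l :: "nat \<Rightarrow> nat" and k r
  have "\<exists>l. \<forall>k. Q l k (l k)"
  proof (rule dependent_wellorder_choice)
    fix r k and l l' :: "nat \<Rightarrow> nat" assume "\<And>j. j < k \<Longrightarrow> l j = l' j"
    moreover from this have "joined_op s l {..<k} = joined_op s l' {..<k}" by (intro joined_op_cong) auto
    ultimately show "Q l k r = Q l' k r" by (simp add: Q_def)
  next
    fix k and l :: "nat \<Rightarrow> nat" assume IH: "\<And>j. j < k \<Longrightarrow> Q l j (l j)"
    define J where "J = joined_op s l {..<k}"
    have "l i < l j" if "i < j" "j < k" for i j using IH[OF that(2)] that(1) by (simp add: Q_def)
    hence inj: "inj_on l {..<k}" by (intro linorder_inj_onI) (auto simp: less_imp_neq)
    have "{..<k} \<noteq> UNIV" using infinite_UNIV_nat by (metis finite_lessThan)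
    hence "(\<lambda>n. \<Gamma> [n] J) \<longlonglongrightarrow> 3 * \<mu>" using lim[OF domJ[OF inj]] by (simp add: Xi[OF inj] J_def)
    from order_tendstoD(1)[OF this, of "5 / 2 * \<mu>"] obtain n0 where "\<And>n. n \<ge> n0 \<Longrightarrow> \<Gamma> [n] J > 5 / 2 * \<mu>"
      using mu(1) by (auto simp: eventually_sequentially)
    hence n: "\<Gamma> [max n0 k] J > 5 / 2 * \<mu>" by simp
    obtain N where N: "\<forall>B\<in>Dom P. agree N J B \<longrightarrow> \<Gamma> [max n0 k] B = \<Gamma> [max n0 k] J"
      using local[of J "max n0 k"] domJ[OF inj] unfolding J_def by blast
    define r where "r = Max (insert N ((\<lambda>j. Suc (l j)) ` {..<k}))"
    have r: "N \<le> r" "\<And>j. j < k \<Longrightarrow> l j < r" by (auto simp: r_def Suc_le_eq[symmetric])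
    have "agree N J B" if "agree r J B" for B using that r(1) by (auto simp: agree_def)
    hence "Q l k r" unfolding Q_def J_def[symmetric] using N n r(2)
      by (intro conjI allI impI exI[of _ "max n0 k"]) auto
    thus "\<exists>r. Q l k r" by blast
  qed
  then obtain l where l: "\<And>k. Q l k (l k)" by blast
  have mono: "strict_mono l" by (rule strict_monoI) (use l in \<open>auto simp: Q_def\<close>)
  hence inj: "inj_on l R" for R by (simp add: inj_on_subset strict_mono_imp_inj_on)
  define J where "J = joined_op s l UNIV"
  have "\<exists>n\<ge>k. \<Gamma> [n] J > 5 / 2 * \<mu>" for k
  proof -
    have "agree (l k) (joined_op s l {..<k}) J"
      unfolding agree_def J_def using coord_joined_op_eq[OF mono s] by blast
    thus ?thesis using l[of k] domJ[OF inj] unfolding Q_def J_def by metis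
  qed
  moreover have "(\<lambda>n. \<Gamma> [n] J) \<longlonglongrightarrow> 2 * \<mu>"
    using lim[OF domJ[OF inj[of UNIV]]] Xi[OF inj[of UNIV]] by (simp add: J_def)
  from order_tendstoD(2)[OF this, of "5 / 2 * \<mu>"] obtain n0 where "\<And>n. n \<ge> n0 \<Longrightarrow> \<Gamma> [n] J < 5 / 2 * \<mu>"
    using mu(1) by (auto simp: eventually_sequentially)
  ultimately show False using less_asym by blast
qed

section \<open>A language of arithmetic expressions and its compiler\<close>

text \<open>Expressions denote complex numbers. Variables are numbered from the outside inwards
  (de Bruijn levels), so that the number of a variable stays the same below further binders.
  \<open>Fold prod b e\<close> is the product or sum of e over a new variable ranging over \<open>{..<\<lceil>Re b\<rceil>}\<close>;
  \<open>Quot\<close> divides by the real part of its second argument.\<close>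

datatype bop = Plus | Minus | Times | Quot

datatype 'l expr =
    Lit real real
  | Var nat
  | Bin bop "'l expr" "'l expr"
  | Conj "'l expr"
  | IfNeg "'l expr" "'l expr" "'l expr"
  | Fold bool "'l expr" "'l expr"
  | Query1 'l "'l expr"
  | Query2 'l "'l expr" "'l expr"

fun bop_fun :: "bop \<Rightarrow> complex \<Rightarrow> complex \<Rightarrow> complex" where
  "bop_fun Plus u v = u + v"
| "bop_fun Minus u v = u - v"
| "bop_fun Times u v = u * v"
| "bop_fun Quot u v = u / complex_of_real (Re v)"

type_synonym 'l answers = "'l \<Rightarrow> nat list \<Rightarrow> complex"

definition nat_ceil :: "complex \<Rightarrow> nat" where "nat_ceil v = nat \<lceil>Re v\<rceil>"

primrec eval :: "'l answers \<Rightarrow> complex list \<Rightarrow> 'l expr \<Rightarrow> complex" where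
  "eval orc env (Lit a b) = Complex a b"
| "eval orc env (Var i) = env ! i"
| "eval orc env (Bin op e1 e2) = bop_fun op (eval orc env e1) (eval orc env e2)"
| "eval orc env (Conj e) = cnj (eval orc env e)"
| "eval orc env (IfNeg c e1 e2) = (if Re (eval orc env c) < 0 then eval orc env e1 else eval orc env e2)"
| "eval orc env (Fold p b e) = (if p
     then \<Prod>i<nat_ceil (eval orc env b). eval orc (env @ [of_nat i]) e
     else \<Sum>i<nat_ceil (eval orc env b). eval orc (env @ [of_nat i]) e)"
| "eval orc env (Query1 l e) = orc l [addr (Re (eval orc env e))]"
| "eval orc env (Query2 l e1 e2) = orc l [addr (Re (eval orc env e1)), addr (Re (eval orc env e2))]"

primrec closed_below :: "nat \<Rightarrow> 'l expr \<Rightarrow> bool" where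
  "closed_below n (Lit a b) \<longleftrightarrow> True"
| "closed_below n (Var i) \<longleftrightarrow> i < n"
| "closed_below n (Bin op e1 e2) \<longleftrightarrow> closed_below n e1 \<and> closed_below n e2"
| "closed_below n (Conj e) \<longleftrightarrow> closed_below n e"
| "closed_below n (IfNeg c e1 e2) \<longleftrightarrow> closed_below n c \<and> closed_below n e1 \<and> closed_below n e2"
| "closed_below n (Fold p b e) \<longleftrightarrow> closed_below n b \<and> closed_below (Suc n) e"
| "closed_below n (Query1 l e) \<longleftrightarrow> closed_below n e"
| "closed_below n (Query2 l e1 e2) \<longleftrightarrow> closed_below n e1 \<and> closed_below n e2"

primrec literals :: "'l expr \<Rightarrow> real set" where
  "literals (Lit a b) = {a, b}"
| "literals (Var i) = {}"
| "literals (Bin op e1 e2) = literals e1 \<union> literals e2"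
| "literals (Conj e) = literals e"
| "literals (IfNeg c e1 e2) = literals c \<union> literals e1 \<union> literals e2"
| "literals (Fold p b e) = literals b \<union> literals e"
| "literals (Query1 l e) = literals e"
| "literals (Query2 l e1 e2) = literals e1 \<union> literals e2"

subsection \<open>Evaluation reads finitely many oracle values\<close>

primrec queries :: "'l answers \<Rightarrow> complex list \<Rightarrow> 'l expr \<Rightarrow> ('l \<times> nat list) set" where
  "queries orc env (Lit a b) = {}"
| "queries orc env (Var i) = {}"
| "queries orc env (Bin op e1 e2) = queries orc env e1 \<union> queries orc env e2"
| "queries orc env (Conj e) = queries orc env e"
| "queries orc env (IfNeg c e1 e2) = queries orc env c \<union>
     (if Re (eval orc env c) < 0 then queries orc env e1 else queries orc env e2)"
| "queries orc env (Fold p b e) = queries orc env b \<union>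
     (\<Union>i<nat_ceil (eval orc env b). queries orc (env @ [of_nat i]) e)"
| "queries orc env (Query1 l e) = queries orc env e \<union> {(l, [addr (Re (eval orc env e))])}"
| "queries orc env (Query2 l e1 e2) = queries orc env e1 \<union> queries orc env e2 \<union>
     {(l, [addr (Re (eval orc env e1)), addr (Re (eval orc env e2))])}"

lemma finite_queries: "finite (queries orc env e)"
  by (induction e arbitrary: env) auto

text \<open>The queries may depend on earlier answers. If two oracles agree on the queries made
  with the first one, the computation takes the same course with the second.\<close>

lemma eval_queries_cong:
  "(\<And>l w. (l, w) \<in> queries orc env e \<Longrightarrow> orc' l w = orc l w) \<Longrightarrow>
    eval orc' env e = eval orc env e \<and> queries orc' env e = queries orc env e"
proof (induction e arbitrary: env)
  case (Fold p b e)
  have b: "eval orc' env b = eval orc env b \<and> queries orc' env b = queries orc env b"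
    by (rule Fold.IH(1)) (use Fold.prems in auto)
  have "eval orc' (env @ [of_nat i]) e = eval orc (env @ [of_nat i]) e \<and>
      queries orc' (env @ [of_nat i]) e = queries orc (env @ [of_nat i]) e"
    if "i < nat_ceil (eval orc env b)" for i
    by (rule Fold.IH(2)) (use Fold.prems that in auto)
  with b show ?case by auto
next
  case (IfNeg c e1 e2)
  have "eval orc' env c = eval orc env c \<and> queries orc' env c = queries orc env c"
    by (rule IfNeg.IH(1)) (use IfNeg.prems in auto)
  moreover have "eval orc' env e1 = eval orc env e1 \<and> queries orc' env e1 = queries orc env e1"
    if "Re (eval orc env c) < 0"
    by (rule IfNeg.IH(2)) (use IfNeg.prems that in auto)
  moreover have "eval orc' env e2 = eval orc env e2 \<and> queries orc' env e2 = queries orc env e2"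
    if "\<not> Re (eval orc env c) < 0"
    by (rule IfNeg.IH(3)) (use IfNeg.prems that in auto)
  ultimately show ?case by auto
qed auto

text \<open>The set of evaluations read on A is the set of queries that have a value; the fixed
  element \<open>h0\<close> makes it non-empty.\<close>

lemma general_algorithm_eval:
  assumes nonneg: "\<And>A. A \<in> Dom P \<Longrightarrow> 0 \<le> Re (eval (oracle_of P A) env e)"
    and ne: "evaluations P \<noteq> {}"
  shows "general_algorithm P (\<lambda>A. Re (eval (oracle_of P A) env e))"
proof -
  obtain h0 where h0: "h0 \<in> evaluations P" using ne by blast
  define L where "L A = insert h0 {h. \<exists>(l, w)\<in>queries (oracle_of P A) env e. Lam P l w = Some h}" for A
  have fin: "finite (L A)" for A
  proof -
    have "{h. \<exists>(l, w)\<in>queries (oracle_of P A) env e. Lam P l w = Some h}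
        \<subseteq> (\<lambda>(l, w). the (Lam P l w)) ` queries (oracle_of P A) env e" by force
    thus ?thesis unfolding L_def using finite_queries finite_subset by blast
  qed
  have sub: "L A \<subseteq> evaluations P" for A using h0 by (auto simp: L_def evaluations_def)
  have *: "L B = L A \<and> eval (oracle_of P B) env e = eval (oracle_of P A) env e"
    if eq: "\<forall>h\<in>L A. h B = h A" for A B
  proof -
    have "oracle_of P B l w = oracle_of P A l w" if "(l, w) \<in> queries (oracle_of P A) env e" for l w
    proof (cases "Lam P l w")
      case (Some h)
      hence "h \<in> L A" using that by (auto simp: L_def)
      thus ?thesis using eq Some by (simp add: oracle_of_def)
    qed (simp add: oracle_of_def)
    hence "eval (oracle_of P B) env e = eval (oracle_of P A) env e"
      and "queries (oracle_of P B) env e = queries (oracle_of P A) env e"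
      using eval_queries_cong[of "oracle_of P A" env e "oracle_of P B"] by blast+
    thus ?thesis by (simp add: L_def)
  qed
  have ne: "L A \<noteq> {}" for A by (simp add: L_def)
  show ?thesis
    unfolding general_algorithm_def
  proof (intro conjI exI[of _ L] ballI impI)
    show "(\<lambda>A. Re (eval (oracle_of P A) env e)) \<in> Dom P \<rightarrow> {0..}" using nonneg by auto
  next
    fix A B assume "\<forall>h\<in>L A. h B = h A"
    from *[OF this] show "L B = L A" "Re (eval (oracle_of P B) env e) = Re (eval (oracle_of P A) env e)" by auto
  qed (rule fin ne sub)+
qed

subsection \<open>Compilation\<close>

text \<open>A complex number occupies two adjacent registers. \<open>compile \<rho> d k e\<close> is code, to be
  placed at address k, that leaves the value of e in register d and changes registers from d
  on only; the variable i lives in register \<open>\<rho> ! i\<close>. Absolute addresses are needed for the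
  jumps.\<close>

fun bop_code :: "bop \<Rightarrow> nat \<Rightarrow> nat \<Rightarrow> nat \<Rightarrow> 'l instr list" where
  "bop_code Plus x y t = [Add x x y, Add (x + 1) (x + 1) (y + 1)]"
| "bop_code Minus x y t = [Sub x x y, Sub (x + 1) (x + 1) (y + 1)]"
| "bop_code Times x y t = [Mul t x y, Mul (t + 1) (x + 1) (y + 1), Sub t t (t + 1),
     Mul (t + 1) x (y + 1), Mul (t + 2) (x + 1) y, Add (x + 1) (t + 1) (t + 2),
     Const (t + 1) 0, Add x t (t + 1)]"
| "bop_code Quot x y t = [Div x x y, Div (x + 1) (x + 1) y]"

primrec compile :: "nat list \<Rightarrow> nat \<Rightarrow> nat \<Rightarrow> 'l expr \<Rightarrow> 'l instr list" where
  "compile \<rho> d k (Lit a b) = [Const d a, Const (d + 1) b]"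
| "compile \<rho> d k (Var i) = [Const d 0, Add (d + 1) (\<rho> ! i + 1) d, Add d (\<rho> ! i) d]"
| "compile \<rho> d k (Bin op e1 e2) =
     (let c1 = compile \<rho> d k e1; c2 = compile \<rho> (d + 2) (k + length c1) e2
      in c1 @ c2 @ bop_code op d (d + 2) (d + 4))"
| "compile \<rho> d k (Conj e) = compile \<rho> d k e @ [Const (d + 2) 0, Sub (d + 1) (d + 2) (d + 1)]"
| "compile \<rho> d k (IfNeg c e1 e2) =
     (let c0 = compile \<rho> d k c; k2 = k + length c0 + 1;
          c2 = compile \<rho> d k2 e2; k1 = k2 + length c2 + 2;
          c1 = compile \<rho> d k1 e1
      in c0 @ [JumpNeg d k1] @ c2 @ [Const (d + 2) (-1), JumpNeg (d + 2) (k1 + length c1)] @ c1)"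
| "compile \<rho> d k (Fold p b e) =
     (let cb = compile \<rho> d k b; loop = k + length cb + 4;
          ce = compile (\<rho> @ [d + 2]) (d + 6) (loop + 4) e;
          cu = bop_code (if p then Times else Plus) (d + 4) (d + 6) (d + 8) @
            [Const (d + 8) 1, Add (d + 2) (d + 2) (d + 8), Const (d + 8) (-1), JumpNeg (d + 8) loop]
      in cb @ [Const (d + 2) 0, Const (d + 3) 0, Const (d + 4) (if p then 1 else 0), Const (d + 5) 0] @
         [Sub (d + 6) (d + 2) d, JumpNeg (d + 6) (loop + 4), Const (d + 6) (-1),
          JumpNeg (d + 6) (loop + 4 + length ce + length cu)] @
         ce @ cu @ [Const (d + 6) 0, Add d (d + 4) (d + 6), Add (d + 1) (d + 5) (d + 6)])"
| "compile \<rho> d k (Query1 l e) = compile \<rho> d k e @ [Ask d l [d]]"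
| "compile \<rho> d k (Query2 l e1 e2) =
     (let c1 = compile \<rho> d k e1; c2 = compile \<rho> (d + 2) (k + length c1) e2
      in c1 @ c2 @ [Ask d l [d, d + 2]])"

definition reach :: "'l answers \<Rightarrow> 'l instr list \<Rightarrow> nat \<times> registers \<Rightarrow> nat \<times> registers \<Rightarrow> bool" where
  "reach orc p x y \<longleftrightarrow> (\<exists>t. (step orc p ^^ t) x = y)"

lemma reach_refl: "reach orc p x x"
  unfolding reach_def by (rule exI[of _ 0]) simp

lemma reach_trans:
  assumes "reach orc p x y" "reach orc p y z"
  shows "reach orc p x z"
proof -
  obtain t u where "(step orc p ^^ t) x = y" "(step orc p ^^ u) y = z" using assms by (auto simp: reach_def)
  hence "(step orc p ^^ (u + t)) x = z" by (simp add: funpow_add)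
  thus ?thesis unfolding reach_def by blast
qed

lemma reach_step: "step orc p x = y \<Longrightarrow> reach orc p x y"
  unfolding reach_def by (rule exI[of _ 1]) simp

text \<open>Jump targets are absolute, so correctness of a fragment is stated for a program that
  contains it at a given address.\<close>

definition code_at :: "'l instr list \<Rightarrow> nat \<Rightarrow> 'l instr list \<Rightarrow> bool" where
  "code_at p k c \<longleftrightarrow> (\<exists>pre post. p = pre @ c @ post \<and> length pre = k)"

lemma code_at_appendD:
  assumes "code_at p k (c @ c')"
  shows "code_at p k c" and "code_at p (k + length c) c'"
proof -
  obtain pre post where "p = pre @ (c @ c') @ post" "length pre = k" using assms by (auto simp: code_at_def)
  hence "p = pre @ c @ (c' @ post)" "p = (pre @ c) @ c' @ post" "length (pre @ c) = k + length c" by auto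
  thus "code_at p k c" "code_at p (k + length c) c'" using \<open>length pre = k\<close> unfolding code_at_def by blast+
qed

lemma code_at_ConsD:
  assumes "code_at p k (i # c)"
  shows "code_at p (Suc k) c" and "step orc p (k, s) = exec orc i (k, s)"
  using code_at_appendD(2)[of p k "[i]" c] assms by (auto simp: code_at_def step_def)

fun is_jump :: "'l instr \<Rightarrow> bool" where
  "is_jump (JumpNeg a t) \<longleftrightarrow> True"
| "is_jump _ \<longleftrightarrow> False"

definition update :: "'l answers \<Rightarrow> 'l instr \<Rightarrow> registers \<Rightarrow> registers" where
  "update orc i s = snd (exec orc i (0, s))"

lemma update_simps [simp]:
  "update orc (Const d c) s = s(d := c)"
  "update orc (Add d a b) s = s(d := s a + s b)"
  "update orc (Sub d a b) s = s(d := s a - s b)"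
  "update orc (Mul d a b) s = s(d := s a * s b)"
  "update orc (Div d a b) s = s(d := s a / s b)"
  "update orc (Ask d l rs) s = (let v = orc l (map (\<lambda>r. addr (s r)) rs) in s(d := Re v, Suc d := Im v))"
  by (simp_all add: update_def Let_def)

lemma reach_straight:
  "code_at p k c \<Longrightarrow> list_all (\<lambda>i. \<not> is_jump i) c \<Longrightarrow>
    reach orc p (k, s) (k + length c, fold (update orc) c s)"
proof (induction c arbitrary: k s)
  case (Cons i c)
  have "step orc p (k, s) = (Suc k, update orc i s)"
    using code_at_ConsD(2)[OF Cons.prems(1)] Cons.prems(2) by (cases i) (auto simp: update_def Let_def)
  from reach_trans[OF reach_step[OF this] Cons.IH[OF code_at_ConsD(1)[OF Cons.prems(1)]]]
  show ?case using Cons.prems(2) by simp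
qed (simp add: reach_refl)

lemma reach_jump:
  assumes "code_at p k (JumpNeg a t # c)"
  shows "reach orc p (k, s) (if s a < 0 then t else Suc k, s)"
  by (rule reach_step) (simp add: code_at_ConsD(2)[OF assms])

definition holds :: "registers \<Rightarrow> nat \<Rightarrow> complex \<Rightarrow> bool" where
  "holds s d v \<longleftrightarrow> s d = Re v \<and> s (d + 1) = Im v"

text \<open>All variables live below the register d from which on registers may be overwritten.\<close>

definition env_in :: "nat list \<Rightarrow> complex list \<Rightarrow> nat \<Rightarrow> registers \<Rightarrow> bool" where
  "env_in \<rho> env d s \<longleftrightarrow> length \<rho> = length env \<and> (\<forall>i<length env. \<rho> ! i + 1 < d \<and> holds s (\<rho> ! i) (env ! i))"

lemma env_in_mono:
  assumes "env_in \<rho> env d s" "\<And>r. r < d \<Longrightarrow> s' r = s r" "d \<le> d'"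
  shows "env_in \<rho> env d' s'"
  using assms unfolding env_in_def holds_def by fastforce

lemma env_in_snoc:
  assumes "env_in \<rho> env d s" "holds s d v" "d + 1 < d'" 
  shows "env_in (\<rho> @ [d]) (env @ [v]) d' s"
  using assms unfolding env_in_def by (auto simp: nth_append less_Suc_eq)

text \<open>x and y are the registers of the operands, x also that of the result, and
  temporaries start at t.\<close>

lemma bop_code_correct:
  assumes "holds s x u" "holds s y v" "x + 1 < y" "y + 1 < t"
  shows "holds (fold (update orc) (bop_code op x y t) s) x (bop_fun op u v)"
    and "r < t \<Longrightarrow> r \<noteq> x \<Longrightarrow> r \<noteq> x + 1 \<Longrightarrow> fold (update orc) (bop_code op x y t) s r = s r"
    and "list_all (\<lambda>i. \<not> is_jump i) (bop_code op x y t)"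
  using assms by (cases op; auto simp: holds_def Re_divide_of_real Im_divide_of_real)+

text \<open>By induction on the expression. All cases except those with jumps concatenate
  straight code with the code of subexpressions; for \<open>Fold\<close> the loop invariant \<open>Inv j\<close> says
  that the counter is j and the accumulator is the sum or product of the first j terms.\<close>

lemma compile_correct:
  assumes "closed_below (length env) e" "env_in \<rho> env d s" "code_at p k (compile \<rho> d k e)"
  shows "\<exists>s'. reach orc p (k, s) (k + length (compile \<rho> d k e), s') \<and>
    holds s' d (eval orc env e) \<and> (\<forall>r<d. s' r = s r)"
  using assms
proof (induction e arbitrary: env \<rho> d s k)
  case (Lit a b)
  show ?case using reach_straight[OF Lit.prems(3), of orc s] by (auto simp: holds_def)
next
  case (Var i)
  have "holds s (\<rho> ! i) (env ! i)" "\<rho> ! i + 1 < d" using Var by (auto simp: env_in_def)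
  thus ?case using reach_straight[OF Var.prems(3), of orc s] by (auto simp: holds_def)
next
  case (Bin op e1 e2)
  define c1 where "c1 = compile \<rho> d k e1"
  define c2 where "c2 = compile \<rho> (d + 2) (k + length c1) e2"
  have code: "compile \<rho> d k (Bin op e1 e2) = c1 @ c2 @ bop_code op d (d + 2) (d + 4)"
    by (simp add: c1_def c2_def Let_def)
  note at = Bin.prems(3)[unfolded code]
  obtain s1 where s1: "reach orc p (k, s) (k + length c1, s1)" "holds s1 d (eval orc env e1)" "\<forall>r<d. s1 r = s r"
    using Bin.IH(1)[OF _ Bin.prems(2), of k] Bin.prems(1) code_at_appendD(1)[OF at] by (auto simp: c1_def)
  have "env_in \<rho> env (d + 2) s1" using s1(3) by (intro env_in_mono[OF Bin.prems(2)]) auto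
  then obtain s2 where s2: "reach orc p (k + length c1, s1) (k + length c1 + length c2, s2)"
      "holds s2 (d + 2) (eval orc env e2)" "\<forall>r<d + 2. s2 r = s1 r"
    using Bin.IH(2)[of env \<rho> "d + 2" s1 "k + length c1"] Bin.prems(1)
      code_at_appendD(1)[OF code_at_appendD(2)[OF at]] by (auto simp: c2_def)
  have h: "holds s2 d (eval orc env e1)" using s1(2) s2(3) by (simp add: holds_def)
  have bc: "holds (fold (update orc) (bop_code op d (d + 2) (d + 4)) s2) d (bop_fun op (eval orc env e1) (eval orc env e2))"
    "\<And>r. r < d \<Longrightarrow> fold (update orc) (bop_code op d (d + 2) (d + 4)) s2 r = s2 r"
    "list_all (\<lambda>i. \<not> is_jump i) (bop_code op d (d + 2) (d + 4) :: 'a instr list)"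
    by (rule bop_code_correct[OF h s2(2)]; simp)+
  have "reach orc p (k, s) (k + length (compile \<rho> d k (Bin op e1 e2)), fold (update orc) (bop_code op d (d + 2) (d + 4)) s2)"
    using reach_trans[OF s1(1) reach_trans[OF s2(1) reach_straight[OF code_at_appendD(2)[OF code_at_appendD(2)[OF at]] bc(3)]]]
    unfolding code by (simp only: length_append add.assoc)
  moreover have "\<forall>r<d. fold (update orc) (bop_code op d (d + 2) (d + 4)) s2 r = s r"
    using bc(2) s1(3) s2(3) by simp
  ultimately show ?case using bc(1) by (metis eval.simps(3))
next
  case (Conj e)
  define c where "c = compile \<rho> d k e"
  note at = Conj.prems(3)[unfolded compile.simps, folded c_def]
  obtain s1 where s1: "reach orc p (k, s) (k + length c, s1)" "holds s1 d (eval orc env e)" "\<forall>r<d. s1 r = s r"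
    using Conj.IH[OF _ Conj.prems(2), of k] Conj.prems(1) code_at_appendD(1)[OF at] by (auto simp: c_def)
  define s2 where "s2 = fold (update orc) [Const (d + 2) 0, Sub (d + 1) (d + 2) (d + 1)] s1"
  have "reach orc p (k, s) (k + length (compile \<rho> d k (Conj e)), s2)"
    using reach_trans[OF s1(1) reach_straight[OF code_at_appendD(2)[OF at], of orc]]
    by (simp add: s2_def c_def add.assoc)
  moreover have "holds s2 d (eval orc env (Conj e))" "\<forall>r<d. s2 r = s r"
    using s1(2,3) by (simp_all add: s2_def holds_def)
  ultimately show ?case by metis
next
  case (IfNeg c e1 e2)
  define c0 where "c0 = compile \<rho> d k c"
  define k2 where "k2 = k + length c0 + 1"
  define c2 where "c2 = compile \<rho> d k2 e2"
  define k1 where "k1 = k2 + length c2 + 2"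
  define c1 where "c1 = compile \<rho> d k1 e1"
  have code: "compile \<rho> d k (IfNeg c e1 e2) =
      c0 @ [JumpNeg d k1] @ c2 @ [Const (d + 2) (-1), JumpNeg (d + 2) (k1 + length c1)] @ c1"
    by (simp add: c0_def c1_def c2_def k1_def k2_def Let_def)
  note at = IfNeg.prems(3)[unfolded code]
  note at_jump = code_at_appendD(2)[OF at]
  note at2 = code_at_appendD(2)[OF at_jump]
  note at_exit = code_at_appendD(2)[OF at2]
  obtain s1 where s1: "reach orc p (k, s) (k + length c0, s1)" "holds s1 d (eval orc env c)" "\<forall>r<d. s1 r = s r"
    using IfNeg.IH(1)[OF _ IfNeg.prems(2), of k] IfNeg.prems(1) code_at_appendD(1)[OF at] by (auto simp: c0_def)
  have env1: "env_in \<rho> env d s1" using s1(3) by (intro env_in_mono[OF IfNeg.prems(2)]) auto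
  have len: "k + length (compile \<rho> d k (IfNeg c e1 e2)) = k1 + length c1"
    unfolding code by (simp add: k1_def k2_def)
  have jump: "reach orc p (k + length c0, s1) (if s1 d < 0 then k1 else k2, s1)"
    using reach_jump[OF at_jump[unfolded append_Cons append_Nil], of orc s1]
    unfolding k2_def by (simp only: Suc_eq_plus1)
  show ?case
  proof (cases "Re (eval orc env c) < 0")
    case True
    have "code_at p k1 c1" using code_at_appendD(2)[OF at_exit] by (simp add: k1_def k2_def add.assoc)
    then obtain s2 where s2: "reach orc p (k1, s1) (k1 + length c1, s2)" "holds s2 d (eval orc env e1)" "\<forall>r<d. s2 r = s1 r"
      using IfNeg.IH(2)[OF _ env1, of k1] IfNeg.prems(1) by (auto simp: c1_def)
    have "reach orc p (k, s) (k1 + length c1, s2)"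
      using reach_trans[OF s1(1) reach_trans[OF _ s2(1)]] jump True s1(2) by (auto simp: holds_def)
    thus ?thesis unfolding len using s2 s1(3) True by auto
  next
    case False
    have "code_at p k2 c2" using code_at_appendD(1)[OF at2] by (simp add: k2_def)
    then obtain s2 where s2: "reach orc p (k2, s1) (k2 + length c2, s2)" "holds s2 d (eval orc env e2)" "\<forall>r<d. s2 r = s1 r"
      using IfNeg.IH(3)[OF _ env1, of k2] IfNeg.prems(1) by (auto simp: c2_def)
    have ex: "code_at p (k2 + length c2) ([Const (d + 2) (-1)] @ JumpNeg (d + 2) (k1 + length c1) # c1)"
      using at_exit by (simp add: k2_def add.assoc)
    have "reach orc p (k2 + length c2, s2) (Suc (k2 + length c2), s2(d + 2 := -1))"
      using reach_straight[OF code_at_appendD(1)[OF ex], of orc s2] by simp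
    moreover have "reach orc p (Suc (k2 + length c2), s2(d + 2 := -1)) (k1 + length c1, s2(d + 2 := -1))"
      using reach_jump[of p "Suc (k2 + length c2)" "d + 2" "k1 + length c1" c1 orc "s2(d + 2 := -1)"]
        code_at_appendD(2)[OF ex] by simp
    ultimately have "reach orc p (k2 + length c2, s2) (k1 + length c1, s2(d + 2 := -1))" by (rule reach_trans)
    hence "reach orc p (k, s) (k1 + length c1, s2(d + 2 := -1))"
      using reach_trans[OF s1(1) reach_trans[OF _ reach_trans[OF s2(1)]]] jump False s1(2) by (auto simp: holds_def)
    moreover have "holds (s2(d + 2 := -1)) d (eval orc env (IfNeg c e1 e2))" "\<forall>r<d. (s2(d + 2 := -1)) r = s r"
      using s2(2,3) s1(3) False by (simp_all add: holds_def)
    ultimately show ?thesis unfolding len by blast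
  qed
next
  case (Fold p' b e)
  define cb where "cb = compile \<rho> d k b"
  define loop where "loop = k + length cb + 4"
  define ce where "ce = compile (\<rho> @ [d + 2]) (d + 6) (loop + 4) e"
  define bc :: "'a instr list" where "bc = bop_code (if p' then Times else Plus) (d + 4) (d + 6) (d + 8)"
  define cu where "cu = bc @ [Const (d + 8) 1, Add (d + 2) (d + 2) (d + 8), Const (d + 8) (-1), JumpNeg (d + 8) loop]"
  define stop where "stop = loop + 4 + length ce + length cu"
  define ini :: "'a instr list" where
    "ini = [Const (d + 2) 0, Const (d + 3) 0, Const (d + 4) (if p' then 1 else 0), Const (d + 5) 0]"
  define test :: "'a instr list" where
    "test = [Sub (d + 6) (d + 2) d, JumpNeg (d + 6) (loop + 4), Const (d + 6) (-1), JumpNeg (d + 6) stop]"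
  define fin :: "'a instr list" where "fin = [Const (d + 6) 0, Add d (d + 4) (d + 6), Add (d + 1) (d + 5) (d + 6)]"
  have code: "compile \<rho> d k (Fold p' b e) = cb @ ini @ test @ ce @ cu @ fin"
    by (simp add: cb_def loop_def ce_def bc_def cu_def stop_def ini_def test_def fin_def Let_def)
  note at = Fold.prems(3)[unfolded code]
  note at1 = code_at_appendD(2)[OF at] note at2 = code_at_appendD(2)[OF at1]
  note at3 = code_at_appendD(2)[OF at2] note at4 = code_at_appendD(2)[OF at3]
  note at5 = code_at_appendD(2)[OF at4]
  have at_ini: "code_at p (k + length cb) ini" using code_at_appendD(1)[OF at1] .
  have len: "length ini = 4" "length test = 4" "length fin = 3" by (simp_all add: ini_def test_def fin_def)
  have at_test: "code_at p loop test" using code_at_appendD(1)[OF at2] unfolding loop_def len .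
  have at_ce: "code_at p (loop + 4) ce" using code_at_appendD(1)[OF at3] unfolding loop_def len .
  have at_cu: "code_at p (loop + 4 + length ce) cu" using code_at_appendD(1)[OF at4] unfolding loop_def len .
  have at_fin: "code_at p stop fin" using at5 unfolding stop_def loop_def len .
  obtain s1 where s1: "reach orc p (k, s) (k + length cb, s1)" "holds s1 d (eval orc env b)" "\<forall>r<d. s1 r = s r"
    using Fold.IH(1)[OF _ Fold.prems(2), of k] Fold.prems(1) code_at_appendD(1)[OF at] by (auto simp: cb_def)
  define N where "N = nat_ceil (eval orc env b)"
  define val where "val j = (if p' then \<Prod>i<j. eval orc (env @ [of_nat i]) e else \<Sum>i<j. eval orc (env @ [of_nat i]) e)" for j
  \<comment> \<open>the state at the head of the loop before round j\<close>
  define Inv where "Inv j st \<longleftrightarrow> st d = Re (eval orc env b) \<and> holds st (d + 2) (of_nat j) \<and> holds st (d + 4) (val j) \<and> (\<forall>r<d. st r = s r)"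
    for j and st :: registers
  have less_N: "real j < Re (eval orc env b) \<longleftrightarrow> j < N" for j
    unfolding N_def nat_ceil_def by (simp add: zless_nat_eq_int_zless less_ceiling_iff)
  have round: "\<exists>st'. reach orc p (loop, st) (loop, st') \<and> Inv (Suc j) st'" if I: "Inv j st" and j: "j < N" for j st
  proof -
    define t1 where "t1 = st(d + 6 := real j - Re (eval orc env b))"
    have "code_at p loop ([Sub (d + 6) (d + 2) d] @ JumpNeg (d + 6) (loop + 4) # drop 2 test)"
      using at_test by (simp add: test_def)
    note a = code_at_appendD[OF this]
    have "reach orc p (loop, st) (Suc loop, t1)"
      using reach_straight[OF a(1), of orc st] I by (simp add: t1_def Inv_def holds_def)
    moreover have "reach orc p (Suc loop, t1) (loop + 4, t1)"
      using reach_jump[of p "Suc loop" "d + 6" "loop + 4" "drop 2 test" orc t1] a(2) j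
      by (simp add: t1_def less_N)
    ultimately have r1: "reach orc p (loop, st) (loop + 4, t1)" by (rule reach_trans)
    have "env_in \<rho> env (d + 2) t1"
      by (rule env_in_mono[OF Fold.prems(2)]) (use I in \<open>auto simp: t1_def Inv_def\<close>)
    hence "env_in (\<rho> @ [d + 2]) (env @ [of_nat j]) (d + 6) t1"
      by (rule env_in_snoc) (use I in \<open>auto simp: t1_def Inv_def holds_def\<close>)
    then obtain t2 where t2: "reach orc p (loop + 4, t1) (loop + 4 + length ce, t2)"
        "holds t2 (d + 6) (eval orc (env @ [of_nat j]) e)" "\<forall>r<d + 6. t2 r = t1 r"
      using Fold.IH(2)[of "env @ [of_nat j]" "\<rho> @ [d + 2]" "d + 6" t1 "loop + 4"] Fold.prems(1) at_ce
      by (auto simp: ce_def)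
    have acc: "holds t2 (d + 4) (val j)" using t2(3) I by (simp add: t1_def Inv_def holds_def)
    have bcc: "holds (fold (update orc) bc t2) (d + 4) (bop_fun (if p' then Times else Plus) (val j) (eval orc (env @ [of_nat j]) e))"
      "\<And>r. r < d + 8 \<Longrightarrow> r \<noteq> d + 4 \<Longrightarrow> r \<noteq> d + 5 \<Longrightarrow> fold (update orc) bc t2 r = t2 r"
      "list_all (\<lambda>i. \<not> is_jump i) bc"
      unfolding bc_def by (rule bop_code_correct[OF acc t2(2)]; simp)+
    define t3 where "t3 = fold (update orc) bc t2"
    have at_cu': "code_at p (loop + 4 + length ce)
        (bc @ [Const (d + 8) 1, Add (d + 2) (d + 2) (d + 8), Const (d + 8) (-1)] @ [JumpNeg (d + 8) loop])"
      using at_cu by (simp add: cu_def)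
    note u1 = code_at_appendD[OF at_cu'] note u2 = code_at_appendD[OF u1(2)]
    have r3: "reach orc p (loop + 4 + length ce, t2) (loop + 4 + length ce + length bc, t3)"
      unfolding t3_def by (rule reach_straight[OF u1(1) bcc(3)])
    define t4 where "t4 = t3(d + 2 := real (Suc j), d + 8 := -1)"
    have t3: "t3 (d + 2) = real j" "t3 (d + 3) = 0"
      using bcc(2)[of "d + 2"] bcc(2)[of "d + 3"] t2(3) I
      by (auto simp: t3_def t1_def Inv_def holds_def eval_nat_numeral)
    have "fold (update orc) [Const (d + 8) 1, Add (d + 2) (d + 2) (d + 8), Const (d + 8) (-1)] t3 = t4"
      using t3 by (simp add: t4_def fun_eq_iff)
    hence r4: "reach orc p (loop + 4 + length ce + length bc, t3) (loop + 4 + length ce + length bc + 3, t4)"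
      using reach_straight[OF u2(1), of orc t3] by simp
    have r5: "reach orc p (loop + 4 + length ce + length bc + 3, t4) (loop, t4)"
      using reach_jump[OF u2(2), of orc t4] by (simp add: t4_def eval_nat_numeral)
    have "val (Suc j) = bop_fun (if p' then Times else Plus) (val j) (eval orc (env @ [of_nat j]) e)"
      by (simp add: val_def)
    hence "holds t3 (d + 4) (val (Suc j))" using bcc(1) by (simp add: t3_def)
    moreover have "t3 r = st r" if "r \<le> d" for r
      using bcc(2)[of r] t2(3) that by (auto simp: t3_def t1_def)
    ultimately have "Inv (Suc j) t4" using I t3 by (auto simp: Inv_def t4_def holds_def eval_nat_numeral)
    thus ?thesis using reach_trans[OF r1 reach_trans[OF t2(1) reach_trans[OF r3 reach_trans[OF r4 r5]]]] by blast
  qed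
  have "\<exists>st. reach orc p (k, s) (loop, st) \<and> Inv j st" if "j \<le> N" for j
    using that
  proof (induction j)
    case 0
    have "list_all (\<lambda>i. \<not> is_jump i) ini" by (simp add: ini_def)
    hence "reach orc p (k + length cb, s1) (loop, fold (update orc) ini s1)"
      using reach_straight[OF at_ini, of orc s1] unfolding len loop_def by blast
    moreover have "Inv 0 (fold (update orc) ini s1)"
      using s1 by (auto simp: Inv_def ini_def val_def holds_def)
    ultimately show ?case using reach_trans[OF s1(1)] by blast
  next
    case (Suc j)
    then obtain st where "reach orc p (k, s) (loop, st)" "Inv j st" by auto
    thus ?case using round[of j st] Suc.prems reach_trans by (metis Suc_le_lessD)
  qed
  then obtain st where st: "reach orc p (k, s) (loop, st)" "Inv N st" by blast
  define t1 where "t1 = st(d + 6 := real N - Re (eval orc env b))"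
  have at_test': "code_at p loop ([Sub (d + 6) (d + 2) d] @ JumpNeg (d + 6) (loop + 4) # ([Const (d + 6) (-1)] @ [JumpNeg (d + 6) stop]))"
    using at_test by (simp add: test_def)
  note a = code_at_appendD[OF at_test']
  have b2: "code_at p (loop + 2) ([Const (d + 6) (-1)] @ [JumpNeg (d + 6) stop])"
    using code_at_ConsD(1)[OF a(2)] by simp
  note c = code_at_appendD[OF b2]
  have r1: "reach orc p (loop, st) (Suc loop, t1)"
    using reach_straight[OF a(1), of orc st] st(2) by (simp add: t1_def Inv_def holds_def)
  have r2: "reach orc p (Suc loop, t1) (loop + 2, t1)"
    using reach_jump[of p "Suc loop" "d + 6" "loop + 4" "[Const (d + 6) (-1)] @ [JumpNeg (d + 6) stop]" orc t1] a(2)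
    by (simp add: t1_def less_N)
  have r3: "reach orc p (loop + 2, t1) (loop + 3, t1(d + 6 := -1))"
    using reach_straight[OF c(1), of orc t1] by (simp add: eval_nat_numeral)
  have r4: "reach orc p (loop + 3, t1(d + 6 := -1)) (stop, t1(d + 6 := -1))"
    using reach_jump[of p "loop + 3" "d + 6" stop "[]" orc "t1(d + 6 := -1)"] c(2) by (simp add: eval_nat_numeral)
  have "list_all (\<lambda>i. \<not> is_jump i) fin" by (simp add: fin_def)
  hence r5: "reach orc p (stop, t1(d + 6 := -1)) (stop + 3, fold (update orc) fin (t1(d + 6 := -1)))"
    using reach_straight[OF at_fin] unfolding len by blast
  have "reach orc p (k, s) (stop + 3, fold (update orc) fin (t1(d + 6 := -1)))"
    by (rule reach_trans[OF st(1) reach_trans[OF r1 reach_trans[OF r2 reach_trans[OF r3 reach_trans[OF r4 r5]]]]])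
  moreover have "holds (fold (update orc) fin (t1(d + 6 := -1))) d (eval orc env (Fold p' b e))"
  proof -
    have "eval orc env (Fold p' b e) = val N" by (simp add: val_def N_def)
    moreover have "st (d + 4) = Re (val N)" "st (d + 5) = Im (val N)"
      using st(2) by (simp_all add: Inv_def holds_def add.commute)
    ultimately show ?thesis by (simp only:) (simp add: fin_def t1_def holds_def)
  qed
  moreover have "\<forall>r<d. fold (update orc) fin (t1(d + 6 := -1)) r = s r"
    using st(2) by (simp add: fin_def t1_def Inv_def)
  moreover have "k + length (compile \<rho> d k (Fold p' b e)) = stop + 3"
    unfolding code by (simp add: stop_def loop_def len)
  ultimately show ?case by metis
next
  case (Query1 l e)
  define c where "c = compile \<rho> d k e"
  note at = Query1.prems(3)[unfolded compile.simps, folded c_def]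
  obtain s1 where s1: "reach orc p (k, s) (k + length c, s1)" "holds s1 d (eval orc env e)" "\<forall>r<d. s1 r = s r"
    using Query1.IH[OF _ Query1.prems(2), of k] Query1.prems(1) code_at_appendD(1)[OF at] by (auto simp: c_def)
  define s2 where "s2 = fold (update orc) [Ask d l [d]] s1"
  have "reach orc p (k, s) (k + length (compile \<rho> d k (Query1 l e)), s2)"
    using reach_trans[OF s1(1) reach_straight[OF code_at_appendD(2)[OF at], of orc]]
    by (simp add: s2_def c_def add.assoc)
  moreover have "holds s2 d (eval orc env (Query1 l e))" "\<forall>r<d. s2 r = s r"
    using s1(2,3) by (simp_all add: s2_def holds_def Let_def)
  ultimately show ?case by metis
next
  case (Query2 l e1 e2)
  define c1 where "c1 = compile \<rho> d k e1"
  define c2 where "c2 = compile \<rho> (d + 2) (k + length c1) e2"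
  have code: "compile \<rho> d k (Query2 l e1 e2) = c1 @ c2 @ [Ask d l [d, d + 2]]"
    by (simp add: c1_def c2_def Let_def)
  note at = Query2.prems(3)[unfolded code]
  obtain s1 where s1: "reach orc p (k, s) (k + length c1, s1)" "holds s1 d (eval orc env e1)" "\<forall>r<d. s1 r = s r"
    using Query2.IH(1)[OF _ Query2.prems(2), of k] Query2.prems(1) code_at_appendD(1)[OF at] by (auto simp: c1_def)
  have "env_in \<rho> env (d + 2) s1" using s1(3) by (intro env_in_mono[OF Query2.prems(2)]) auto
  then obtain s2 where s2: "reach orc p (k + length c1, s1) (k + length c1 + length c2, s2)"
      "holds s2 (d + 2) (eval orc env e2)" "\<forall>r<d + 2. s2 r = s1 r"
    using Query2.IH(2)[of env \<rho> "d + 2" s1 "k + length c1"] Query2.prems(1)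
      code_at_appendD(1)[OF code_at_appendD(2)[OF at]] by (auto simp: c2_def)
  have h: "holds s2 d (eval orc env e1)" using s1(2) s2(3) by (simp add: holds_def)
  define s3 where "s3 = fold (update orc) [Ask d l [d, d + 2]] s2"
  have "reach orc p (k, s) (k + length (compile \<rho> d k (Query2 l e1 e2)), s3)"
    using reach_trans[OF s1(1) reach_trans[OF s2(1) reach_straight[OF code_at_appendD(2)[OF code_at_appendD(2)[OF at]], of orc]]]
    unfolding code by (simp add: s3_def add.assoc)
  moreover have "holds s3 d (eval orc env (Query2 l e1 e2))" "\<forall>r<d. s3 r = s r"
    using h s2(2,3) s1(3) by (simp_all add: s3_def holds_def Let_def)
  ultimately show ?case by metis
qed

lemma consts_of_append [simp]: "consts_of (c @ c') = consts_of c \<union> consts_of c'"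
  by (auto simp: consts_of_def)

lemma consts_of_Cons [simp]:
  "consts_of [] = {}" "consts_of (Const d v # c) = insert v (consts_of c)"
  "consts_of (Add x y z # c) = consts_of c" "consts_of (Sub x y z # c) = consts_of c"
  "consts_of (Mul x y z # c) = consts_of c" "consts_of (Div x y z # c) = consts_of c"
  "consts_of (Ask x l rs # c) = consts_of c" "consts_of (JumpNeg x t # c) = consts_of c"
  by (auto simp: consts_of_def)

lemma consts_of_compile: "consts_of (compile \<rho> d k e) \<subseteq> literals e \<union> \<rat>"
proof (induction e arbitrary: \<rho> d k)
  case (Bin op e1 e2)
  have "consts_of (bop_code op d (d + 2) (d + 4) :: 'a instr list) \<subseteq> \<rat>" by (cases op) auto
  with Bin.IH[of \<rho> d k] Bin.IH(2) show ?case by (fastforce simp: Let_def)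
next
  case (Fold p b e)
  have "consts_of (bop_code (if p then Times else Plus) (d + 4) (d + 6) (d + 8) :: 'a instr list) \<subseteq> \<rat>" by auto
  with Fold.IH(1)[of \<rho> d k] Fold.IH(2) show ?case by (fastforce simp: Let_def)
qed (fastforce simp: Let_def)+

subsection \<open>Machines for functions of one or two indices\<close>

text \<open>Machines see one or two natural numbers; if there is only one, register 1 is 0, and
  the second variable has the value 0. The second input is moved, because a complex variable
  occupies two registers.\<close>

definition input_env :: "nat list \<Rightarrow> complex list" where
  "input_env ns = [of_nat (ns ! 0), if length ns = 1 then 0 else of_nat (ns ! 1)]"

definition program :: "'l expr \<Rightarrow> 'l instr list" where
  "program e = [Const 4 0, Add 2 1 4, Const 1 0] @ compile [0, 2] 4 3 e @ [Const 5 0, Add 0 4 5]"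

lemma computes_program:
  assumes e: "closed_below 2 e" and ns: "length ns = 1 \<or> length ns = 2"
  shows "computes orc (program e) ns (Re (eval orc (input_env ns) e))"
proof -
  define c where "c = compile [0, 2] 4 3 e"
  have at: "code_at (program e) 0 ([Const 4 0, Add 2 1 4, Const 1 0] @ c @ [Const 5 0, Add 0 4 5])"
    unfolding code_at_def program_def c_def by (rule exI[of _ "[]"], rule exI[of _ "[]"]) simp
  note a = code_at_appendD[OF at]
  have "code_at (program e) 3 (c @ [Const 5 0, Add 0 4 5])" using a(2) by (simp add: numeral_3_eq_3)
  note b = code_at_appendD[OF this]
  define s0 where "s0 = (input ns)(4 := 0, 2 := input ns 1, 1 := 0)"
  have "fold (update orc) [Const 4 0, Add 2 1 4, Const 1 0] (input ns) = s0"
    by (simp add: s0_def)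
  hence r0: "reach orc (program e) (0, input ns) (3, s0)"
    using reach_straight[OF a(1), of orc "input ns"] by (simp add: numeral_3_eq_3)
  have "env_in [0, 2] (input_env ns) 4 s0"
    using ns by (auto simp: env_in_def input_env_def holds_def s0_def input_def less_Suc_eq numeral_2_eq_2)
  moreover have "closed_below (length (input_env ns)) e"
    using e by (simp add: input_env_def numeral_2_eq_2)
  moreover have "code_at (program e) 3 (compile [0, 2] 4 3 e)" using b(1) by (simp add: c_def)
  ultimately obtain s1 where s1: "reach orc (program e) (3, s0) (3 + length c, s1)" "holds s1 4 (eval orc (input_env ns) e)"
    using compile_correct[of "input_env ns" e "[0, 2]" 4 s0 "program e" 3 orc] unfolding c_def by blast
  have "reach orc (program e) (3 + length c, s1) (3 + length c + 2, fold (update orc) [Const 5 0, Add 0 4 5] s1)"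
    using reach_straight[of "program e" "3 + length c" "[Const 5 0, Add 0 4 5]" orc s1] b(2) by simp
  from reach_trans[OF r0 reach_trans[OF s1(1) this]]
  obtain t where "(step orc (program e) ^^ t) (0, input ns) = (3 + length c + 2, s1(5 := 0, 0 := s1 4 + 0))"
    by (auto simp: reach_def)
  thus ?thesis using s1(2) unfolding computes_def program_def
    by (intro exI[of _ t] exI[of _ "3 + length c + 2"] exI[of _ "s1(5 := 0, 0 := s1 4 + 0)"]) (auto simp: c_def holds_def)
qed

instance label :: countable
  by countable_datatype

lemma countable_evaluations: "countable (evaluations (P :: ('a, label) problem))"
proof -
  have "evaluations P \<subseteq> (\<lambda>(l, w). the (Lam P l w)) ` UNIV"
  proof
    fix h assume "h \<in> evaluations P"
    then obtain l w where "Lam P l w = Some h" by (auto simp: evaluations_def)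
    thus "h \<in> range (\<lambda>(l, w). the (Lam P l w))" by (intro image_eqI[of _ _ "(l, w)"]) auto
  qed
  thus ?thesis by (rule countable_subset) simp
qed

text \<open>An expression in two variables whose literals are rational or known parameters
  yields algorithms of arithmetic type, and hence, by the finiteness of its queries, general
  algorithms.\<close>

lemma algorithms_eval:
  fixes P :: "('a, label) problem"
  assumes e: "closed_below 2 e" "literals e \<subseteq> \<rat> \<union> K" and k: "k = 1 \<or> k = 2"
    and ne: "evaluations P \<noteq> {}"
    and nonneg: "\<And>A ns. A \<in> Dom P \<Longrightarrow> 0 \<le> Re (eval (oracle_of P A) (input_env ns) e)"
    and \<Gamma>: "\<And>A ns. A \<in> Dom P \<Longrightarrow> length ns = k \<Longrightarrow> \<Gamma> ns A = Re (eval (oracle_of P A) (input_env ns) e)"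
  shows "algorithms (Arithmetic K) P k \<Gamma>"
proof -
  have "general_algorithm P (\<Gamma> ns)" if ns: "length ns = k" for ns
  proof -
    have "general_algorithm P (\<lambda>A. Re (eval (oracle_of P A) (input_env ns) e))"
      by (rule general_algorithm_eval) (use nonneg ne in auto)
    thus ?thesis using \<Gamma>[OF _ ns] unfolding general_algorithm_def by (simp add: Pi_def)
  qed
  moreover have "consts_of (program e) \<subseteq> \<rat> \<union> K"
    using consts_of_compile[of "[0, 2]" 4 3 e] e(2) by (auto simp: program_def)
  moreover have "computes (oracle_of P A) (program e) ns (\<Gamma> ns A)" if "A \<in> Dom P" "length ns = k" for A ns
    using computes_program[OF e(1), of ns "oracle_of P A"] k that by (auto simp: \<Gamma>)
  ultimately show ?thesis
    unfolding algorithms_def using countable_evaluations by auto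
qed


section \<open>The algorithm\<close>

subsection \<open>Test vectors\<close>

text \<open>The digits of k in base 2 N + 1, shifted by N, are the real and imaginary parts of
  the coordinates of a vector of Gaussian integers. All vectors with N coordinates and
  entries of size at most N arise from \<open>k < (2 N + 1) ^ (2 N)\<close>.\<close>

definition digit :: "nat \<Rightarrow> nat \<Rightarrow> nat \<Rightarrow> nat" where
  "digit b k j = k div b ^ j mod b"

definition gauss_coord :: "nat \<Rightarrow> nat \<Rightarrow> nat \<Rightarrow> complex" where
  "gauss_coord N k j = Complex (real (digit (2 * N + 1) k (2 * j)) - real N)
                               (real (digit (2 * N + 1) k (2 * j + 1)) - real N)"

abbreviation test_count :: "nat \<Rightarrow> nat" where "test_count N \<equiv> (2 * N + 1) ^ (2 * N)"

definition gauss_vec :: "nat \<Rightarrow> nat \<Rightarrow> ell2" where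
  "gauss_vec N k = (\<Sum>j<N. gauss_coord N k j *\<^sub>C basis_vec j)"

text \<open>Induction on the number of digits: the last digit is added with weight \<open>b\<^sup>n\<close>, which
  changes no lower one.\<close>

lemma digits_exist:
  assumes "\<And>j. j < n \<Longrightarrow> c j < b" "0 < b"
  shows "\<exists>k<b ^ n. \<forall>j<n. digit b k j = c j"
  using assms(1)
proof (induction n)
  case (Suc n)
  then obtain k where k: "k < b ^ n" "\<And>j. j < n \<Longrightarrow> digit b k j = c j" by (meson less_SucI)
  define k' where "k' = k + c n * b ^ n"
  have "k' < b ^ n + c n * b ^ n" using k by (simp add: k'_def)
  also have "\<dots> \<le> b * b ^ n" using Suc.prems[of n] by (metis lessI less_eq_Suc_le mult_Suc mult_le_mono1)
  finally have "k' < b ^ Suc n" by simp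
  moreover have "digit b k' j = c j" if j: "j < Suc n" for j
  proof (cases "j = n")
    case True
    thus ?thesis using k(1) Suc.prems[of n] assms(2) by (simp add: digit_def k'_def)
  next
    case False
    hence "b ^ n = b ^ j * (b * b ^ (n - j - 1))"
      using j by (metis (no_types, lifting) Suc_diff_Suc diff_diff_left less_SucE plus_1_eq_Suc add.commute
          le_add_diff_inverse less_imp_le power_Suc power_add)
    hence "k' = k + (c n * b ^ (n - j - 1) * b) * b ^ j" by (simp add: k'_def)
    hence "k' div b ^ j = c n * b ^ (n - j - 1) * b + k div b ^ j"
      using assms(2) by (simp only:) (rule div_mult_self1, simp)
    thus ?thesis using k(2)[of j] j False by (simp add: digit_def)
  qed
  ultimately show ?case by blast
qed auto

lemma gauss_vec_surj:
  assumes "\<And>j. \<bar>u j\<bar> \<le> int N" "\<And>j. \<bar>v j\<bar> \<le> int N"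
  shows "\<exists>k<test_count N. gauss_vec N k = (\<Sum>j<N. Complex (of_int (u j)) (of_int (v j)) *\<^sub>C basis_vec j)"
proof -
  define c where "c i = nat (if even i then u (i div 2) + int N else v (i div 2) + int N)" for i
  have "c i < 2 * N + 1" for i
    using assms(1)[of "i div 2"] assms(2)[of "i div 2"] by (auto simp: c_def)
  then obtain k where k: "k < test_count N" "\<And>j. j < 2 * N \<Longrightarrow> digit (2 * N + 1) k j = c j"
    using digits_exist[of "2 * N" c "2 * N + 1"] by auto
  have "gauss_coord N k j = Complex (of_int (u j)) (of_int (v j))" if "j < N" for j
  proof -
    have "real (c (2 * j)) = of_int (u j) + real N" "real (c (2 * j + 1)) = of_int (v j) + real N"
      using assms(1)[of j] assms(2)[of j] by (auto simp: c_def)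
    thus ?thesis using that k(2)[of "2 * j"] k(2)[of "2 * j + 1"] by (simp add: gauss_coord_def)
  qed
  thus ?thesis using k(1) by (auto simp: gauss_vec_def intro!: exI[of _ k] sum.cong)
qed

lemma coord_gauss_vec: "coord (gauss_vec N k) j = (if j < N then gauss_coord N k j else 0)"
  by (simp add: gauss_vec_def coord_sum if_distrib cong: if_cong)

lemma norm_gauss_vec: "(norm (gauss_vec N k))\<^sup>2 = (\<Sum>j<N. (cmod (gauss_coord N k j))\<^sup>2)"
  unfolding norm_ell2_square by (subst suminf_finite[of "{..<N}"]) (auto simp: coord_gauss_vec)

text \<open>Only the Gram matrix and the matrix entries of T enter, not its infinite columns:
  the expansion is \<open>\<parallel>T x - z x\<parallel>\<^sup>2 = \<parallel>T x\<parallel>\<^sup>2 - 2 Re (cnj z \<llangle>T x, x\<rrangle>) + \<bar>z\<bar>\<^sup>2 \<parallel>x\<parallel>\<^sup>2\<close>.\<close>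

lemma norm_square_via_Gram:
  fixes T :: operator and N k :: nat
  assumes T: "T \<in> Omega_B"
  defines "x \<equiv> gauss_vec N k"
  shows "(residual T z x)\<^sup>2 =
    Re (\<Sum>i<N. \<Sum>j<N. gauss_coord N k j * cnj (gauss_coord N k i) *
         (\<llangle>T (basis_vec j), T (basis_vec i)\<rrangle> - 2 * cnj z * \<llangle>T (basis_vec j), basis_vec i\<rrangle>))
    + (cmod z)\<^sup>2 * (norm x)\<^sup>2"
proof -
  let ?c = "gauss_coord N k"
  have Tx: "T x = (\<Sum>j<N. ?c j *\<^sub>C T (basis_vec j))"
    by (simp add: x_def gauss_vec_def blinfun.sum_right Omega_B_scaleC[OF T])
  have 1: "\<llangle>T x, T x\<rrangle> = (\<Sum>i<N. \<Sum>j<N. ?c j * cnj (?c i) * \<llangle>T (basis_vec j), T (basis_vec i)\<rrangle>)"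
    unfolding Tx
    by (simp add: cinner.sum_left cinner.sum_right cinner_scaleC_left cinner_scaleC_right sum_distrib_left mult_ac)
  have 2: "\<llangle>T x, x\<rrangle> = (\<Sum>i<N. \<Sum>j<N. ?c j * cnj (?c i) * \<llangle>T (basis_vec j), basis_vec i\<rrangle>)"
    unfolding Tx unfolding x_def gauss_vec_def
    by (simp add: cinner.sum_left cinner.sum_right cinner_scaleC_left cinner_scaleC_right sum_distrib_left mult_ac)
  have "(residual T z x)\<^sup>2 = (norm (T x))\<^sup>2 - 2 * inner (T x) (z *\<^sub>C x) + (norm (z *\<^sub>C x))\<^sup>2"
    unfolding power2_norm_eq_inner by (simp add: inner_diff_left inner_diff_right inner_commute)
  also have "\<dots> = Re (\<llangle>T x, T x\<rrangle> - 2 * cnj z * \<llangle>T x, x\<rrangle>) + (cmod z)\<^sup>2 * (norm x)\<^sup>2"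
    by (simp add: cinner_self inner_ell2_def cinner_scaleC_right norm_scaleC power_mult_distrib
        mult.assoc del: of_real_power)
  also have "\<llangle>T x, T x\<rrangle> - 2 * cnj z * \<llangle>T x, x\<rrangle> = (\<Sum>i<N. \<Sum>j<N. ?c j * cnj (?c i) *
         (\<llangle>T (basis_vec j), T (basis_vec i)\<rrangle> - 2 * cnj z * \<llangle>T (basis_vec j), basis_vec i\<rrangle>))"
    unfolding 1 2 by (simp add: sum_distrib_left sum_subtractf[symmetric] algebra_simps)
  finally show ?thesis .
qed

subsection \<open>The algorithm as an expression\<close>

text \<open>Throughout, variable 0 is the stage n of the algorithm, variable 1 the parameter of
  an inner limit, variables 2 and 3 are the position in the grid, variable 4 is the number k
  of a test vector, and 5 and 6 are row and column indices. L is the number of variables in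
  scope, hence the next variable to be bound.\<close>

abbreviation "oneE \<equiv> Lit 1 0"
abbreviation "zeroE \<equiv> Lit 0 0"
abbreviation "sizeE \<equiv> Bin Plus (Var 0) oneE"
abbreviation "baseE \<equiv> Bin Plus (Bin Plus sizeE sizeE) oneE"

text \<open>The quotient k div \<open>b\<^sup>j\<close> is the number of \<open>i < k\<close> with \<open>(i + 1) b\<^sup>j \<le> k\<close>.\<close>

definition div_powE :: "nat \<Rightarrow> 'l expr \<Rightarrow> 'l expr" where
  "div_powE L j = Fold False (Var 4)
     (IfNeg (Bin Minus (Var 4) (Bin Times (Bin Plus (Var L) oneE) (Fold True j baseE))) zeroE oneE)"

definition digitE :: "nat \<Rightarrow> 'l expr \<Rightarrow> 'l expr" where
  "digitE L j = Bin Minus (div_powE L j) (Bin Times baseE (div_powE L (Bin Plus j oneE)))"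

definition coordE :: "nat \<Rightarrow> nat \<Rightarrow> 'l expr" where
  "coordE L c = Bin Plus (Bin Minus (digitE L (Bin Plus (Var c) (Var c))) sizeE)
     (Bin Times (Lit 0 1) (Bin Minus (digitE L (Bin Plus (Bin Plus (Var c) (Var c)) oneE)) sizeE))"

lemma nat_ceil_of_nat [simp]: "nat_ceil (of_nat n) = n"
  by (simp add: nat_ceil_def)

lemma sum_indicator_div:
  assumes "0 < b"
  shows "(\<Sum>i<a. if (i + 1) * b \<le> a then 1 else 0) = (of_nat (a div b) :: complex)"
proof -
  have "{i \<in> {..<a}. (i + 1) * b \<le> a} = {..<a div b}"
  proof (intro equalityI subsetI)
    fix i assume i: "i \<in> {..<a div b}"
    hence "i + 1 \<le> a div b" by simp
    hence le: "(i + 1) * b \<le> a" using assms by (simp add: less_eq_div_iff_mult_less_eq)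
    moreover have "i + 1 \<le> (i + 1) * b" using assms mult_le_mono2[of 1 b "i + 1"] by simp
    ultimately show "i \<in> {i \<in> {..<a}. (i + 1) * b \<le> a}" by simp
  qed (use assms in \<open>auto simp: less_eq_div_iff_mult_less_eq Suc_le_eq[symmetric]\<close>)
  moreover have "(\<Sum>i<a. if (i + 1) * b \<le> a then 1 else 0) = (of_nat (card {i \<in> {..<a}. (i + 1) * b \<le> a}) :: complex)"
    by (subst sum.inter_filter[symmetric]) auto
  ultimately show ?thesis by simp
qed

context
  fixes orc :: "'l answers" and env :: "complex list" and L n k :: nat
  assumes L: "length env = L" "4 < L" and env: "env ! 0 = of_nat n" "env ! 4 = of_nat k"
begin

lemma eval_baseE: "eval orc (env @ xs) baseE = of_nat (2 * (n + 1) + 1)"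
  using L by (simp add: nth_append env complex_eq_iff)

lemma eval_div_powE:
  assumes j: "\<And>x. eval orc (env @ [x]) j = of_nat j'"
  shows "eval orc env (div_powE L j) = of_nat (k div (2 * (n + 1) + 1) ^ j')"
proof -
  have len: "4 < length env" "0 < length env" using L by auto
  have b: "(env @ [x]) ! 4 = of_nat k" "(env @ [x]) ! L = x" for x
    using L env by (auto simp: nth_append)
  have p: "eval orc (env @ [x]) (Fold True j baseE) = of_nat ((2 * (n + 1) + 1) ^ j')" for x
    using eval_baseE[of "[x, _]"] by (simp only: eval.simps j if_True nat_ceil_of_nat) simp
  have "eval orc env (div_powE L j) = (\<Sum>i<k. if (i + 1) * (2 * (n + 1) + 1) ^ j' \<le> k then 1 else 0)"
    unfolding div_powE_def eval.simps(6) if_False eval.simps(2) env(2) nat_ceil_of_nat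
  proof (rule sum.cong[OF refl])
    fix i
    have "Re (of_nat k - (of_nat i + 1) * of_nat ((2 * (n + 1) + 1) ^ j')) = real k - real ((i + 1) * (2 * (n + 1) + 1) ^ j')"
      by (simp del: of_nat_power add: algebra_simps)
    hence iff: "Re (of_nat k - (of_nat i + 1) * of_nat ((2 * (n + 1) + 1) ^ j')) < 0
        \<longleftrightarrow> \<not> (i + 1) * (2 * (n + 1) + 1) ^ j' \<le> k"
      by (simp only: diff_less_0_iff_less of_nat_less_iff not_le)
    have lit: "Complex 1 0 = 1" "Complex 0 0 = 0" by (simp_all add: complex_eq_iff)
    show "eval orc (env @ [of_nat i]) (IfNeg (Bin Minus (Var 4) (Bin Times (Bin Plus (Var L) oneE) (Fold True j baseE))) zeroE oneE)
        = (if (i + 1) * (2 * (n + 1) + 1) ^ j' \<le> k then 1 else 0)"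
      unfolding eval.simps(5) eval.simps(3) bop_fun.simps p eval.simps(1,2) b lit iff by simp
  qed
  thus ?thesis by (simp only: sum_indicator_div zero_less_power)
qed

lemma eval_digitE:
  assumes "\<And>x. eval orc (env @ [x]) j = of_nat j'"
  shows "eval orc env (digitE L j) = of_nat (digit (2 * (n + 1) + 1) k j')"
proof -
  define b where "b = 2 * (n + 1) + 1"
  have "eval orc (env @ [x]) (Bin Plus j oneE) = of_nat (Suc j')" for x
    by (simp add: assms complex_eq_iff)
  hence "eval orc env (digitE L j) = of_nat (k div b ^ j') - of_nat b * of_nat (k div b ^ Suc j')"
    using eval_baseE[of "[]"] by (simp only: digitE_def eval.simps bop_fun.simps eval_div_powE[OF assms] b_def
        eval_div_powE append_Nil2)
  also have "\<dots> = of_nat (k div b ^ j') - of_nat (b * (k div b ^ j' div b))"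
    by (simp add: div_mult2_eq[symmetric] mult.commute)
  also have "\<dots> = of_nat (digit b k j')"
    unfolding digit_def by (simp only: minus_mult_div_eq_mod[symmetric] of_nat_diff times_div_less_eq_dividend)
  finally show ?thesis by (simp only: b_def)
qed

lemma eval_coordE:
  assumes c: "c < L" "env ! c = of_nat j"
  shows "eval orc env (coordE L c) = gauss_coord (n + 1) k j"
proof -
  have v: "eval orc (env @ [x]) (Var c) = of_nat j" for x using c L by (simp add: nth_append)
  have 1: "eval orc env (digitE L (Bin Plus (Var c) (Var c))) = of_nat (digit (2 * (n + 1) + 1) k (2 * j))"
    by (rule eval_digitE) (simp only: eval.simps(3) v bop_fun.simps, simp)
  have 2: "eval orc env (digitE L (Bin Plus (Bin Plus (Var c) (Var c)) oneE)) = of_nat (digit (2 * (n + 1) + 1) k (2 * j + 1))"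
    by (rule eval_digitE) (simp only: eval.simps(1,3) v bop_fun.simps, simp add: complex_eq_iff)
  show ?thesis unfolding coordE_def eval.simps(3) bop_fun.simps 1 2 eval.simps(1,2) env gauss_coord_def
    by (simp add: complex_eq_iff)
qed

end

text \<open>The value \<open>\<parallel>T x - z x\<parallel>\<^sup>2 - \<rho> \<parallel>x\<parallel>\<^sup>2\<close> for the k-th test vector x, where a and G are
  expressions for the entry and the Gram matrix of T with row index in variable 5 and column
  index in variable 6.\<close>

definition quadE :: "'l expr \<Rightarrow> 'l expr \<Rightarrow> 'l expr \<Rightarrow> 'l expr \<Rightarrow> 'l expr" where
  "quadE a G z \<rho> = Bin Plus
     (Fold False sizeE (Fold False sizeE (Bin Times (Bin Times (coordE 7 6) (Conj (coordE 7 5)))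
        (Bin Minus G (Bin Times (Bin Times (Lit 2 0) (Conj z)) a)))))
     (Bin Times (Bin Minus (Bin Times z (Conj z)) \<rho>)
        (Fold False sizeE (Bin Times (coordE 6 5) (Conj (coordE 6 5)))))"

lemma eval_quadE:
  fixes T :: operator
  assumes T: "T \<in> Omega_B"
    and env: "env = [of_nat n, of_nat m, of_nat p, of_nat q, of_nat k]"
    and a: "\<And>i j. i \<le> n \<Longrightarrow> j \<le> n \<Longrightarrow> eval orc (env @ [of_nat i, of_nat j]) a = \<llangle>T (basis_vec j), basis_vec i\<rrangle>"
    and G: "\<And>i j. i \<le> n \<Longrightarrow> j \<le> n \<Longrightarrow> eval orc (env @ [of_nat i, of_nat j]) G = \<llangle>T (basis_vec j), T (basis_vec i)\<rrangle>"
    and z: "\<And>xs. eval orc (env @ xs) ze = z"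
    and \<rho>: "eval orc env \<rho>e = complex_of_real \<rho>"
  shows "Re (eval orc env (quadE a G ze \<rho>e)) =
    (norm (T (gauss_vec (n + 1) k) - z *\<^sub>C gauss_vec (n + 1) k))\<^sup>2 - \<rho> * (norm (gauss_vec (n + 1) k))\<^sup>2"
proof -
  let ?c = "gauss_coord (n + 1) k"
  have size: "eval orc (env @ xs) sizeE = of_nat (n + 1)" for xs
    by (simp add: env complex_eq_iff)
  have c7: "eval orc (env @ [of_nat i, of_nat j]) (coordE 7 5) = ?c i"
    "eval orc (env @ [of_nat i, of_nat j]) (coordE 7 6) = ?c j" for i j
    by (rule eval_coordE; simp add: env)+
  have c6: "eval orc (env @ [of_nat i]) (coordE 6 5) = ?c i" for i
    by (rule eval_coordE; simp add: env)
  have lit2: "eval orc e2 (Lit 2 0) = 2" for e2 by (simp add: complex_eq_iff)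
  have 1: "eval orc env (Fold False sizeE (Fold False sizeE (Bin Times (Bin Times (coordE 7 6) (Conj (coordE 7 5)))
        (Bin Minus G (Bin Times (Bin Times (Lit 2 0) (Conj ze)) a))))) =
     (\<Sum>i<n+1. \<Sum>j<n+1. ?c j * cnj (?c i) *
         (\<llangle>T (basis_vec j), T (basis_vec i)\<rrangle> - 2 * cnj z * \<llangle>T (basis_vec j), basis_vec i\<rrangle>))"
    using size[of "[]"] size[of "[_]"]
    by (simp only: eval.simps(6) if_False nat_ceil_of_nat append_Nil2)
      (intro sum.cong refl, simp add: c7 a G z lit2 del: eval.simps(1))
  have 2: "eval orc env (Fold False sizeE (Bin Times (coordE 6 5) (Conj (coordE 6 5)))) = complex_of_real ((norm (gauss_vec (n + 1) k))\<^sup>2)"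
    using size[of "[]"] unfolding norm_gauss_vec of_real_sum
    by (simp only: eval.simps(6) if_False nat_ceil_of_nat append_Nil2)
      (intro sum.cong refl, simp add: c6 complex_norm_square del: of_real_power)
  have 3: "eval orc env (Bin Minus (Bin Times ze (Conj ze)) \<rho>e) = complex_of_real ((cmod z)\<^sup>2 - \<rho>)"
    using z[of "[]"] by (simp add: \<rho> complex_norm_square[symmetric])
  have "eval orc env (quadE a G ze \<rho>e) = (\<Sum>i<n+1. \<Sum>j<n+1. ?c j * cnj (?c i) *
         (\<llangle>T (basis_vec j), T (basis_vec i)\<rrangle> - 2 * cnj z * \<llangle>T (basis_vec j), basis_vec i\<rrangle>))
      + complex_of_real ((cmod z)\<^sup>2 - \<rho>) * complex_of_real ((norm (gauss_vec (n + 1) k))\<^sup>2)"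
    unfolding quadE_def eval.simps(3)[of _ _ Plus] eval.simps(3)[of _ _ Times "Bin Minus _ _"] bop_fun.simps 1 2 3 ..
  hence "Re (eval orc env (quadE a G ze \<rho>e)) = Re (\<Sum>i<n+1. \<Sum>j<n+1. ?c j * cnj (?c i) *
         (\<llangle>T (basis_vec j), T (basis_vec i)\<rrangle> - 2 * cnj z * \<llangle>T (basis_vec j), basis_vec i\<rrangle>))
      + ((cmod z)\<^sup>2 - \<rho>) * (norm (gauss_vec (n + 1) k))\<^sup>2"
    by (simp only: plus_complex.sel of_real_mult[symmetric] Re_complex_of_real)
  thus ?thesis unfolding norm_square_via_Gram[OF T] by (simp add: algebra_simps)
qed

subsection \<open>Counting accepted grid points\<close>

text \<open>The operator \<open>T'\<close> plays the part of the adjoint: it is \<open>P\<^sub>M A\<^sup>*\<close>, and not the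
  adjoint of T, when T is the truncation \<open>P\<^sub>M A\<close> of A.\<close>

definition accepts :: "nat \<Rightarrow> operator \<Rightarrow> operator \<Rightarrow> real \<Rightarrow> complex \<Rightarrow> bool" where
  "accepts N T T' \<rho> z \<longleftrightarrow> (\<exists>k<test_count N.
     (norm (T (gauss_vec N k) - z *\<^sub>C gauss_vec N k))\<^sup>2 < \<rho> * (norm (gauss_vec N k))\<^sup>2 \<or>
     (norm (T' (gauss_vec N k) - cnj z *\<^sub>C gauss_vec N k))\<^sup>2 < \<rho> * (norm (gauss_vec N k))\<^sup>2)"

text \<open>For mesh width \<open>1 / N\<close>, the \<open>2 N\<^sup>2\<close> points start at \<open>-N\<close>, so the grid grows to the
  whole line or plane while it becomes finer.\<close>

definition grid :: "nat \<Rightarrow> nat \<Rightarrow> real" where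
  "grid N p = (real p - (real N)\<^sup>2) / real N"

definition grid_point :: "bool \<Rightarrow> nat \<Rightarrow> nat \<times> nat \<Rightarrow> complex" where
  "grid_point planar N = (\<lambda>(p, q). if planar then Complex (grid N p) (grid N q) else complex_of_real (grid N p))"

text \<open>In the linear case the second index is the dummy 0, which lets both cases share one
  program.\<close>

definition grid_indices :: "bool \<Rightarrow> nat \<Rightarrow> (nat \<times> nat) set" where
  "grid_indices planar N = {..<2 * N\<^sup>2} \<times> {..<if planar then 2 * N\<^sup>2 else 1}"

definition grid_volume :: "bool \<Rightarrow> nat \<Rightarrow> (complex \<Rightarrow> bool) \<Rightarrow> real" where
  "grid_volume planar N Q = real (card {c \<in> grid_indices planar N. Q (grid_point planar N c)})
     * (if planar then (1 / real N)\<^sup>2 else 1 / real N)"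

text \<open>The sum over k is positive if and only if some test vector leads to acceptance.\<close>

definition acceptE :: "'l expr \<Rightarrow> 'l expr \<Rightarrow> 'l expr \<Rightarrow> 'l expr \<Rightarrow> 'l expr \<Rightarrow> 'l expr \<Rightarrow> 'l expr" where
  "acceptE a G a' G' z \<rho> = IfNeg (Bin Minus zeroE (Fold False (Fold True (Bin Plus sizeE sizeE) baseE)
     (Bin Plus (IfNeg (quadE a G z \<rho>) oneE zeroE) (IfNeg (quadE a' G' (Conj z) \<rho>) oneE zeroE))))
     oneE zeroE"

definition gridE :: "nat \<Rightarrow> 'l expr" where
  "gridE c = Bin Quot (Bin Minus (Var c) (Bin Times sizeE sizeE)) sizeE"

definition pointE :: "bool \<Rightarrow> 'l expr" where
  "pointE planar = (if planar then Bin Plus (gridE 2) (Bin Times (Lit 0 1) (gridE 3)) else gridE 2)"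

definition volumeE :: "bool \<Rightarrow> 'l expr \<Rightarrow> 'l expr \<Rightarrow> 'l expr \<Rightarrow> 'l expr \<Rightarrow> 'l expr \<Rightarrow> 'l expr" where
  "volumeE planar a G a' G' \<rho> = Bin Quot
     (Fold False (Bin Plus (Bin Times sizeE sizeE) (Bin Times sizeE sizeE))
       (Fold False (if planar then Bin Plus (Bin Times sizeE sizeE) (Bin Times sizeE sizeE) else oneE)
         (acceptE a G a' G' (pointE planar) \<rho>)))
     (if planar then Bin Times sizeE sizeE else sizeE)"

lemma Complex_literals [simp]: "Complex 0 0 = 0" "Complex 1 0 = 1" "Complex 0 1 = \<i>"
  by (simp_all add: complex_eq_iff)

lemma literals_volumeE:
  "literals (volumeE planar a G a' G' \<rho>) \<subseteq> \<rat> \<union> literals a \<union> literals G \<union> literals a' \<union> literals G' \<union> literals \<rho>"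
  by (auto simp: volumeE_def acceptE_def quadE_def coordE_def digitE_def div_powE_def pointE_def gridE_def)

lemma closed_below_volumeE:
  assumes "closed_below 7 a" "closed_below 7 G" "closed_below 7 a'" "closed_below 7 G'" "closed_below 5 \<rho>"
  shows "closed_below 2 (volumeE planar a G a' G' \<rho>)"
  using assms
  by (auto simp: volumeE_def acceptE_def quadE_def coordE_def digitE_def div_powE_def pointE_def gridE_def
      eval_nat_numeral)

context
  fixes orc :: "'l answers" and n m :: nat and a G a' G' \<rho>e :: "'l expr" and \<rho> :: real and T T' :: operator
  assumes T: "T \<in> Omega_B" and T': "T' \<in> Omega_B"
    and a: "\<And>p q k i j. i \<le> n \<Longrightarrow> j \<le> n \<Longrightarrow>
      eval orc [of_nat n, of_nat m, of_nat p, of_nat q, of_nat k, of_nat i, of_nat j] a = \<llangle>T (basis_vec j), basis_vec i\<rrangle>"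
    and G: "\<And>p q k i j. i \<le> n \<Longrightarrow> j \<le> n \<Longrightarrow>
      eval orc [of_nat n, of_nat m, of_nat p, of_nat q, of_nat k, of_nat i, of_nat j] G = \<llangle>T (basis_vec j), T (basis_vec i)\<rrangle>"
    and a': "\<And>p q k i j. i \<le> n \<Longrightarrow> j \<le> n \<Longrightarrow>
      eval orc [of_nat n, of_nat m, of_nat p, of_nat q, of_nat k, of_nat i, of_nat j] a' = \<llangle>T' (basis_vec j), basis_vec i\<rrangle>"
    and G': "\<And>p q k i j. i \<le> n \<Longrightarrow> j \<le> n \<Longrightarrow>
      eval orc [of_nat n, of_nat m, of_nat p, of_nat q, of_nat k, of_nat i, of_nat j] G' = \<llangle>T' (basis_vec j), T' (basis_vec i)\<rrangle>"
    and \<rho>e: "\<And>xs. eval orc ([of_nat n, of_nat m] @ xs) \<rho>e = complex_of_real \<rho>"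
begin

lemma eval_gridE:
  "eval orc ([of_nat n, of_nat m, of_nat p] @ xs) (gridE 2) = complex_of_real (grid (n + 1) p)"
  "eval orc ([of_nat n, of_nat m, of_nat p, of_nat q] @ xs) (gridE 3) = complex_of_real (grid (n + 1) q)"
  by (simp_all add: gridE_def grid_def power2_eq_square add.commute)

lemma eval_pointE:
  "eval orc ([of_nat n, of_nat m, of_nat p, of_nat q] @ xs) (pointE planar) = grid_point planar (n + 1) (p, q)"
  using eval_gridE(1)[of p "of_nat q # xs"] eval_gridE(2)[of p q xs]
  by (simp add: pointE_def grid_point_def complex_eq_iff)

lemma eval_acceptE:
  "eval orc [of_nat n, of_nat m, of_nat p, of_nat q] (acceptE a G a' G' (pointE planar) \<rho>e)
    = (if accepts (n + 1) T T' \<rho> (grid_point planar (n + 1) (p, q)) then 1 else 0)"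
proof -
  let ?env = "[of_nat n, of_nat m, of_nat p, of_nat q] :: complex list"
  define z where "z = grid_point planar (n + 1) (p, q)"
  define K where "K = test_count (n + 1)"
  define hit where "hit k \<longleftrightarrow> (norm (T (gauss_vec (n + 1) k) - z *\<^sub>C gauss_vec (n + 1) k))\<^sup>2 < \<rho> * (norm (gauss_vec (n + 1) k))\<^sup>2" for k
  define hit' where "hit' k \<longleftrightarrow> (norm (T' (gauss_vec (n + 1) k) - cnj z *\<^sub>C gauss_vec (n + 1) k))\<^sup>2 < \<rho> * (norm (gauss_vec (n + 1) k))\<^sup>2" for k
  have lit: "eval orc e oneE = 1" "eval orc e zeroE = 0" for e by (simp_all add: complex_eq_iff)
  have base: "eval orc (?env @ xs) baseE = of_nat (2 * (n + 1) + 1)" for xs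
    by (simp add: complex_eq_iff)
  have expo: "eval orc ?env (Bin Plus sizeE sizeE) = of_nat (2 * (n + 1))"
    by (simp add: complex_eq_iff)
  have K: "eval orc ?env (Fold True (Bin Plus sizeE sizeE) baseE) = of_nat K"
    by (simp only: eval.simps(6) if_True expo nat_ceil_of_nat base prod_constant card_lessThan of_nat_power K_def)
  have q: "Re (eval orc (?env @ [of_nat k]) (quadE a G (pointE planar) \<rho>e)) < 0 \<longleftrightarrow> hit k" for k
    by (subst eval_quadE[OF T, where n = n and m = m and p = p and q = q and k = k and z = z and \<rho> = \<rho>])
      (use a G \<rho>e[of "[_, _, _]"] eval_pointE[of p q "of_nat k # _"] in \<open>simp_all add: hit_def z_def\<close>)
  have q': "Re (eval orc (?env @ [of_nat k]) (quadE a' G' (Conj (pointE planar)) \<rho>e)) < 0 \<longleftrightarrow> hit' k" for k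
    by (subst eval_quadE[OF T', where n = n and m = m and p = p and q = q and k = k and z = "cnj z" and \<rho> = \<rho>])
      (use a' G' \<rho>e[of "[_, _, _]"] eval_pointE[of p q "of_nat k # _"] in \<open>simp_all add: hit'_def z_def\<close>)
  define s :: nat where "s = (\<Sum>k<K. (if hit k then 1 else 0) + (if hit' k then 1 else 0))"
  have sum: "eval orc ?env (Fold False (Fold True (Bin Plus sizeE sizeE) baseE)
     (Bin Plus (IfNeg (quadE a G (pointE planar) \<rho>e) oneE zeroE) (IfNeg (quadE a' G' (Conj (pointE planar)) \<rho>e) oneE zeroE)))
     = of_nat s"
    unfolding s_def eval.simps(6)[of _ _ False] if_False K nat_ceil_of_nat of_nat_sum
    by (intro sum.cong refl) (simp only: eval.simps(3,5) q q' lit bop_fun.simps of_nat_add if_distrib[of of_nat] of_nat_0 of_nat_1)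
  have "s > 0 \<longleftrightarrow> (\<exists>k<K. hit k \<or> hit' k)"
    unfolding s_def neq0_conv[symmetric] by (auto simp: sum_eq_0_iff)
  also have "\<dots> \<longleftrightarrow> accepts (n + 1) T T' \<rho> z"
    by (simp add: accepts_def hit_def hit'_def K_def)
  finally show ?thesis
    unfolding acceptE_def eval.simps(5)[of _ _ "Bin Minus _ _"] eval.simps(3) sum bop_fun.simps lit z_def
    by simp
qed

lemma eval_volumeE:
  "eval orc [of_nat n, of_nat m] (volumeE planar a G a' G' \<rho>e)
     = complex_of_real (grid_volume planar (n + 1) (accepts (n + 1) T T' \<rho>))"
proof -
  define M where "M = 2 * (n + 1)\<^sup>2"
  define M' where "M' = (if planar then M else 1)"
  define acc where "acc c \<longleftrightarrow> accepts (n + 1) T T' \<rho> (grid_point planar (n + 1) c)" for c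
  have M: "eval orc (of_nat n # xs) (Bin Plus (Bin Times sizeE sizeE) (Bin Times sizeE sizeE)) = of_nat M" for xs
    by (simp add: M_def power2_eq_square algebra_simps)
  have M': "eval orc (of_nat n # xs) (if planar then Bin Plus (Bin Times sizeE sizeE) (Bin Times sizeE sizeE) else oneE) = of_nat M'" for xs
    using M[of xs] by (simp add: M'_def complex_eq_iff)
  have "eval orc [of_nat n, of_nat m] (Fold False (Bin Plus (Bin Times sizeE sizeE) (Bin Times sizeE sizeE))
       (Fold False (if planar then Bin Plus (Bin Times sizeE sizeE) (Bin Times sizeE sizeE) else oneE)
         (acceptE a G a' G' (pointE planar) \<rho>e))) = (\<Sum>p<M. \<Sum>q<M'. if acc (p, q) then 1 else 0)"
    unfolding eval.simps(6) if_False M M' nat_ceil_of_nat append_Cons append_Nil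
    by (simp only: eval_acceptE acc_def)
  also have "\<dots> = (\<Sum>c\<in>{..<M} \<times> {..<M'}. if acc c then 1 else 0)"
    by (simp add: sum.cartesian_product)
  also have "\<dots> = of_nat (card {c \<in> {..<M} \<times> {..<M'}. acc c})"
    by (subst sum.inter_filter[symmetric]) auto
  also have "{..<M} \<times> {..<M'} = grid_indices planar (n + 1)"
    by (simp add: grid_indices_def M_def M'_def)
  finally have 1: "eval orc [of_nat n, of_nat m] (Fold False (Bin Plus (Bin Times sizeE sizeE) (Bin Times sizeE sizeE))
       (Fold False (if planar then Bin Plus (Bin Times sizeE sizeE) (Bin Times sizeE sizeE) else oneE)
         (acceptE a G a' G' (pointE planar) \<rho>e))) = of_nat (card {c \<in> grid_indices planar (n + 1). acc c})" .
  have 2: "Re (eval orc [of_nat n, of_nat m] (if planar then Bin Times sizeE sizeE else sizeE))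
      = (if planar then (real (n + 1))\<^sup>2 else real (n + 1))"
    by (simp add: power2_eq_square add.commute)
  have "1 + complex_of_nat n \<noteq> 0" by (metis of_nat_Suc of_nat_neq_0)
  thus ?thesis
    unfolding volumeE_def eval.simps(3)[of _ _ Quot] bop_fun.simps 1 2 grid_volume_def acc_def
    by (simp add: power_one_over field_simps)
qed

end


section \<open>Convergence of the grid volumes\<close>

text \<open>The sets \<open>\<Inter>\<^sub>m\<^sub>\<ge>\<^sub>n U m\<close> increase to S, and the measure of \<open>U n\<close> lies between those of
  this intersection and of S.\<close>

lemma measure_lower_approximation:
  assumes S: "S \<in> fmeasurable M" and U: "\<And>n. U n \<in> sets M" "\<And>n. U n \<subseteq> S"
    and ev: "\<And>z. z \<in> S \<Longrightarrow> \<forall>\<^sub>F n in sequentially. z \<in> U n"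
  shows "measure M (U n) \<le> measure M S" and "(\<lambda>n. measure M (U n)) \<longlonglongrightarrow> measure M S"
proof -
  have le: "measure M (U n) \<le> measure M S" for n
    by (rule measure_mono_fmeasurable[OF U(2) U(1) S])
  show "measure M (U n) \<le> measure M S" by (rule le)
  define V where "V n = (\<Inter>m\<in>{n..}. U m)" for n
  have V: "V n \<in> sets M" for n unfolding V_def using U by (intro sets.countable_INT') auto
  have inc: "incseq V" unfolding V_def by (auto simp: incseq_def)
  have UV: "(\<Union>n. V n) = S"
    using U(2) ev by (fastforce simp: V_def eventually_sequentially)
  have "range V \<subseteq> sets M" using V by auto
  moreover have "emeasure M (\<Union>n. V n) \<noteq> \<infinity>" unfolding UV using S by (auto simp: fmeasurable_def)
  ultimately have "(\<lambda>n. measure M (V n)) \<longlonglongrightarrow> measure M S"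
    using Lim_measure_incseq[OF _ inc] unfolding UV by blast
  moreover have "measure M (V n) \<le> measure M (U n)" for n
  proof (rule measure_mono_fmeasurable)
    show "U n \<in> fmeasurable M" using U S by (meson fmeasurableI2)
    show "V n \<subseteq> U n" by (auto simp: V_def)
  qed (rule V)
  ultimately show "(\<lambda>n. measure M (U n)) \<longlonglongrightarrow> measure M S"
    using le by (intro tendsto_sandwich[of "\<lambda>n. measure M (V n)" "\<lambda>n. measure M (U n)" sequentially "\<lambda>_. measure M S"]) auto
qed

lemma cell_count_approximation:
  fixes S :: "'a :: euclidean_space set" and cell :: "nat \<Rightarrow> 'b \<Rightarrow> 'a set" and v :: "nat \<Rightarrow> real"
  assumes S: "S \<in> lmeasurable" and fin: "\<And>n. finite (I n)"
    and cell: "\<And>n c. cell n c \<in> lmeasurable" "\<And>n c. measure lebesgue (cell n c) = v n"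
    and disj: "\<And>n c d. c \<noteq> d \<Longrightarrow> c \<in> I n \<Longrightarrow> d \<in> I n \<Longrightarrow> cell n c \<inter> cell n d = {}"
    and sound: "\<And>n c. c \<in> I n \<Longrightarrow> acc n c \<Longrightarrow> cell n c \<subseteq> S"
    and complete: "\<And>z. z \<in> S \<Longrightarrow> \<forall>\<^sub>F n in sequentially. \<exists>c\<in>I n. acc n c \<and> z \<in> cell n c"
  shows "card {c \<in> I n. acc n c} * v n \<le> measure lebesgue S"
    and "(\<lambda>n. card {c \<in> I n. acc n c} * v n) \<longlonglongrightarrow> measure lebesgue S"
proof -
  define U where "U n = (\<Union>c\<in>{c \<in> I n. acc n c}. cell n c)" for n
  have "measure lebesgue (U n) = (\<Sum>c\<in>{c \<in> I n. acc n c}. measure lebesgue (cell n c))" for n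
    unfolding U_def using fin cell(1) disj
    by (intro measure_UNION') (auto simp: pairwise_def disjnt_def)
  hence m: "card {c \<in> I n. acc n c} * v n = measure lebesgue (U n)" for n by (simp add: cell(2))
  have sets: "U n \<in> sets lebesgue" for n
    unfolding U_def using fin cell(1) by (intro sets.finite_UN) (auto simp: fmeasurable_def)
  have sub: "U n \<subseteq> S" for n unfolding U_def using sound by blast
  have ev: "\<forall>\<^sub>F n in sequentially. z \<in> U n" if "z \<in> S" for z
    using complete[OF that] by eventually_elim (auto simp: U_def)
  show "card {c \<in> I n. acc n c} * v n \<le> measure lebesgue S"
    "(\<lambda>n. card {c \<in> I n. acc n c} * v n) \<longlonglongrightarrow> measure lebesgue S"
    unfolding m using measure_lower_approximation[OF S sets sub ev] by auto
qed

lemma content_complex_box: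
  assumes "0 \<le> d"
  shows "measure lborel (box (Complex x y) (Complex (x + d) (y + d))) = d\<^sup>2"
    and "measure lborel (cbox (Complex x y) (Complex (x + d) (y + d))) = d\<^sup>2"
proof -
  have "(\<Prod>b\<in>Basis. (Complex (x + d) (y + d) - Complex x y) \<bullet> b) = d\<^sup>2"
    by (simp add: Basis_complex_def power2_eq_square)
  moreover have "\<forall>b\<in>Basis. Complex x y \<bullet> b \<le> Complex (x + d) (y + d) \<bullet> b"
    using assms by (simp add: Basis_complex_def)
  ultimately show "measure lborel (box (Complex x y) (Complex (x + d) (y + d))) = d\<^sup>2"
    "measure lborel (cbox (Complex x y) (Complex (x + d) (y + d))) = d\<^sup>2"
    by (simp_all add: measure_lborel_box_eq measure_lborel_cbox_eq)
qed

text \<open>Half-open cells partition the plane; the open and the closed square with the same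
  measure enclose each of them.\<close>

lemma half_open_square:
  fixes x y d :: real
  assumes "0 \<le> d"
  defines "Q \<equiv> {z. x \<le> Re z \<and> Re z < x + d \<and> y \<le> Im z \<and> Im z < y + d}"
  shows "Q \<in> lmeasurable" and "measure lebesgue Q = d\<^sup>2"
proof -
  have sub: "box (Complex x y) (Complex (x + d) (y + d)) \<subseteq> Q" "Q \<subseteq> cbox (Complex x y) (Complex (x + d) (y + d))"
    by (auto simp: Q_def in_box_complex_iff in_cbox_complex_iff)
  have "Q \<in> sets borel" unfolding Q_def by measurable
  moreover have "bounded Q" using sub(2) bounded_subset bounded_cbox by blast
  ultimately show Q: "Q \<in> lmeasurable" by (intro bounded_set_imp_lmeasurable) auto
  have "measure lebesgue (box (Complex x y) (Complex (x + d) (y + d))) \<le> measure lebesgue Q"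
    by (rule measure_mono_fmeasurable[OF sub(1) _ Q]) simp
  moreover have "measure lebesgue Q \<le> measure lebesgue (cbox (Complex x y) (Complex (x + d) (y + d)))"
    by (rule measure_mono_fmeasurable[OF sub(2) fmeasurableD[OF Q]]) simp
  ultimately show "measure lebesgue Q = d\<^sup>2"
    using content_complex_box[OF assms(1)] by simp
qed

lemma grid_cell_unique:
  assumes "0 < N" "grid N p \<le> x" "x < grid N p + 1 / real N" "grid N q \<le> x" "x < grid N q + 1 / real N"
  shows "p = q"
proof -
  have "grid N p < grid N q + 1 / real N" "grid N q < grid N p + 1 / real N" using assms by linarith+
  hence "real p < real q + 1" "real q < real p + 1"
    using assms(1) by (simp_all add: grid_def field_simps)
  thus ?thesis by linarith
qed

lemma grid_cell_exists:
  assumes N: "\<bar>x\<bar> < real N"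
  shows "\<exists>p<2 * N\<^sup>2. grid N p \<le> x \<and> x < grid N p + 1 / real N"
proof -
  define y where "y = (x + real N) * real N"
  define p where "p = nat \<lfloor>y\<rfloor>"
  have pos: "0 < real N" using N by linarith
  have y: "0 \<le> y" "y < 2 * (real N)\<^sup>2"
    using N pos by (auto simp: y_def power2_eq_square abs_less_iff intro!: mult_nonneg_nonneg mult_strict_right_mono
        simp flip: mult.assoc)
  have p: "real p \<le> y" "y < real p + 1" using y(1) by (simp_all add: p_def)
  have "real p < real (2 * N\<^sup>2)" using p(1) y(2) by simp
  hence "p < 2 * N\<^sup>2" by (simp only: of_nat_less_iff)
  moreover have "grid N p \<le> x \<and> x < grid N p + 1 / real N"
    using p pos by (simp add: grid_def y_def field_simps power2_eq_square)
  ultimately show ?thesis by blast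
qed

lemma eventually_less_Suc: "\<forall>\<^sub>F n in sequentially. r < real (n + 1)"
proof -
  obtain m where "r < real m" using reals_Archimedean2 by blast
  thus ?thesis by (auto simp: eventually_sequentially intro!: exI[of _ m])
qed

definition region_volume :: "bool \<Rightarrow> complex set \<Rightarrow> real" where
  "region_volume planar S = (if planar then measure lebesgue S else measure lebesgue {t :: real. complex_of_real t \<in> S})"

text \<open>The diameter of a cell is less than \<open>2 / N\<close>. Soundness thus puts accepted cells into
  S, so that their total area is a lower bound, and completeness makes every point of S
  belong to accepted cells from some stage on.\<close>

lemma grid_volume_approximation:
  fixes S :: "complex set"
  assumes S: "S \<in> lmeasurable" "{t :: real. complex_of_real t \<in> S} \<in> lmeasurable"
    and sound: "\<And>n z w. Q n z \<Longrightarrow> cmod (w - z) < 2 / real (n + 1) \<Longrightarrow> w \<in> S"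
    and complete: "\<And>w. w \<in> S \<Longrightarrow> \<forall>\<^sub>F n in sequentially. \<forall>z. cmod (w - z) < 2 / real (n + 1) \<longrightarrow> Q n z"
  shows "grid_volume planar (n + 1) (Q n) \<le> region_volume planar S"
    and "(\<lambda>n. grid_volume planar (n + 1) (Q n)) \<longlonglongrightarrow> region_volume planar S"
proof -
  have "grid_volume planar (n + 1) (Q n) \<le> region_volume planar S \<and>
    (\<lambda>n. grid_volume planar (n + 1) (Q n)) \<longlonglongrightarrow> region_volume planar S" for n
  proof (cases planar)
    case True
    define cell where "cell n = (\<lambda>(p, q). {z. grid (n + 1) p \<le> Re z \<and> Re z < grid (n + 1) p + 1 / real (n + 1) \<and>
      grid (n + 1) q \<le> Im z \<and> Im z < grid (n + 1) q + 1 / real (n + 1)})" for n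
    have near: "cmod (z - grid_point True (n + 1) c) < 2 / real (n + 1)" if "z \<in> cell n c" for n c z
    proof -
      obtain p q where c: "c = (p, q)" by force
      have "\<bar>Re z - grid (n + 1) p\<bar> < 1 / real (n + 1)" "\<bar>Im z - grid (n + 1) q\<bar> < 1 / real (n + 1)"
        using that by (auto simp: cell_def c)
      thus ?thesis using cmod_le[of "z - grid_point True (n + 1) c"] by (simp add: grid_point_def c)
    qed
    have f1: "finite (grid_indices True (n + 1))" for n by (simp add: grid_indices_def)
    have f2: "cell n c \<in> lmeasurable" and f3: "measure lebesgue (cell n c) = (1 / real (n + 1))\<^sup>2" for n c
      unfolding cell_def using half_open_square[of "1 / real (n + 1)"] by (auto split: prod.split)
    have f4: "cell n c \<inter> cell n d = {}" if "c \<noteq> d" "c \<in> grid_indices True (n + 1)" "d \<in> grid_indices True (n + 1)" for n c d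
      using that grid_cell_unique[of "n + 1"] unfolding cell_def by (fastforce split: prod.splits)
    have f5: "cell n c \<subseteq> S" if "c \<in> grid_indices True (n + 1)" "Q n (grid_point True (n + 1) c)" for n c
      using sound[OF that(2)] near by blast
    have f6: "\<forall>\<^sub>F n in sequentially. \<exists>c\<in>grid_indices True (n + 1). Q n (grid_point True (n + 1) c) \<and> z \<in> cell n c"
      if "z \<in> S" for z
      using complete[OF that] eventually_less_Suc[of "cmod z"]
    proof eventually_elim
      case (elim n)
      have "\<bar>Re z\<bar> < real (n + 1)" "\<bar>Im z\<bar> < real (n + 1)"
        using elim(2) abs_Re_le_cmod[of z] abs_Im_le_cmod[of z] by linarith+
      then obtain p q where pq: "p < 2 * (n + 1)\<^sup>2" "q < 2 * (n + 1)\<^sup>2" "z \<in> cell n (p, q)"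
        using grid_cell_exists[of "Re z" "n + 1"] grid_cell_exists[of "Im z" "n + 1"] by (auto simp: cell_def)
      moreover have "Q n (grid_point True (n + 1) (p, q))" using elim(1) near[OF pq(3)] by blast
      ultimately show ?case by (intro bexI[of _ "(p, q)"]) (auto simp: grid_indices_def)
    qed
    have "card {c \<in> grid_indices True (n + 1). Q n (grid_point True (n + 1) c)} * (1 / real (n + 1))\<^sup>2 \<le> measure lebesgue S"
      "(\<lambda>n. card {c \<in> grid_indices True (n + 1). Q n (grid_point True (n + 1) c)} * (1 / real (n + 1))\<^sup>2) \<longlonglongrightarrow> measure lebesgue S"
      by (rule cell_count_approximation[where cell = cell, OF S(1) f1 f2 f3 f4 f5 f6]; assumption)+
    thus ?thesis using True by (simp add: grid_volume_def region_volume_def)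
  next
    case False
    define cell where "cell n = (\<lambda>(p, q :: nat). {t. grid (n + 1) p \<le> t \<and> t < grid (n + 1) p + 1 / real (n + 1)})" for n
    have near: "cmod (complex_of_real t - grid_point False (n + 1) c) < 2 / real (n + 1)" if "t \<in> cell n c" for n c t
    proof -
      obtain p q where c: "c = (p, q)" by force
      have "\<bar>t - grid (n + 1) p\<bar> < 1 / real (n + 1)"
        using that by (auto simp: cell_def c)
      moreover have "1 / real (n + 1) \<le> 2 / real (n + 1)" by (intro divide_right_mono) auto
      ultimately show ?thesis by (simp add: grid_point_def c flip: of_real_diff)
    qed
    have f1: "finite (grid_indices False (n + 1))" for n by (simp add: grid_indices_def)
    have cell: "cell n c = {grid (n + 1) (fst c)..<grid (n + 1) (fst c) + 1 / real (n + 1)}" for n c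
      by (auto simp: cell_def split: prod.splits)
    have f2: "cell n c \<in> lmeasurable" for n c unfolding cell by (rule bounded_set_imp_lmeasurable) auto
    have f3: "measure lebesgue (cell n c) = 1 / real (n + 1)" for n c unfolding cell by simp
    have f4: "cell n c \<inter> cell n d = {}" if "c \<noteq> d" "c \<in> grid_indices False (n + 1)" "d \<in> grid_indices False (n + 1)" for n c d
      using that grid_cell_unique[of "n + 1"] unfolding cell_def grid_indices_def by (fastforce split: prod.splits)
    have f5: "cell n c \<subseteq> {t. complex_of_real t \<in> S}" if "c \<in> grid_indices False (n + 1)" "Q n (grid_point False (n + 1) c)" for n c
      using sound[OF that(2)] near by blast
    have f6: "\<forall>\<^sub>F n in sequentially. \<exists>c\<in>grid_indices False (n + 1). Q n (grid_point False (n + 1) c) \<and> t \<in> cell n c"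
      if "t \<in> {t. complex_of_real t \<in> S}" for t
      using complete[OF that[simplified]] eventually_less_Suc[of "\<bar>t\<bar>"]
    proof eventually_elim
      case (elim n)
      then obtain p where p: "p < 2 * (n + 1)\<^sup>2" "t \<in> cell n (p, 0)"
        using grid_cell_exists[of t "n + 1"] by (auto simp: cell_def)
      moreover have "Q n (grid_point False (n + 1) (p, 0))" using elim(1) near[OF p(2)] by blast
      ultimately show ?case by (intro bexI[of _ "(p, 0)"]) (auto simp: grid_indices_def)
    qed
    have "card {c \<in> grid_indices False (n + 1). Q n (grid_point False (n + 1) c)} * (1 / real (n + 1)) \<le> measure lebesgue {t :: real. complex_of_real t \<in> S}"
      "(\<lambda>n. card {c \<in> grid_indices False (n + 1). Q n (grid_point False (n + 1) c)} * (1 / real (n + 1))) \<longlonglongrightarrow> measure lebesgue {t :: real. complex_of_real t \<in> S}"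
      by (rule cell_count_approximation[where cell = cell, OF S(2) f1 f2 f3 f4 f5 f6]; assumption)+
    thus ?thesis using False by (simp add: grid_volume_def region_volume_def)
  qed
  thus "grid_volume planar (n + 1) (Q n) \<le> region_volume planar S"
    "(\<lambda>n. grid_volume planar (n + 1) (Q n)) \<longlonglongrightarrow> region_volume planar S" by auto
qed

subsection \<open>Gaussian integer vectors are dense up to scaling\<close>

lemma floor_mult_over_tendsto: "(\<lambda>m. of_int \<lfloor>real (Suc m) * a\<rfloor> / real (Suc m)) \<longlonglongrightarrow> a"
proof (rule LIMSEQ_I)
  fix r :: real assume "0 < r"
  then obtain m0 where m0: "inverse (real (Suc m0)) < r" using reals_Archimedean by blast
  have "norm (of_int \<lfloor>real (Suc m) * a\<rfloor> / real (Suc m) - a) < r" if "m \<ge> m0" for m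
  proof -
    have "of_int \<lfloor>real (Suc m) * a\<rfloor> / real (Suc m) - a = (of_int \<lfloor>real (Suc m) * a\<rfloor> - real (Suc m) * a) / real (Suc m)"
      by (simp add: diff_divide_distrib del: of_nat_Suc)
    moreover have "\<bar>of_int \<lfloor>real (Suc m) * a\<rfloor> - real (Suc m) * a\<bar> \<le> 1" by linarith
    ultimately have "norm (of_int \<lfloor>real (Suc m) * a\<rfloor> / real (Suc m) - a) \<le> 1 / real (Suc m)"
      by (simp add: divide_right_mono del: of_nat_Suc)
    also have "\<dots> \<le> inverse (real (Suc m0))" using that by (simp add: inverse_eq_divide frac_le)
    finally show ?thesis using m0 by simp
  qed
  thus "\<exists>m0. \<forall>m\<ge>m0. norm (of_int \<lfloor>real (Suc m) * a\<rfloor> / real (Suc m) - a) < r" by blast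
qed

text \<open>The condition on x is open and invariant under scaling. Truncate x, approximate the
  coordinates by fractions with denominator m, and multiply by m. The resulting vector y is
  a test vector at all late stages, and it does not change with the stage.\<close>

lemma test_vector_exists:
  fixes A :: operator
  assumes x: "residual A w x < r * norm x"
  obtains y where "residual A w y < r * norm y"
    and "\<forall>\<^sub>F N in sequentially. \<exists>k<test_count N. gauss_vec N k = y"
proof -
  define \<phi> where "\<phi> y = r * norm y - residual A w y" for y
  have cont: "(\<lambda>n. \<phi> (f n)) \<longlonglongrightarrow> \<phi> l" if "f \<longlonglongrightarrow> l" for f :: "nat \<Rightarrow> ell2" and l
    unfolding \<phi>_def by (intro tendsto_intros scaleC.tendsto that)
  have "\<phi> x > 0" using x by (simp add: \<phi>_def)
  from order_tendstoD(1)[OF cont[OF proj_tendsto] this]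
  obtain n where n: "\<phi> (proj n x) > 0" by (auto simp: eventually_sequentially)
  define u v where "u m j = (if j < n then \<lfloor>real (Suc m) * Re (coord x j)\<rfloor> else 0)"
    and "v m j = (if j < n then \<lfloor>real (Suc m) * Im (coord x j)\<rfloor> else 0)" for m j
  define y where "y m = (\<Sum>j<n. Complex (of_int (u m j)) (of_int (v m j)) *\<^sub>C basis_vec j)" for m
  have cdiv: "Complex p q / complex_of_nat c = Complex (p / real c) (q / real c)" for p q c
    by (simp add: complex_eq_iff)
  have "(1 / real (Suc m)) *\<^sub>R y m = (\<Sum>j<n. Complex (of_int \<lfloor>real (Suc m) * Re (coord x j)\<rfloor> / real (Suc m))
      (of_int \<lfloor>real (Suc m) * Im (coord x j)\<rfloor> / real (Suc m)) *\<^sub>C basis_vec j)" for m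
    unfolding y_def scaleR_sum_right
    by (intro sum.cong refl) (simp add: u_def v_def scaleR_scaleC cdiv del: of_nat_Suc)
  moreover have "(\<lambda>m. (\<Sum>j<n. Complex (of_int \<lfloor>real (Suc m) * Re (coord x j)\<rfloor> / real (Suc m))
      (of_int \<lfloor>real (Suc m) * Im (coord x j)\<rfloor> / real (Suc m)) *\<^sub>C basis_vec j)) \<longlonglongrightarrow>
      (\<Sum>j<n. Complex (Re (coord x j)) (Im (coord x j)) *\<^sub>C basis_vec j)"
    by (intro tendsto_sum scaleC.tendsto tendsto_Complex floor_mult_over_tendsto tendsto_const)
  ultimately have "(\<lambda>m. (1 / real (Suc m)) *\<^sub>R y m) \<longlonglongrightarrow> proj n x"
    by (simp only: complex_surj proj_eq_sum)
  from order_tendstoD(1)[OF cont[OF this] n] obtain m where m: "\<phi> ((1 / real (Suc m)) *\<^sub>R y m) > 0"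
    by (auto simp: eventually_sequentially)
  have scale: "\<phi> (t *\<^sub>R z) = \<bar>t\<bar> * \<phi> z" for t z
  proof -
    have "A (t *\<^sub>R z) - w *\<^sub>C (t *\<^sub>R z) = t *\<^sub>R (A z - w *\<^sub>C z)"
      by (simp add: blinfun.scaleR_right scaleC.scaleR_right scaleR_diff_right)
    hence "residual A w (t *\<^sub>R z) = \<bar>t\<bar> * residual A w z" by simp
    thus ?thesis unfolding \<phi>_def by (simp add: right_diff_distrib)
  qed
  have "\<phi> (y m) > 0" using m unfolding scale by (simp add: zero_less_divide_iff)
  define B where "B = Max (insert n ((\<lambda>j. nat \<bar>u m j\<bar>) ` {..<n} \<union> (\<lambda>j. nat \<bar>v m j\<bar>) ` {..<n}))"
  have B: "n \<le> B" "\<And>j. j < n \<Longrightarrow> nat \<bar>u m j\<bar> \<le> B" "\<And>j. j < n \<Longrightarrow> nat \<bar>v m j\<bar> \<le> B"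
    by (auto simp: B_def)
  have "\<exists>k<test_count N. gauss_vec N k = y m" if N: "N \<ge> B" for N
  proof -
    have "\<bar>u m j\<bar> \<le> int N" "\<bar>v m j\<bar> \<le> int N" for j
      using B(2)[of j] B(3)[of j] N by (cases "j < n"; simp add: u_def v_def)+
    from gauss_vec_surj[of "u m" N "v m", OF this] obtain k where
      k: "k < test_count N" "gauss_vec N k = (\<Sum>j<N. Complex (of_int (u m j)) (of_int (v m j)) *\<^sub>C basis_vec j)"
      by blast
    have zero: "Complex (of_int (u m j)) (of_int (v m j)) *\<^sub>C basis_vec j = 0" if "\<not> j < n" for j
      using that by (simp add: u_def v_def scaleC.zero_left)
    have "(\<Sum>j<N. Complex (of_int (u m j)) (of_int (v m j)) *\<^sub>C basis_vec j) = y m"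
      unfolding y_def using B(1) N zero by (intro sum.mono_neutral_right) auto
    thus ?thesis using k by metis
  qed
  hence "\<forall>\<^sub>F N in sequentially. \<exists>k<test_count N. gauss_vec N k = y m"
    unfolding eventually_sequentially by blast
  thus ?thesis using that[of "y m"] \<open>\<phi> (y m) > 0\<close> by (simp add: \<phi>_def)
qed

subsection \<open>Acceptance criteria that capture the pseudospectrum\<close>

abbreviation pseudo_volume :: "bool \<Rightarrow> real \<Rightarrow> operator \<Rightarrow> real" where
  "pseudo_volume planar \<epsilon> A \<equiv> region_volume planar (pseudospectrum \<epsilon> A)"

text \<open>An acceptance criterion is sound if accepted points come with a vector proving that
  they lie in the pseudospectrum with a margin of \<open>2 / N\<close>, the diameter of a cell, and it is
  complete if a test vector that proves this with a slightly larger margin leads to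
  acceptance.\<close>

lemma grid_volume_pseudospectrum:
  assumes A: "A \<in> Omega_B" and e: "\<epsilon> > 0" and c: "c \<longlonglongrightarrow> 0"
    and sound: "\<And>n z. Q n z \<Longrightarrow> \<exists>x. x \<noteq> 0 \<and> (residual A z x \<le> (\<epsilon> - 2 / real (n + 1)) * norm x \<or>
        residual (adj A) (cnj z) x \<le> (\<epsilon> - 2 / real (n + 1)) * norm x)"
    and complete: "\<And>n z k. k < test_count (n + 1) \<Longrightarrow>
        norm (A (gauss_vec (n + 1) k) - z *\<^sub>C gauss_vec (n + 1) k) < (\<epsilon> - 2 / real (n + 1) - c n) * norm (gauss_vec (n + 1) k) \<or>
        norm (adj A (gauss_vec (n + 1) k) - cnj z *\<^sub>C gauss_vec (n + 1) k) < (\<epsilon> - 2 / real (n + 1) - c n) * norm (gauss_vec (n + 1) k)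
        \<Longrightarrow> Q n z"
  shows "grid_volume planar (n + 1) (Q n) \<le> pseudo_volume planar \<epsilon> A"
    and "(\<lambda>n. grid_volume planar (n + 1) (Q n)) \<longlonglongrightarrow> pseudo_volume planar \<epsilon> A"
proof -
  have s: "w \<in> pseudospectrum \<epsilon> A" if Q: "Q n z" and wz: "cmod (w - z) < 2 / real (n + 1)" for n z w
  proof -
    obtain x where x: "x \<noteq> 0" "residual A z x \<le> (\<epsilon> - 2 / real (n + 1)) * norm x \<or>
        residual (adj A) (cnj z) x \<le> (\<epsilon> - 2 / real (n + 1)) * norm x" using sound[OF Q] by blast
    have *: "residual B w' x < \<epsilon> * norm x"
      if "residual B z' x \<le> (\<epsilon> - 2 / real (n + 1)) * norm x" "cmod (z' - w') < 2 / real (n + 1)"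
      for B :: operator and z' w'
    proof -
      have "cmod (z' - w') * norm x < 2 / real (n + 1) * norm x"
        using that(2) x(1) by (intro mult_strict_right_mono) auto
      thus ?thesis using norm_shift_le[of B x w' z'] that(1) unfolding left_diff_distrib by linarith
    qed
    have "cmod (z - w) < 2 / real (n + 1)" "cmod (cnj z - cnj w) < 2 / real (n + 1)"
      using wz by (simp_all only: norm_minus_commute complex_mod_cnj flip: complex_cnj_diff)
    thus ?thesis using x(2) * pseudospectrum_iff[OF A e] by blast
  qed
  have evc: "\<forall>\<^sub>F n in sequentially. \<forall>z. cmod (w - z) < 2 / real (n + 1) \<longrightarrow>
      (\<exists>k<test_count (n + 1). norm (B (gauss_vec (n + 1) k) - z *\<^sub>C gauss_vec (n + 1) k)
        < (\<epsilon> - 2 / real (n + 1) - c n) * norm (gauss_vec (n + 1) k))"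
    if x: "residual B w x < \<epsilon> * norm x" for B :: operator and w x
  proof -
    obtain y where y: "residual B w y < \<epsilon> * norm y"
      "\<forall>\<^sub>F N in sequentially. \<exists>k<test_count N. gauss_vec N k = y"
      using test_vector_exists[OF x] by blast
    have ypos: "norm y > 0" using y(1) e by (cases "y = 0") (auto simp: scaleC.zero_right)
    \<comment> \<open>one term \<open>2 / (n + 1)\<close> is the margin of the test, the other one the distance from w to z\<close>
    have "(\<lambda>n. (\<epsilon> - 2 * (2 / real (n + 1)) - c n) * norm y) \<longlonglongrightarrow> (\<epsilon> - 2 * 0 - 0) * norm y"
      by (intro tendsto_intros c LIMSEQ_ignore_initial_segment[OF lim_const_over_n])
    hence "\<forall>\<^sub>F n in sequentially. residual B w y < (\<epsilon> - 2 * (2 / real (n + 1)) - c n) * norm y"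
      using y(1) by (intro order_tendstoD(1)) auto
    moreover have "\<forall>\<^sub>F n in sequentially. \<exists>k<test_count (n + 1). gauss_vec (n + 1) k = y"
      using y(2) by (subst (asm) eventually_sequentially_seg[of _ 1, symmetric])
    ultimately show ?thesis
    proof eventually_elim
      case (elim n)
      then obtain k where k: "k < test_count (n + 1)" "gauss_vec (n + 1) k = y" by blast
      have "residual B z y < (\<epsilon> - 2 / real (n + 1) - c n) * norm y" if "cmod (w - z) < 2 / real (n + 1)" for z
      proof -
        have "cmod (w - z) * norm y < 2 / real (n + 1) * norm y"
          using that ypos by (intro mult_strict_right_mono) auto
        moreover have "(\<epsilon> - 2 * (2 / real (n + 1)) - c n) * norm y
            = (\<epsilon> - 2 / real (n + 1) - c n) * norm y - 2 / real (n + 1) * norm y" by (simp add: algebra_simps)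
        ultimately show ?thesis using norm_shift_le[of B y z w] elim(1) by linarith
      qed
      thus ?case using k by blast
    qed
  qed
  have c: "\<forall>\<^sub>F n in sequentially. \<forall>z. cmod (w - z) < 2 / real (n + 1) \<longrightarrow> Q n z"
    if w: "w \<in> pseudospectrum \<epsilon> A" for w
  proof -
    obtain x where "residual A w x < \<epsilon> * norm x \<or> residual (adj A) (cnj w) x < \<epsilon> * norm x"
      using w pseudospectrum_iff[OF A e] by blast
    thus ?thesis
    proof
      assume "residual A w x < \<epsilon> * norm x"
      from evc[OF this] show ?thesis by eventually_elim (use complete in blast)
    next
      assume "residual (adj A) (cnj w) x < \<epsilon> * norm x"
      from evc[OF this] show ?thesis
      proof eventually_elim
        case (elim n)
        have "cmod (cnj w - cnj z) < 2 / real (n + 1)" if "cmod (w - z) < 2 / real (n + 1)" for z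
          using that by (simp only: complex_mod_cnj flip: complex_cnj_diff)
        thus ?case using elim complete by blast
      qed
    qed
  qed
  show "grid_volume planar (n + 1) (Q n) \<le> pseudo_volume planar \<epsilon> A"
    "(\<lambda>n. grid_volume planar (n + 1) (Q n)) \<longlonglongrightarrow> pseudo_volume planar \<epsilon> A"
    using grid_volume_approximation[OF lmeasurable_pseudospectrum[OF A e] lmeasurable_real_pseudospectrum[OF A e], of Q planar] s c
    by auto
qed

lemma norm_square_less_iff:
  fixes y x :: ell2
  shows "(norm y)\<^sup>2 < (max r 0)\<^sup>2 * (norm x)\<^sup>2 \<longleftrightarrow> norm y < r * norm x"
proof -
  have "(norm y)\<^sup>2 < (max r 0)\<^sup>2 * (norm x)\<^sup>2 \<longleftrightarrow> norm y < max r 0 * norm x"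
    by (metis abs_le_square_iff abs_norm_cancel abs_of_nonneg linorder_not_le max.cobounded2 mult_nonneg_nonneg
        norm_ge_zero power_mult_distrib)
  also have "\<dots> \<longleftrightarrow> norm y < r * norm x"
  proof (cases "r \<ge> 0")
    case False
    hence "r * norm x \<le> 0" by (simp add: mult_le_0_iff)
    hence "r * norm x \<le> norm y" by (rule order.trans) simp
    thus ?thesis using False by (simp add: max_def not_less)
  qed simp
  finally show ?thesis .
qed

text \<open>The squared radius of the acceptance test. Cutting off at 0 before squaring makes a
  negative radius reject everything.\<close>

definition radius :: "real \<Rightarrow> real \<Rightarrow> nat \<Rightarrow> real" where
  "radius \<epsilon> c n = (max (\<epsilon> - 2 / real (n + 1) - c) 0)\<^sup>2"

lemma accepts_iff:
  "accepts (n + 1) T T' (radius \<epsilon> c n) z \<longleftrightarrow> (\<exists>k<test_count (n + 1).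
     norm (T (gauss_vec (n + 1) k) - z *\<^sub>C gauss_vec (n + 1) k) < (\<epsilon> - 2 / real (n + 1) - c) * norm (gauss_vec (n + 1) k) \<or>
     norm (T' (gauss_vec (n + 1) k) - cnj z *\<^sub>C gauss_vec (n + 1) k) < (\<epsilon> - 2 / real (n + 1) - c) * norm (gauss_vec (n + 1) k))"
  unfolding accepts_def radius_def norm_square_less_iff ..

text \<open>A known bound c on the error made by working with T in place of A is compensated by
  reducing the radius by c.\<close>

lemma grid_volume_known_error:
  fixes A :: operator and T T' :: "nat \<Rightarrow> operator"
  assumes A: "A \<in> Omega_B" and e: "\<epsilon> > 0" and c: "c \<longlonglongrightarrow> 0"
    and T: "\<And>n k. norm (A (gauss_vec (n + 1) k) - T n (gauss_vec (n + 1) k)) \<le> c n * norm (gauss_vec (n + 1) k)"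
    and T': "\<And>n k. norm (adj A (gauss_vec (n + 1) k) - T' n (gauss_vec (n + 1) k)) \<le> c n * norm (gauss_vec (n + 1) k)"
  shows "grid_volume planar (n + 1) (accepts (n + 1) (T n) (T' n) (radius \<epsilon> (c n) n)) \<le> pseudo_volume planar \<epsilon> A"
    and "(\<lambda>n. grid_volume planar (n + 1) (accepts (n + 1) (T n) (T' n) (radius \<epsilon> (c n) n)))
      \<longlonglongrightarrow> pseudo_volume planar \<epsilon> A"
proof -
  have close: "residual B z y \<le> residual B' z y + t" if "norm (B y - B' y) \<le> t" for B B' :: operator and z y t
    using norm_triangle_ineq[of "B y - B' y" "B' y - z *\<^sub>C y"] that by simp
  have close': "residual B' z y \<le> residual B z y + t" if "norm (B y - B' y) \<le> t" for B B' :: operator and z y t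
    using close[of B' y B] that by (simp add: norm_minus_commute)
  have sound: "\<exists>x. x \<noteq> 0 \<and> (residual A z x \<le> (\<epsilon> - 2 / real (n + 1)) * norm x \<or>
        residual (adj A) (cnj z) x \<le> (\<epsilon> - 2 / real (n + 1)) * norm x)"
    if acc: "accepts (n + 1) (T n) (T' n) (radius \<epsilon> (c n) n) z" for n z
  proof -
    obtain k where k: "norm (T n (gauss_vec (n + 1) k) - z *\<^sub>C gauss_vec (n + 1) k) < (\<epsilon> - 2 / real (n + 1) - c n) * norm (gauss_vec (n + 1) k) \<or>
     norm (T' n (gauss_vec (n + 1) k) - cnj z *\<^sub>C gauss_vec (n + 1) k) < (\<epsilon> - 2 / real (n + 1) - c n) * norm (gauss_vec (n + 1) k)"
      using acc unfolding accepts_iff by blast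
    define y where "y = gauss_vec (n + 1) k"
    have "y \<noteq> 0" using k unfolding y_def[symmetric] by (auto simp: scaleC.zero_right)
    moreover have "residual A z y \<le> (\<epsilon> - 2 / real (n + 1)) * norm y \<or>
        residual (adj A) (cnj z) y \<le> (\<epsilon> - 2 / real (n + 1)) * norm y"
      using k close[OF T[of n k], of z] close[OF T'[of n k], of "cnj z"] unfolding y_def[symmetric] left_diff_distrib
      by linarith
    ultimately show ?thesis by blast
  qed
  have complete: "accepts (n + 1) (T n) (T' n) (radius \<epsilon> (c n) n) z"
    if "k < test_count (n + 1)"
      "norm (A (gauss_vec (n + 1) k) - z *\<^sub>C gauss_vec (n + 1) k) < (\<epsilon> - 2 / real (n + 1) - 2 * c n) * norm (gauss_vec (n + 1) k) \<or>
       norm (adj A (gauss_vec (n + 1) k) - cnj z *\<^sub>C gauss_vec (n + 1) k) < (\<epsilon> - 2 / real (n + 1) - 2 * c n) * norm (gauss_vec (n + 1) k)"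
    for n z k
    unfolding accepts_iff
    by (rule exI[of _ k])
      (use that close'[OF T[of n k], of z] close'[OF T'[of n k], of "cnj z"] in \<open>unfold left_diff_distrib, auto\<close>)
  \<comment> \<open>the error counts twice here: it reduces the radius, and it is made when A is replaced by T\<close>
  have "(\<lambda>n. 2 * c n) \<longlonglongrightarrow> 0" using tendsto_mult_right_zero[OF c, of 2] by simp
  note * = grid_volume_pseudospectrum[OF A e this, where Q = "\<lambda>n. accepts (n + 1) (T n) (T' n) (radius \<epsilon> (c n) n)"]
  show "grid_volume planar (n + 1) (accepts (n + 1) (T n) (T' n) (radius \<epsilon> (c n) n)) \<le> pseudo_volume planar \<epsilon> A"
    by (rule *(1)) (fact sound, fact complete)
  show "(\<lambda>n. grid_volume planar (n + 1) (accepts (n + 1) (T n) (T' n) (radius \<epsilon> (c n) n)))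
      \<longlonglongrightarrow> pseudo_volume planar \<epsilon> A"
    by (rule *(2)) (fact sound, fact complete)
qed

text \<open>Test vectors for N are in the range of \<open>P\<^sub>N\<close>. The adjoint estimate is that for the
  adjoint of \<open>P\<^sub>N A (I - P\<^sub>f\<^sub>(\<^sub>N\<^sub>))\<close>.\<close>

lemma dispersion_error:
  assumes A: "A \<in> Omega_B" and d: "dispersion f N A \<le> c"
  shows "norm (A (gauss_vec N k) - (proj (f N) o\<^sub>L A) (gauss_vec N k)) \<le> c * norm (gauss_vec N k)"
    and "norm (adj A (gauss_vec N k) - (proj (f N) o\<^sub>L adj A) (gauss_vec N k)) \<le> c * norm (gauss_vec N k)"
proof -
  define y where "y = gauss_vec N k"
  have y: "proj N y = y" by (rule ell2_eqI) (simp add: y_def coord_gauss_vec)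
  define E where "E = (id_blinfun - proj (f N)) o\<^sub>L A o\<^sub>L proj N"
  define E' where "E' = proj N o\<^sub>L A o\<^sub>L (id_blinfun - proj (f N))"
  have le: "norm E \<le> c" "norm E' \<le> c" using d by (auto simp: E_def E'_def dispersion_def)
  have "A y - (proj (f N) o\<^sub>L A) y = E y" by (simp add: E_def y blinfun.diff_left)
  thus "norm (A (gauss_vec N k) - (proj (f N) o\<^sub>L A) (gauss_vec N k)) \<le> c * norm (gauss_vec N k)"
    using norm_blinfun[of E y] mult_right_mono[OF le(1) norm_ge_zero[of y]] by (simp add: y_def)
  have E': "E' \<in> Omega_B" using A by (simp add: E'_def)
  have "adj E' = (id_blinfun - proj (f N)) o\<^sub>L (adj A o\<^sub>L proj N)"
    unfolding E'_def using A by (simp add: adj_comp adj_minus adj_id adj_proj)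
  hence "adj A y - (proj (f N) o\<^sub>L adj A) y = adj E' y" by (simp add: y blinfun.diff_left)
  thus "norm (adj A (gauss_vec N k) - (proj (f N) o\<^sub>L adj A) (gauss_vec N k)) \<le> c * norm (gauss_vec N k)"
    using norm_blinfun[of "adj E'" y] mult_right_mono[OF le(2) norm_ge_zero[of y]] norm_adj[OF E'] by (simp add: y_def)
qed

text \<open>Without any knowledge of the error, \<open>\<parallel>P\<^sub>M (A - z) x\<parallel>\<close> increases to its limit as M
  grows. A grid point can therefore change from accepted to rejected only once; the inner
  limit exists and keeps those points that are never rejected.\<close>

lemma norm_proj_shift_mono:
  assumes "N \<le> M" "M \<le> M'"
  shows "norm ((proj M o\<^sub>L A) (gauss_vec N k) - z *\<^sub>C gauss_vec N k) \<le> norm ((proj M' o\<^sub>L A) (gauss_vec N k) - z *\<^sub>C gauss_vec N k)"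
    and "norm ((proj M o\<^sub>L A) (gauss_vec N k) - z *\<^sub>C gauss_vec N k) \<le> norm (A (gauss_vec N k) - z *\<^sub>C gauss_vec N k)"
proof -
  have eq: "(proj M o\<^sub>L A) (gauss_vec N k) - z *\<^sub>C gauss_vec N k = proj M (A (gauss_vec N k) - z *\<^sub>C gauss_vec N k)"
    if "N \<le> M" for M
    using that by (intro ell2_eqI) (simp add: coord_gauss_vec)
  show "norm ((proj M o\<^sub>L A) (gauss_vec N k) - z *\<^sub>C gauss_vec N k) \<le> norm ((proj M' o\<^sub>L A) (gauss_vec N k) - z *\<^sub>C gauss_vec N k)"
    using assms by (simp only: eq norm_proj_mono order.trans[OF assms])
  show "norm ((proj M o\<^sub>L A) (gauss_vec N k) - z *\<^sub>C gauss_vec N k) \<le> norm (A (gauss_vec N k) - z *\<^sub>C gauss_vec N k)"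
    using assms by (simp only: eq norm_proj_le)
qed

definition accepts_truncated :: "real \<Rightarrow> operator \<Rightarrow> nat \<Rightarrow> nat \<Rightarrow> complex \<Rightarrow> bool" where
  "accepts_truncated \<epsilon> A n m = accepts (n + 1) (proj (n + 1 + m) o\<^sub>L A) (proj (n + 1 + m) o\<^sub>L adj A) (radius \<epsilon> 0 n)"

abbreviation outer_volume :: "bool \<Rightarrow> real \<Rightarrow> operator \<Rightarrow> nat \<Rightarrow> real" where
  "outer_volume planar \<epsilon> A n \<equiv> grid_volume planar (n + 1) (\<lambda>z. \<forall>m. accepts_truncated \<epsilon> A n m z)"

lemma accepts_truncated_antimono:
  assumes acc: "accepts_truncated \<epsilon> A n m' z" and m: "m \<le> m'"
  shows "accepts_truncated \<epsilon> A n m z"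
proof -
  have le: "norm ((proj (n + 1 + m) o\<^sub>L B) (gauss_vec (n + 1) k) - w *\<^sub>C gauss_vec (n + 1) k)
      \<le> norm ((proj (n + 1 + m') o\<^sub>L B) (gauss_vec (n + 1) k) - w *\<^sub>C gauss_vec (n + 1) k)" for B k w
    by (rule norm_proj_shift_mono) (use m in auto)
  show ?thesis using acc unfolding accepts_truncated_def accepts_iff by (meson le order.strict_trans1)
qed

lemma grid_volume_inner_limit:
  assumes anti: "\<And>m m' z. m \<le> m' \<Longrightarrow> R m' z \<Longrightarrow> R m z"
  shows "(\<lambda>m. grid_volume planar N (R m)) \<longlonglongrightarrow> grid_volume planar N (\<lambda>z. \<forall>m. R m z)"
proof -
  have "\<forall>\<^sub>F m in sequentially. R m z \<longleftrightarrow> (\<forall>m. R m z)" for z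
  proof (cases "\<forall>m. R m z")
    case False
    then obtain m0 where "\<not> R m0 z" by blast
    hence "\<not> R m z" if "m \<ge> m0" for m using anti that by blast
    thus ?thesis using False by (auto simp: eventually_sequentially)
  qed simp
  hence "\<forall>\<^sub>F m in sequentially. \<forall>c\<in>grid_indices planar N. R m (grid_point planar N c) \<longleftrightarrow> (\<forall>m. R m (grid_point planar N c))"
    by (intro eventually_ball_finite) (auto simp: grid_indices_def)
  hence "\<forall>\<^sub>F m in sequentially. grid_volume planar N (R m) = grid_volume planar N (\<lambda>z. \<forall>m. R m z)"
  proof eventually_elim
    case (elim m)
    hence "{c \<in> grid_indices planar N. R m (grid_point planar N c)} = {c \<in> grid_indices planar N. \<forall>m. R m (grid_point planar N c)}"
      by auto
    thus ?case by (simp add: grid_volume_def)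
  qed
  thus ?thesis by (rule tendsto_eventually)
qed

text \<open>A point that is never rejected is sound: finitely many test vectors are available,
  so one of them works for infinitely many, hence by monotonicity for all, truncations, and
  the strict inequalities become a weak one in the limit.\<close>

lemma grid_volume_truncated:
  assumes A: "A \<in> Omega_B" and e: "\<epsilon> > 0"
  shows "outer_volume planar \<epsilon> A n \<le> pseudo_volume planar \<epsilon> A"
    and "(\<lambda>n. outer_volume planar \<epsilon> A n) \<longlonglongrightarrow> pseudo_volume planar \<epsilon> A"
proof -
  have sound: "\<exists>x. x \<noteq> 0 \<and> (residual A z x \<le> (\<epsilon> - 2 / real (n + 1)) * norm x \<or>
        residual (adj A) (cnj z) x \<le> (\<epsilon> - 2 / real (n + 1)) * norm x)"
    if acc: "\<forall>m. accepts_truncated \<epsilon> A n m z" for n z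
  proof -
    define r where "r = \<epsilon> - 2 / real (n + 1)"
    define y where "y k = gauss_vec (n + 1) k" for k
    define h where "h B w k m \<longleftrightarrow> norm ((proj (n + 1 + m) o\<^sub>L B) (y k) - w *\<^sub>C y k) < r * norm (y k)"
      for B :: operator and w k m
    define K where "K = test_count (n + 1)"
    have ex: "\<exists>k<K. h A z k m \<or> h (adj A) (cnj z) k m" for m
      using acc unfolding accepts_truncated_def accepts_iff h_def y_def r_def K_def by auto
    have anti: "h B w k m" if "h B w k m'" "m \<le> m'" for B w k m m'
      using that norm_proj_shift_mono(1)[of "n + 1" "n + 1 + m" "n + 1 + m'" B k w] unfolding h_def y_def by auto
    have "\<exists>k<K. (\<forall>m. h A z k m) \<or> (\<forall>m. h (adj A) (cnj z) k m)"
    proof (rule ccontr)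
      assume neg: "\<not> ?thesis"
      have "\<forall>\<^sub>F m in sequentially. \<not> h A z k m \<and> \<not> h (adj A) (cnj z) k m" if kK: "k < K" for k
      proof -
        obtain m1 m2 where "\<not> h A z k m1" "\<not> h (adj A) (cnj z) k m2" using neg kK by blast
        thus ?thesis unfolding eventually_sequentially by (intro exI[of _ "max m1 m2"]) (meson anti max.boundedE)
      qed
      hence "\<forall>\<^sub>F m in sequentially. \<forall>k\<in>{..<K}. \<not> h A z k m \<and> \<not> h (adj A) (cnj z) k m"
        by (intro eventually_ball_finite) auto
      thus False using ex by (auto simp: eventually_sequentially)
    qed
    then obtain k where k: "(\<forall>m. h A z k m) \<or> (\<forall>m. h (adj A) (cnj z) k m)" by blast
    have lim: "norm (B (y k) - w *\<^sub>C y k) \<le> r * norm (y k)" if all: "\<forall>m. h B w k m" for B w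
    proof (rule tendsto_upperbound)
      have "(\<lambda>m. proj (m + (n + 1)) (B (y k))) \<longlonglongrightarrow> B (y k)"
        by (intro LIMSEQ_ignore_initial_segment proj_tendsto)
      hence "(\<lambda>m. norm (proj (m + (n + 1)) (B (y k)) - w *\<^sub>C y k)) \<longlonglongrightarrow> norm (B (y k) - w *\<^sub>C y k)"
        by (rule tendsto_norm[OF tendsto_diff[OF _ tendsto_const]])
      thus "(\<lambda>m. norm ((proj (n + 1 + m) o\<^sub>L B) (y k) - w *\<^sub>C y k)) \<longlonglongrightarrow> norm (B (y k) - w *\<^sub>C y k)"
        by (simp add: add.commute)
      show "\<forall>\<^sub>F m in sequentially. norm ((proj (n + 1 + m) o\<^sub>L B) (y k) - w *\<^sub>C y k) \<le> r * norm (y k)"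
        using all by (intro always_eventually allI) (simp add: h_def less_imp_le)
    qed simp
    have "y k \<noteq> 0"
    proof
      assume "y k = 0"
      hence "\<not> h B w k 0" for B w by (simp add: h_def)
      thus False using k by blast
    qed
    thus ?thesis using k lim unfolding r_def by blast
  qed
  have complete: "\<forall>m. accepts_truncated \<epsilon> A n m z"
    if k: "k < test_count (n + 1)" and
      less: "norm (A (gauss_vec (n + 1) k) - z *\<^sub>C gauss_vec (n + 1) k) < (\<epsilon> - 2 / real (n + 1) - 0) * norm (gauss_vec (n + 1) k) \<or>
       norm (adj A (gauss_vec (n + 1) k) - cnj z *\<^sub>C gauss_vec (n + 1) k) < (\<epsilon> - 2 / real (n + 1) - 0) * norm (gauss_vec (n + 1) k)"
    for n z k
  proof
    fix m
    have "norm ((proj (n + 1 + m) o\<^sub>L B) (gauss_vec (n + 1) k) - w *\<^sub>C gauss_vec (n + 1) k)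
        \<le> norm (B (gauss_vec (n + 1) k) - w *\<^sub>C gauss_vec (n + 1) k)" for B w
      by (rule norm_proj_shift_mono(2)[of _ _ "n + 1 + m"]) auto
    thus "accepts_truncated \<epsilon> A n m z"
      unfolding accepts_truncated_def accepts_iff using k less by (meson order.strict_trans1)
  qed
  note * = grid_volume_pseudospectrum[OF A e tendsto_const, where Q = "\<lambda>n z. \<forall>m. accepts_truncated \<epsilon> A n m z"]
  show "outer_volume planar \<epsilon> A n \<le> pseudo_volume planar \<epsilon> A"
    by (rule *(1)) (fact sound, fact complete)
  show "(\<lambda>n. outer_volume planar \<epsilon> A n) \<longlonglongrightarrow> pseudo_volume planar \<epsilon> A"
    by (rule *(2)) (fact sound, fact complete)
qed

subsection \<open>Entries, Gram matrices and radii as expressions\<close>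

abbreviation "entryE \<equiv> Query2 Entry (Var 5) (Var 6)"
abbreviation "adj_entryE \<equiv> Conj (Query2 Entry (Var 6) (Var 5))"

definition truncated_GramE :: "label expr \<Rightarrow> label expr" where
  "truncated_GramE M = Fold False M
     (Bin Times (Query2 Entry (Var 7) (Var 6)) (Conj (Query2 Entry (Var 7) (Var 5))))"

definition truncated_adj_GramE :: "label expr \<Rightarrow> label expr" where
  "truncated_adj_GramE M = Fold False M
     (Bin Times (Conj (Query2 Entry (Var 6) (Var 7))) (Query2 Entry (Var 5) (Var 7)))"

definition radiusE :: "real \<Rightarrow> label expr \<Rightarrow> label expr" where
  "radiusE \<epsilon> c = (let r = Bin Minus (Bin Minus (Lit \<epsilon> 0) (Bin Quot (Lit 2 0) sizeE)) c
     in IfNeg r zeroE (Bin Times r r))"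

lemma eval_radiusE:
  assumes "eval orc (of_nat n # env) ce = complex_of_real c"
  shows "eval orc (of_nat n # env) (radiusE \<epsilon> ce) = complex_of_real (radius \<epsilon> c n)"
proof -
  have lit: "Complex t 0 = complex_of_real t" for t by (simp add: complex_eq_iff)
  define r :: "label expr" where "r = Bin Minus (Bin Minus (Lit \<epsilon> 0) (Bin Quot (Lit 2 0) sizeE)) ce"
  define t where "t = \<epsilon> - 2 / real (n + 1) - c"
  have "eval orc (of_nat n # env) r = complex_of_real t"
    by (simp add: r_def t_def assms lit add.commute)
  hence "eval orc (of_nat n # env) (IfNeg r zeroE (Bin Times r r)) = complex_of_real ((max t 0)\<^sup>2)"
    by (simp add: max_def power2_eq_square)
  thus ?thesis by (simp only: radiusE_def Let_def r_def t_def radius_def)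
qed

lemma cinner_truncated:
  "\<llangle>(proj M o\<^sub>L A) x, (proj M o\<^sub>L A) y\<rrangle> = (\<Sum>k<M. coord (A x) k * cnj (coord (A y) k))"
  unfolding cinner_def by (subst suminf_finite[of "{..<M}"]) auto

lemma addr_of_nat [simp]: "addr (real i) = i"
  by (simp add: addr_def)

text \<open>The Gram matrix of \<open>P\<^sub>M A\<close> is a finite sum of products of entries of A. The
  condition \<open>n + 1 \<le> M\<close> makes the relevant entries of \<open>P\<^sub>M A\<close> agree with those of A.\<close>

lemma eval_volumeE_truncated:
  assumes A: "A \<in> Omega_B" and entry: "\<And>i j. orc Entry [i, j] = \<llangle>A (basis_vec j), basis_vec i\<rrangle>"
    and M: "\<And>xs. eval orc ([of_nat n, of_nat m] @ xs) Me = of_nat M" "n + 1 \<le> M"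
    and c: "\<And>xs. eval orc ([of_nat n, of_nat m] @ xs) ce = complex_of_real c"
  shows "eval orc [of_nat n, of_nat m]
      (volumeE planar entryE (truncated_GramE Me) adj_entryE (truncated_adj_GramE Me) (radiusE \<epsilon> ce))
    = complex_of_real (grid_volume planar (n + 1)
        (accepts (n + 1) (proj M o\<^sub>L A) (proj M o\<^sub>L adj A) (radius \<epsilon> c n)))"
proof (rule eval_volumeE)
  fix p q k i j :: nat
  let ?env = "[of_nat n, of_nat m, of_nat p, of_nat q, of_nat k, of_nat i, of_nat j] :: complex list"
  have Me: "eval orc ?env Me = of_nat M" using M(1)[of "[_, _, _, _, _]"] by simp
  show "eval orc ?env (truncated_GramE Me) = \<llangle>(proj M o\<^sub>L A) (basis_vec j), (proj M o\<^sub>L A) (basis_vec i)\<rrangle>"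
    unfolding cinner_truncated truncated_GramE_def by (simp add: Me entry cinner_basis_vec)
  show "eval orc ?env (truncated_adj_GramE Me) = \<llangle>(proj M o\<^sub>L adj A) (basis_vec j), (proj M o\<^sub>L adj A) (basis_vec i)\<rrangle>"
    unfolding cinner_truncated truncated_adj_GramE_def
    by (simp add: Me entry cinner_basis_vec coord_adj_basis_vec[OF A])
  assume "i \<le> n" "j \<le> n"
  hence "i < M" using M(2) by simp
  thus "eval orc ?env entryE = \<llangle>(proj M o\<^sub>L A) (basis_vec j), basis_vec i\<rrangle>"
    and "eval orc ?env adj_entryE = \<llangle>(proj M o\<^sub>L adj A) (basis_vec j), basis_vec i\<rrangle>"
    by (simp_all add: entry cinner_basis_vec coord_adj_basis_vec[OF A])
next
  show "eval orc ([of_nat n, of_nat m] @ xs) (radiusE \<epsilon> ce) = complex_of_real (radius \<epsilon> c n)" for xs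
    using eval_radiusE[of orc n "of_nat m # xs" ce c] c[of xs] by simp
qed (use A in auto)

lemma eval_volumeE_Gram:
  assumes A: "A \<in> Omega_B" and entry: "\<And>i j. orc Entry [i, j] = \<llangle>A (basis_vec j), basis_vec i\<rrangle>"
    and gram: "\<And>i j. orc Gram [i, j] = \<llangle>A (basis_vec j), A (basis_vec i)\<rrangle>"
    and adj_gram: "\<And>i j. orc AdjGram [i, j] = \<llangle>adj A (basis_vec j), adj A (basis_vec i)\<rrangle>"
  shows "eval orc [of_nat n, of_nat m]
      (volumeE planar entryE (Query2 Gram (Var 5) (Var 6)) adj_entryE (Query2 AdjGram (Var 5) (Var 6)) (radiusE \<epsilon> zeroE))
    = complex_of_real (grid_volume planar (n + 1) (accepts (n + 1) A (adj A) (radius \<epsilon> 0 n)))"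
proof (rule eval_volumeE)
  show "eval orc ([of_nat n, of_nat m] @ xs) (radiusE \<epsilon> zeroE) = complex_of_real (radius \<epsilon> 0 n)" for xs
    using eval_radiusE[of orc n "of_nat m # xs" zeroE 0] by simp
qed (use A in \<open>auto simp: entry gram adj_gram cinner_basis_vec coord_adj_basis_vec\<close>)

lemma literals_expressions:
  assumes "literals M \<subseteq> \<rat>" "literals c \<subseteq> \<rat>"
  shows "literals (volumeE planar entryE (truncated_GramE M) adj_entryE (truncated_adj_GramE M) (radiusE \<epsilon> c)) \<subseteq> \<rat> \<union> {\<epsilon>}"
    and "literals (volumeE planar entryE (Query2 Gram (Var 5) (Var 6)) adj_entryE (Query2 AdjGram (Var 5) (Var 6)) (radiusE \<epsilon> c)) \<subseteq> \<rat> \<union> {\<epsilon>}"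
  by (rule order.trans[OF literals_volumeE];
      use assms in \<open>auto simp: truncated_GramE_def truncated_adj_GramE_def radiusE_def Let_def\<close>)+

lemma closed_below_expressions:
  assumes "closed_below 7 M" "closed_below 5 c"
  shows "closed_below 2 (volumeE planar entryE (truncated_GramE M) adj_entryE (truncated_adj_GramE M) (radiusE \<epsilon> c))"
    and "closed_below 2 (volumeE planar entryE (Query2 Gram (Var 5) (Var 6)) adj_entryE (Query2 AdjGram (Var 5) (Var 6)) (radiusE \<epsilon> c))"
  by (rule closed_below_volumeE; use assms in \<open>simp add: truncated_GramE_def truncated_adj_GramE_def radiusE_def Let_def\<close>)+


section \<open>Upper bounds\<close>

lemma grid_volume_nonneg: "0 \<le> grid_volume planar N Q"
  by (simp add: grid_volume_def)

text \<open>The second variable of the expression is 0 when there is a single index.\<close>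

lemma in_SCI_Sigma_1:
  fixes P :: "('a, label) problem"
  assumes P: "computational_problem P" "evaluations P \<noteq> {}"
    and e: "closed_below 2 e" "literals e \<subseteq> \<rat> \<union> K"
    and eval: "\<And>X n m. X \<in> Dom P \<Longrightarrow> eval (oracle_of P X) [of_nat n, of_nat m] e = complex_of_real (v X n m)"
    and v: "\<And>X n m. X \<in> Dom P \<Longrightarrow> 0 \<le> v X n m" "\<And>X n. X \<in> Dom P \<Longrightarrow> v X n 0 \<le> Xi P X"
      "\<And>X. X \<in> Dom P \<Longrightarrow> (\<lambda>n. v X n 0) \<longlonglongrightarrow> Xi P X"
  shows "P \<in> SCI_Sigma (Arithmetic K) 1"
proof -
  define \<Gamma> where "\<Gamma> ns X = Re (eval (oracle_of P X) (input_env ns) e)" for ns X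
  have env: "input_env ns = [of_nat (ns ! 0), of_nat (if length ns = 1 then 0 else ns ! 1)]" for ns
    by (simp add: input_env_def)
  have \<Gamma>: "\<Gamma> ns X = v X (ns ! 0) (if length ns = 1 then 0 else ns ! 1)" if "X \<in> Dom P" for ns X
    unfolding \<Gamma>_def env eval[OF that] by simp
  have "algorithms (Arithmetic K) P 1 \<Gamma>"
    by (rule algorithms_eval[OF e _ P(2)]) (use v(1) \<Gamma> in \<open>auto simp: \<Gamma>_def[symmetric]\<close>)
  hence "tower (Arithmetic K) P 1 \<Gamma>"
    unfolding tower_def using v by (auto simp: \<Gamma>)
  thus ?thesis
    unfolding SCI_Sigma_def SCI_Delta_def using P(1) v(2) by (auto simp: \<Gamma> intro!: exI[of _ 1] exI[of _ \<Gamma>])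
qed

lemma in_SCI_Sigma_2:
  fixes P :: "('a, label) problem"
  assumes P: "computational_problem P" "evaluations P \<noteq> {}"
    and e: "closed_below 2 e" "literals e \<subseteq> \<rat> \<union> K"
    and eval: "\<And>X n m. X \<in> Dom P \<Longrightarrow> eval (oracle_of P X) [of_nat n, of_nat m] e = complex_of_real (v X n m)"
    and v: "\<And>X n m. X \<in> Dom P \<Longrightarrow> 0 \<le> v X n m" "\<And>X n. X \<in> Dom P \<Longrightarrow> (\<lambda>m. v X n m) \<longlonglongrightarrow> u X n"
      "\<And>X n. X \<in> Dom P \<Longrightarrow> u X n \<le> Xi P X" "\<And>X. X \<in> Dom P \<Longrightarrow> (\<lambda>n. u X n) \<longlonglongrightarrow> Xi P X"
  shows "P \<in> SCI_Sigma (Arithmetic K) 2"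
proof -
  define \<Gamma> where "\<Gamma> ns X = (if length ns = 1 then u X (ns ! 0) else Re (eval (oracle_of P X) (input_env ns) e))" for ns X
  have env: "input_env ns = [of_nat (ns ! 0), of_nat (if length ns = 1 then 0 else ns ! 1)]" for ns
    by (simp add: input_env_def)
  have ev: "Re (eval (oracle_of P X) (input_env ns) e) = v X (ns ! 0) (if length ns = 1 then 0 else ns ! 1)"
    if "X \<in> Dom P" for ns X
    unfolding env eval[OF that] by simp
  have u: "0 \<le> u X n" if "X \<in> Dom P" for X n
    by (rule LIMSEQ_le_const[OF v(2)[OF that]]) (use v(1)[OF that] in auto)
  have "algorithms (Arithmetic K) P 2 \<Gamma>"
    by (rule algorithms_eval[OF e _ P(2)]) (use v(1) ev in \<open>auto simp: \<Gamma>_def\<close>)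
  moreover have "(\<lambda>m. \<Gamma> (ns @ [m]) X) \<longlonglongrightarrow> \<Gamma> ns X" if X: "X \<in> Dom P" and ns: "1 \<le> length ns" "length ns < 2" for X ns
  proof -
    obtain n where "ns = [n]" using ns by (cases ns) auto
    thus ?thesis using v(2)[OF X, of n] by (simp add: \<Gamma>_def ev[OF X])
  qed
  ultimately have "tower (Arithmetic K) P 2 \<Gamma>"
    unfolding tower_def using v u by (auto simp: \<Gamma>_def ev)
  thus ?thesis
    unfolding SCI_Sigma_def SCI_Delta_def using P(1) v(3)
    by (auto simp: \<Gamma>_def intro!: exI[of _ 2] exI[of _ \<Gamma>])
qed

lemma Leb_as_region_volume:
  "Leb_pseudospectrum \<epsilon> A = region_volume True (pseudospectrum \<epsilon> A)"
  "LebR_pseudospectrum \<epsilon> A = region_volume False (pseudospectrum \<epsilon> A)"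
  by (simp_all add: Leb_pseudospectrum_def LebR_pseudospectrum_def region_volume_def)

lemma region_volume_nonneg: "0 \<le> region_volume planar S"
  by (simp add: region_volume_def)

lemma operator_eq_if_entries:
  fixes A B :: operator
  assumes "A \<in> Omega_B" "B \<in> Omega_B"
    and "\<And>i j. \<llangle>A (basis_vec j), basis_vec i\<rrangle> = \<llangle>B (basis_vec j), basis_vec i\<rrangle>"
  shows "A = B"
  by (rule Omega_B_eqI[OF assms(1,2)]) (use assms(3) in \<open>auto simp: cinner_basis_vec intro: ell2_eqI\<close>)

lemma Lambda1_cases:
  assumes "Lambda1 op l w = Some h"
  obtains i j where "h = (\<lambda>X. \<llangle>op X (basis_vec j), basis_vec i\<rrangle>)"
  using assms that by (cases "(op, l, w)" rule: Lambda1.cases) auto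

lemma Lambda2_cases:
  assumes "Lambda2 op l w = Some h"
  obtains i j where "h = (\<lambda>X. \<llangle>op X (basis_vec j), basis_vec i\<rrangle>)"
  | i j where "h = (\<lambda>X. \<llangle>op X (basis_vec j), op X (basis_vec i)\<rrangle>)"
  | i j where "h = (\<lambda>X. \<llangle>adj (op X) (basis_vec j), adj (op X) (basis_vec i)\<rrangle>)"
  using assms that by (cases "(op, l, w)" rule: Lambda2.cases) (auto elim!: Lambda1_cases)

lemma add_f_cases:
  assumes "add_f f \<Lambda> l w = Some h"
  obtains n where "h = (\<lambda>_. of_nat (f n))" | n where "h = (\<lambda>X. of_rat (snd X n))" | "\<Lambda> l w = Some h"
  using assms that by (cases "(f, \<Lambda>, l, w)" rule: add_f.cases) auto

lemma add_g_cases: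
  assumes "add_g g \<Lambda> l w = Some h"
  obtains c where "h = (\<lambda>_. c)" | "\<Lambda> l w = Some h"
  using assms that by (cases "(g, \<Lambda>, l, w)" rule: add_g.cases) auto

lemma evaluationsI: "Lam P l w = Some h \<Longrightarrow> h \<in> evaluations P"
  by (auto simp: evaluations_def)

lemma complex_of_rat: "(of_rat r :: complex) = complex_of_real (of_rat r)"
  by (cases r) (simp add: of_rat_rat)

subsection \<open>Known dispersion\<close>

abbreviation (input) Omega_f_problem ::
  "real \<Rightarrow> (nat \<Rightarrow> nat) \<Rightarrow> ((operator \<times> (nat \<Rightarrow> rat) \<Rightarrow> operator) \<Rightarrow> (operator \<times> (nat \<Rightarrow> rat), label) evals)
    \<Rightarrow> (operator \<times> (nat \<Rightarrow> rat), label) problem" where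
  "Omega_f_problem \<epsilon> f \<Lambda> \<equiv> \<lparr>Xi = \<lambda>X. Leb_pseudospectrum \<epsilon> (fst X), Dom = Omega_f f, Lam = add_f f (\<Lambda> fst)\<rparr>"

text \<open>The expression uses \<open>P\<^sub>M A\<close> with \<open>M = f(N)\<close> and reduces the radius by the bound
  \<open>c\<^sub>N\<close>.\<close>

lemma Omega_f_in_Sigma_1:
  assumes e: "\<epsilon> > 0" and f: "\<And>n. n + 1 \<le> f n" and \<Lambda>: "\<Lambda> \<in> {Lambda1, Lambda2}"
  shows "Omega_f_problem \<epsilon> f \<Lambda> \<in> SCI_Sigma (Arithmetic {\<epsilon>}) 1"
proof -
  let ?P = "Omega_f_problem \<epsilon> f \<Lambda>"
  let ?e = "volumeE True entryE (truncated_GramE (Query1 F_val sizeE)) adj_entryE (truncated_adj_GramE (Query1 F_val sizeE))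
    (radiusE \<epsilon> (Query1 C_val sizeE)) :: label expr"
  have entry: "Lam ?P Entry [i, j] = Some (\<lambda>X. \<llangle>blinfun_apply (fst X) (basis_vec j), basis_vec i\<rrangle>)" for i j
    using \<Lambda> by auto
  define v where "v X n m = grid_volume True (n + 1) (accepts (n + 1) (proj (f (n + 1)) o\<^sub>L fst X) (proj (f (n + 1)) o\<^sub>L adj (fst X))
      (radius \<epsilon> (of_rat (snd X (n + 1))) n))" for X :: "operator \<times> (nat \<Rightarrow> rat)" and n m :: nat
  have AB: "fst X \<in> Omega_B" if "X \<in> Omega_f f" for X using that by (auto simp: Omega_f_def)
  have bounds: "v X n 0 \<le> Leb_pseudospectrum \<epsilon> (fst X)" "(\<lambda>n. v X n 0) \<longlonglongrightarrow> Leb_pseudospectrum \<epsilon> (fst X)"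
    if X: "X \<in> Omega_f f" for X n
  proof -
    have disp: "dispersion f (n + 1) (fst X) \<le> of_rat (snd X (n + 1))" for n
      using X by (auto simp: Omega_f_def)
    have lim: "(\<lambda>n. real_of_rat (snd X (n + 1))) \<longlonglongrightarrow> 0"
      using X by (intro LIMSEQ_ignore_initial_segment) (auto simp: Omega_f_def)
    note * = grid_volume_known_error[OF AB[OF X] e lim dispersion_error(1)[OF AB[OF X] disp] dispersion_error(2)[OF AB[OF X] disp]]
    show "v X n 0 \<le> Leb_pseudospectrum \<epsilon> (fst X)" "(\<lambda>n. v X n 0) \<longlonglongrightarrow> Leb_pseudospectrum \<epsilon> (fst X)"
      unfolding v_def Leb_as_region_volume by (rule *)+
  qed
  show ?thesis
  proof (rule in_SCI_Sigma_1[where e = ?e and v = v])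
    have "X = Y" if X: "X \<in> Omega_f f" and Y: "Y \<in> Omega_f f" and eq: "\<forall>h\<in>evaluations ?P. h X = h Y" for X Y
    proof (rule prod_eqI)
      show "fst X = fst Y"
        by (rule operator_eq_if_entries[OF AB[OF X] AB[OF Y]]) (rule bspec[OF eq evaluationsI[OF entry]])
      have "Lam ?P C_val [n] = Some (\<lambda>X. of_rat (snd X n))" for n by simp
      from bspec[OF eq evaluationsI[OF this]] have "(of_rat (snd X n) :: complex) = of_rat (snd Y n)" for n .
      thus "snd X = snd Y" by (intro ext) (simp add: of_rat_eq_iff)
    qed
    thus "computational_problem ?P"
      unfolding computational_problem_def by (auto simp: Leb_as_region_volume region_volume_nonneg)
    show "evaluations ?P \<noteq> {}" using evaluationsI[OF entry] by blast
    show "closed_below 2 ?e" by (rule closed_below_expressions) auto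
    show "literals ?e \<subseteq> \<rat> \<union> {\<epsilon>}" by (rule literals_expressions) auto
    fix X n m assume "X \<in> Dom ?P"
    hence X: "X \<in> Omega_f f" by simp
    have size: "addr (Re (eval (oracle_of ?P X) ([of_nat n, of_nat m] @ xs) sizeE)) = n + 1" for xs
      by (simp add: addr_def nat_add_distrib)
    show "eval (oracle_of ?P X) [of_nat n, of_nat m] ?e = complex_of_real (v X n m)"
      unfolding v_def
    proof (rule eval_volumeE_truncated[OF AB[OF X]])
      show "oracle_of ?P X Entry [i, j] = \<llangle>fst X (basis_vec j), basis_vec i\<rrangle>" for i j
        unfolding oracle_of_def entry by simp
      show "eval (oracle_of ?P X) ([of_nat n, of_nat m] @ xs) (Query1 F_val sizeE) = of_nat (f (n + 1))" for xs
        unfolding eval.simps(7) size by (simp add: oracle_of_def)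
      show "eval (oracle_of ?P X) ([of_nat n, of_nat m] @ xs) (Query1 C_val sizeE) = complex_of_real (of_rat (snd X (n + 1)))" for xs
        unfolding eval.simps(7) size by (simp add: oracle_of_def complex_of_rat)
      show "n + 1 \<le> f (n + 1)" using f[of "n + 1"] by simp
    qed
  qed (use bounds in \<open>auto simp: v_def grid_volume_nonneg\<close>)
qed

subsection \<open>Operators as inputs\<close>

text \<open>In the remaining problems the inputs are operators. Which upper bound holds depends
  on whether Gram matrices are among the evaluations and on whether all inputs are diagonal.\<close>

locale operator_problem =
  fixes P :: "(operator, label) problem" and \<epsilon> :: real and planar :: bool
  assumes eps: "\<epsilon> > 0" and dom: "Dom P \<subseteq> Omega_B"
    and Xi: "Xi P = (\<lambda>A. pseudo_volume planar \<epsilon> A)"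
    and entry: "\<And>i j. Lam P Entry [i, j] = Some (\<lambda>A :: operator. \<llangle>A (basis_vec j), basis_vec i\<rrangle>)"
begin

lemma computational_problem_P: "computational_problem P"
  and evaluations_nonempty: "evaluations P \<noteq> {}"
proof -
  have "A = B" if "A \<in> Dom P" "B \<in> Dom P" and eq: "\<forall>h\<in>evaluations P. h A = h B" for A B
  proof (rule operator_eq_if_entries)
    show "A \<in> Omega_B" "B \<in> Omega_B" using dom that by auto
  qed (rule bspec[OF eq evaluationsI[OF entry]])
  thus "computational_problem P"
    unfolding computational_problem_def by (auto simp: Xi region_volume_nonneg)
  show "evaluations P \<noteq> {}" using evaluationsI[OF entry] by blast
qed

lemma oracle_Entry: "oracle_of P A Entry [i, j] = \<llangle>A (basis_vec j), basis_vec i\<rrangle>"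
  by (simp add: oracle_of_def entry)

abbreviation "truncated_volumeE \<equiv> volumeE planar entryE (truncated_GramE (Bin Plus sizeE (Var 1))) adj_entryE
    (truncated_adj_GramE (Bin Plus sizeE (Var 1))) (radiusE \<epsilon> zeroE)"

lemma truncated_volumeE_expression:
  "closed_below 2 truncated_volumeE" "literals truncated_volumeE \<subseteq> \<rat> \<union> {\<epsilon>}"
  by (rule closed_below_expressions; simp) (rule literals_expressions; simp)

lemma eval_truncated_volumeE:
  assumes "A \<in> Dom P"
  shows "eval (oracle_of P A) [of_nat n, of_nat m] truncated_volumeE
    = complex_of_real (grid_volume planar (n + 1) (accepts_truncated \<epsilon> A n m))"
  unfolding accepts_truncated_def
  by (rule eval_volumeE_truncated) (use assms dom oracle_Entry in auto)

lemma in_Sigma_2: "P \<in> SCI_Sigma (Arithmetic {\<epsilon>}) 2"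
proof (rule in_SCI_Sigma_2[where e = truncated_volumeE and v = "\<lambda>A n m. grid_volume planar (n + 1) (accepts_truncated \<epsilon> A n m)"
      and u = "\<lambda>A n. outer_volume planar \<epsilon> A n"])
  fix A n assume "A \<in> Dom P"
  hence A: "A \<in> Omega_B" using dom by blast
  show "(\<lambda>m. grid_volume planar (n + 1) (accepts_truncated \<epsilon> A n m))
      \<longlonglongrightarrow> outer_volume planar \<epsilon> A n"
    by (rule grid_volume_inner_limit[OF accepts_truncated_antimono])
  show "outer_volume planar \<epsilon> A n \<le> Xi P A"
    "(\<lambda>n. outer_volume planar \<epsilon> A n) \<longlonglongrightarrow> Xi P A"
    unfolding Xi by (rule grid_volume_truncated[OF A eps])+
qed (use computational_problem_P evaluations_nonempty truncated_volumeE_expression eval_truncated_volumeE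
    in \<open>auto simp: grid_volume_nonneg\<close>)

text \<open>For diagonal operators the truncation to the size of the test vectors makes no
  error, so the expression for two limits, with the inner parameter frozen at 0, is an
  algorithm with one limit.\<close>

lemma in_Sigma_1_if_diagonal:
  assumes diag: "Dom P \<subseteq> Omega_D"
  shows "P \<in> SCI_Sigma (Arithmetic {\<epsilon>}) 1"
proof (rule in_SCI_Sigma_1[where e = truncated_volumeE and v = "\<lambda>A n m. grid_volume planar (n + 1) (accepts_truncated \<epsilon> A n m)"])
  fix A n assume AP: "A \<in> Dom P"
  hence A: "A \<in> Omega_B" using dom by blast
  have disp: "dispersion (\<lambda>n. n) (n + 1) A \<le> 0" for n
    using dispersion_Omega_D[of A "n + 1" "\<lambda>n. n"] AP diag by auto
  note * = grid_volume_known_error[OF A eps tendsto_const dispersion_error(1)[OF A disp] dispersion_error(2)[OF A disp]]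
  show "grid_volume planar (n + 1) (accepts_truncated \<epsilon> A n 0) \<le> Xi P A"
    "(\<lambda>n. grid_volume planar (n + 1) (accepts_truncated \<epsilon> A n 0)) \<longlonglongrightarrow> Xi P A"
    unfolding Xi accepts_truncated_def add_0_right by (rule *)+
qed (use computational_problem_P evaluations_nonempty truncated_volumeE_expression eval_truncated_volumeE
    in \<open>auto simp: grid_volume_nonneg\<close>)

text \<open>The Gram matrices give exact norms of \<open>(A - z) x\<close> and \<open>(A\<^sup>* - cnj z) x\<close> for test
  vectors x.\<close>

lemma in_Sigma_1_if_Gram:
  assumes gram: "\<And>i j. Lam P Gram [i, j] = Some (\<lambda>A :: operator. \<llangle>A (basis_vec j), A (basis_vec i)\<rrangle>)"
    and adj_gram: "\<And>i j. Lam P AdjGram [i, j] = Some (\<lambda>A :: operator. \<llangle>adj A (basis_vec j), adj A (basis_vec i)\<rrangle>)"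
  shows "P \<in> SCI_Sigma (Arithmetic {\<epsilon>}) 1"
proof (rule in_SCI_Sigma_1[where v = "\<lambda>A n m. grid_volume planar (n + 1) (accepts (n + 1) A (adj A) (radius \<epsilon> 0 n))"])
  let ?e = "volumeE planar entryE (Query2 Gram (Var 5) (Var 6)) adj_entryE (Query2 AdjGram (Var 5) (Var 6)) (radiusE \<epsilon> zeroE)"
  show "closed_below 2 ?e" by (rule closed_below_expressions[where M = oneE]) auto
  show "literals ?e \<subseteq> \<rat> \<union> {\<epsilon>}" by (rule literals_expressions[where M = oneE]) auto
  fix A n m assume "A \<in> Dom P"
  hence A: "A \<in> Omega_B" using dom by blast
  show "eval (oracle_of P A) [of_nat n, of_nat m] ?e
      = complex_of_real (grid_volume planar (n + 1) (accepts (n + 1) A (adj A) (radius \<epsilon> 0 n)))"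
    by (rule eval_volumeE_Gram[OF A]) (simp_all add: oracle_of_def entry gram adj_gram)
  note * = grid_volume_known_error[OF A eps tendsto_const, where T = "\<lambda>_. A" and T' = "\<lambda>_. adj A"]
  show "grid_volume planar (n + 1) (accepts (n + 1) A (adj A) (radius \<epsilon> 0 n)) \<le> Xi P A"
    "(\<lambda>n. grid_volume planar (n + 1) (accepts (n + 1) A (adj A) (radius \<epsilon> 0 n))) \<longlonglongrightarrow> Xi P A"
    unfolding Xi by (rule *; simp)+
qed (use computational_problem_P evaluations_nonempty in \<open>auto simp: grid_volume_nonneg\<close>)

end


section \<open>The classification\<close>

lemma counts_eigenvalues_region_volume:
  assumes "\<epsilon> > 0"
  shows "counts_eigenvalues \<epsilon> (\<lambda>A. pseudo_volume planar \<epsilon> A)"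
  using counts_eigenvalues_Leb[OF assms] counts_eigenvalues_LebR[OF assms]
  by (cases planar) (auto simp: Leb_as_region_volume[abs_def])

lemma block_diagonal:
  assumes "\<And>i. \<bar>a i\<bar> \<le> K"
  shows "block a 0 id K"
proof -
  have "0 \<le> K" using assms[of 0] by linarith
  thus ?thesis using assms by unfold_locales auto
qed

lemma operator_evaluation_Lambda:
  assumes "\<Lambda> \<in> {Lambda1, Lambda2}" "\<Lambda> op l w = Some h" "\<And>A. op (emb A) = A"
  shows "operator_evaluation emb h"
proof -
  have "Lambda1 op l w = Some h \<or> Lambda2 op l w = Some h" using assms(1,2) by auto
  thus ?thesis
  proof
    assume "Lambda1 op l w = Some h"
    then obtain i j where "h = (\<lambda>X. \<llangle>blinfun_apply (op X) (basis_vec j), basis_vec i\<rrangle>)" by (rule Lambda1_cases)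
    hence "\<forall>A. h (emb A) = \<llangle>A (basis_vec j), basis_vec i\<rrangle>" by (simp add: assms(3))
    thus ?thesis unfolding operator_evaluation_def by blast
  next
    assume "Lambda2 op l w = Some h"
    thus ?thesis
    proof (cases rule: Lambda2_cases)
      case (1 i j)
      hence "\<forall>A. h (emb A) = \<llangle>A (basis_vec j), basis_vec i\<rrangle>" by (simp add: assms(3))
      thus ?thesis unfolding operator_evaluation_def by blast
    next
      case (2 i j)
      hence "\<forall>A. h (emb A) = \<llangle>A (basis_vec j), A (basis_vec i)\<rrangle>" by (simp add: assms(3))
      thus ?thesis unfolding operator_evaluation_def by blast
    next
      case (3 i j)
      hence "\<forall>A. h (emb A) = \<llangle>adj A (basis_vec j), adj A (basis_vec i)\<rrangle>" by (simp add: assms(3))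
      thus ?thesis unfolding operator_evaluation_def by blast
    qed
  qed
qed

lemma Omega_f_not_Delta_1:
  assumes e: "\<epsilon> > 0" and f: "\<And>n. n + 1 \<le> f n" and \<Lambda>: "\<Lambda> \<in> {Lambda1, Lambda2}"
  shows "Omega_f_problem \<epsilon> f \<Lambda> \<notin> SCI_Delta General 1"
proof (rule not_Delta1_if_diagonal[OF e counts_eigenvalues_Leb[OF e], where emb = "\<lambda>A. (A, \<lambda>_. 0)"])
  fix a :: "nat \<Rightarrow> real" and K assume a: "\<And>i. \<bar>a i\<bar> \<le> K"
  have D: "block_op a 0 id \<in> Omega_D" by (rule block_op_in_Omega_D[OF a])
  have "dispersion f n (block_op a 0 id) = 0" for n
    by (rule dispersion_Omega_D[OF D]) (use f[of n] in simp)
  thus "(block_op a 0 id, \<lambda>_. 0) \<in> Dom (Omega_f_problem \<epsilon> f \<Lambda>)"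
    using D by (simp add: Omega_f_def Omega_D_def Omega_SA_def)
next
  fix h assume "h \<in> evaluations (Omega_f_problem \<epsilon> f \<Lambda>)"
  then obtain l w where "add_f f (\<Lambda> fst) l w = Some h" by (auto simp: evaluations_def)
  thus "operator_evaluation (\<lambda>A. (A, \<lambda>_. 0)) h"
  proof (cases rule: add_f_cases)
    case 3
    thus ?thesis by (rule operator_evaluation_Lambda[OF \<Lambda>]) simp
  qed (auto simp: operator_evaluation_def)
qed simp

abbreviation (input) classified ::
  "real \<Rightarrow> (operator \<Rightarrow> real) \<Rightarrow> operator set \<Rightarrow> ((operator, label) evals \<Rightarrow> (operator, label) evals) \<Rightarrow> bool" where
  "classified \<epsilon> \<Xi> \<Omega> ext \<equiv>
    \<lparr>Xi = \<Xi>, Dom = \<Omega>, Lam = ext (Lambda1 id)\<rparr> \<in> SCI_Sigma (Arithmetic {\<epsilon>}) 2 - SCI_Delta General 2 \<and>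
    \<lparr>Xi = \<Xi>, Dom = \<Omega>, Lam = ext (Lambda2 id)\<rparr> \<in> SCI_Sigma (Arithmetic {\<epsilon>}) 1 - SCI_Delta General 1"

lemma classes_subset_Omega_B:
  shows Omega_SA_subset: "Omega_SA \<subseteq> Omega_B" and Omega_N_subset: "Omega_N \<subseteq> Omega_B"
    and Omega_g_subset: "Omega_g g \<subseteq> Omega_B"
  by (auto simp: Omega_SA_def Omega_N_def Omega_g_def)

text \<open>The lower bounds only use block operators, and constant evaluations, such as the
  values of g, carry no information on the operator.\<close>

lemma operator_class_classification:
  fixes \<Omega> :: "operator set" and extend :: "(operator, label) evals \<Rightarrow> (operator, label) evals"
  assumes e: "\<epsilon> > 0" and dom: "\<Omega> \<subseteq> Omega_B"
    and blocks: "\<And>a s \<tau> K. block a s \<tau> K \<Longrightarrow> block_op a s \<tau> \<in> \<Omega>"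
    and extend: "\<And>\<Lambda> l w. l \<noteq> G_val \<Longrightarrow> extend \<Lambda> l w = \<Lambda> l w"
      "\<And>\<Lambda> l w h. extend \<Lambda> l w = Some h \<Longrightarrow> \<Lambda> l w = Some h \<or> (\<exists>c. h = (\<lambda>_. c))"
    and Xi: "\<Xi> = (\<lambda>A. pseudo_volume planar \<epsilon> A)"
  shows "classified \<epsilon> \<Xi> \<Omega> extend"
proof -
  let ?P1 = "\<lparr>Xi = \<Xi>, Dom = \<Omega>, Lam = extend (Lambda1 id)\<rparr>" and ?P2 = "\<lparr>Xi = \<Xi>, Dom = \<Omega>, Lam = extend (Lambda2 id)\<rparr>"
  interpret P1: operator_problem ?P1 \<epsilon> planar
    by unfold_locales (use e dom in \<open>auto simp: Xi extend(1)\<close>)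
  interpret P2: operator_problem ?P2 \<epsilon> planar
    by unfold_locales (use e dom in \<open>auto simp: Xi extend(1)\<close>)
  have count: "counts_eigenvalues \<epsilon> \<Xi>" unfolding Xi by (rule counts_eigenvalues_region_volume[OF e])
  have "?P2 \<in> SCI_Sigma (Arithmetic {\<epsilon>}) 1"
    by (rule P2.in_Sigma_1_if_Gram) (simp_all add: extend(1))
  moreover have "?P2 \<notin> SCI_Delta General 1"
  proof (rule not_Delta1_if_diagonal[OF e count, where emb = "\<lambda>A. A"])
    fix a :: "nat \<Rightarrow> real" and K assume "\<And>i. \<bar>a i\<bar> \<le> K"
    thus "block_op a 0 id \<in> Dom ?P2" using blocks[OF block_diagonal[of a K]] by simp
  next
    fix h assume "h \<in> evaluations ?P2"
    then obtain l w where "extend (Lambda2 id) l w = Some h" by (auto simp: evaluations_def)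
    from extend(2)[OF this] show "operator_evaluation (\<lambda>A. A) h"
      using operator_evaluation_Lambda[of Lambda2 id l w h "\<lambda>A. A"] by (auto simp: operator_evaluation_def)
  qed simp
  moreover have "?P1 \<notin> SCI_Delta General 2"
  proof (rule not_Delta2_if_block_operators[OF e])
    show "counts_eigenvalues \<epsilon> (Xi ?P1)" using count by simp
    show "block_op a s \<tau> \<in> Dom ?P1" if "block a s \<tau> K" for a s \<tau> K using blocks[OF that] by simp
    fix h assume "h \<in> evaluations ?P1"
    then obtain l w where "extend (Lambda1 id) l w = Some h" by (auto simp: evaluations_def)
    from extend(2)[OF this] show "(\<exists>i j. \<forall>A :: operator. h A = \<llangle>A (basis_vec j), basis_vec i\<rrangle>) \<or> (\<exists>c. \<forall>A. h A = c)"
    proof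
      assume "Lambda1 id l w = Some h"
      then obtain i j where "h = (\<lambda>X. \<llangle>blinfun_apply (id X) (basis_vec j), basis_vec i\<rrangle>)" by (rule Lambda1_cases)
      hence "\<forall>A :: operator. h A = \<llangle>A (basis_vec j), basis_vec i\<rrangle>" by simp
      thus ?thesis by blast
    qed blast
  qed
  ultimately show ?thesis using P1.in_Sigma_2 by blast
qed

lemma diagonal_class_classification:
  assumes e: "\<epsilon> > 0" and \<Lambda>: "\<Lambda> \<in> {Lambda1, Lambda2}"
  shows "\<lparr>Xi = LebR_pseudospectrum \<epsilon>, Dom = Omega_D, Lam = \<Lambda> id\<rparr> \<in> SCI_Sigma (Arithmetic {\<epsilon>}) 1 - SCI_Delta General 1"
proof -
  let ?P = "\<lparr>Xi = LebR_pseudospectrum \<epsilon>, Dom = Omega_D, Lam = \<Lambda> id\<rparr>"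
  interpret operator_problem ?P \<epsilon> False
    by unfold_locales (use e \<Lambda> in \<open>auto simp: Leb_as_region_volume Omega_D_def Omega_SA_def\<close>)
  have "?P \<notin> SCI_Delta General 1"
  proof (rule not_Delta1_if_diagonal[OF e counts_eigenvalues_LebR[OF e], where emb = "\<lambda>A. A"])
    fix a :: "nat \<Rightarrow> real" and K assume "\<And>i. \<bar>a i\<bar> \<le> K"
    thus "block_op a 0 id \<in> Dom ?P" using block_op_in_Omega_D[of a K] by simp
  next
    fix h assume "h \<in> evaluations ?P"
    then obtain l w where "\<Lambda> id l w = Some h" by (auto simp: evaluations_def)
    thus "operator_evaluation (\<lambda>A. A) h" by (rule operator_evaluation_Lambda[OF \<Lambda>]) simp
  qed simp
  thus ?thesis using in_Sigma_1_if_diagonal by simp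
qed

theorem theorem3p14:
  fixes \<epsilon> :: real and f :: "nat \<Rightarrow> nat" and g :: "real \<Rightarrow> real"
  assumes "\<epsilon> > 0"
    and "\<And>n. n + 1 \<le> f n"
    and "g \<in> {0..} \<rightarrow> {0..}"
    and "strict_mono_on {0..} g"
    and "continuous_on {0..} g"
    and "\<And>x. 0 \<le> x \<Longrightarrow> g x = 0 \<longleftrightarrow> x = 0"
    and "filterlim g at_top at_top"
    and "Omega_g g \<noteq> {}"
  shows
    "(\<forall>\<Lambda>\<in>{Lambda1, Lambda2}.
        \<lparr>Xi = \<lambda>X. Leb_pseudospectrum \<epsilon> (fst X), Dom = Omega_f f, Lam = add_f f (\<Lambda> fst)\<rparr>
          \<in> SCI_Sigma (Arithmetic {\<epsilon>}) 1 - SCI_Delta General 1) \<and>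
     (\<forall>\<Lambda>\<in>{Lambda1, Lambda2}.
        \<lparr>Xi = LebR_pseudospectrum \<epsilon>, Dom = Omega_D, Lam = \<Lambda> id\<rparr>
          \<in> SCI_Sigma (Arithmetic {\<epsilon>}) 1 - SCI_Delta General 1) \<and>
     (\<forall>(\<Xi>, \<Omega>, extend) \<in>
        {(Leb_pseudospectrum \<epsilon>, Omega_B, id),
         (LebR_pseudospectrum \<epsilon>, Omega_SA, id),
         (Leb_pseudospectrum \<epsilon>, Omega_N, id),
         (Leb_pseudospectrum \<epsilon>, Omega_g g, add_g g)}.
        \<lparr>Xi = \<Xi>, Dom = \<Omega>, Lam = extend (Lambda1 id)\<rparr>
          \<in> SCI_Sigma (Arithmetic {\<epsilon>}) 2 - SCI_Delta General 2 \<and>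
        \<lparr>Xi = \<Xi>, Dom = \<Omega>, Lam = extend (Lambda2 id)\<rparr>
          \<in> SCI_Sigma (Arithmetic {\<epsilon>}) 1 - SCI_Delta General 1)"
proof -
  note eps = assms(1)
  have Leb: "Leb_pseudospectrum \<epsilon> = (\<lambda>A. region_volume True (pseudospectrum \<epsilon> A))"
    and LebR: "LebR_pseudospectrum \<epsilon> = (\<lambda>A. region_volume False (pseudospectrum \<epsilon> A))"
    by (simp_all add: fun_eq_iff Leb_as_region_volume)
  have g: "g x \<le> x" if "0 \<le> x" for x
    using Omega_g_nonempty_imp_le[OF assms(8) that] .
  have extend_g: "add_g g \<Lambda> l w = \<Lambda> l w" if "l \<noteq> G_val" for \<Lambda> l w
    using that by (cases "(g, \<Lambda>, l, w)" rule: add_g.cases) auto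
  have extend_g': "\<Lambda> l w = Some h \<or> (\<exists>c. h = (\<lambda>_. c))" if "add_g g \<Lambda> l w = Some h" for \<Lambda> l w h
    using that by (cases rule: add_g_cases) auto
  have B: "classified \<epsilon> (Leb_pseudospectrum \<epsilon>) Omega_B id"
    by (rule operator_class_classification[OF eps _ _ _ _ Leb]) (auto intro: block.block_op_in_Omega_B)
  have SA: "classified \<epsilon> (LebR_pseudospectrum \<epsilon>) Omega_SA id"
    by (rule operator_class_classification[OF eps _ _ _ _ LebR])
      (use Omega_SA_subset in \<open>auto intro: block.block_op_in_Omega_SA\<close>)
  have N: "classified \<epsilon> (Leb_pseudospectrum \<epsilon>) Omega_N id"
    by (rule operator_class_classification[OF eps _ _ _ _ Leb])
      (use Omega_N_subset in \<open>auto intro: block.block_op_in_Omega_N\<close>)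
  have G: "classified \<epsilon> (Leb_pseudospectrum \<epsilon>) (Omega_g g) (add_g g)"
    by (rule operator_class_classification[OF eps _ _ _ _ Leb])
      (use Omega_g_subset extend_g extend_g' in \<open>auto intro: block.block_op_in_Omega_g g\<close>)
  show ?thesis
    using Omega_f_in_Sigma_1[OF eps assms(2)] Omega_f_not_Delta_1[OF eps assms(2)]
      diagonal_class_classification[OF eps] B SA N G
    by blast
qed

end
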